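(* Let $\Gamma_{0,3}=\pi_1(\Sigma_{0,3})=\langle\alpha,\beta\rangle$ be the fundamental group of the pair of pants and $W_3=\langle s_1,s_2,s_3\mid s_1^2=s_2^2=s_3^2=1\rangle$. Let $\phi:\Gamma_{0,3}\to W_3$ be the homomorphism with $\phi(\alpha)=s_1s_2$, $\phi(\beta)=s_2s_3$. Let $\widetilde\rho\in\mathrm{Hom}^{\max}(W_3,\mathrm{PSp}^\pm(4,\mathbb R))$. Then the representation $\rho:=\widetilde\rho|_{\mathrm{Im}(\phi)}$ (that is, $\rho=\widetilde\rho\circ\phi$) belongs to $\mathrm{Hom}^{\max,\mathrm{Shilov}}(\Gamma_{0,3},\mathrm{PSp}(4,\mathbb R))$.
   Context: $\mathrm{Sp}(4,\mathbb R)$ preserves the symplectic form with matrix $J=\begin{pmatrix}0&\mathrm{Id}\\-\mathrm{Id}&0\end{pmatrix}$; $\mathrm{Sp}^-(4,\mathbb R)=\{M:M^TJM=-J\}$ (antisymplectic), $\mathrm{Sp}^\pm=\mathrm{Sp}\cup\mathrm{Sp}^-$, $\mathrm{PSp}=\mathrm{Sp}/\{\pm\mathrm{Id}\}$, $\mathrm{PSp}^\pm=\mathrm{Sp}^\pm/\{\pm\mathrm{Id}\}$. $\mathcal X=\{X+iY: X\in\mathrm{Sym}(2,\mathbb R),\,Y\in\mathrm{Sym}^+(2,\mathbb R)\}$ is the Siegel space. A reflection of $\mathcal X$ is an antisymplectic $R$ with $R^2=\mathrm{Id}$. $\mathcal L(\mathbb R^4)$ is the set of Lagrangians; a real symmetric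 matrix $X$ denotes the Lagrangian spanned by the columns of $\binom{X}{\mathrm{Id}}$, $\infty=\langle e_1,e_2\rangle$. A triple of pairwise transverse Lagrangians is maximal if it is in the $\mathrm{Sp}(4,\mathbb R)$-orbit of $(\infty,0,\mathrm{Id})$; an $m$-tuple is maximal if all subtriples with increasing indices are. Cross-ratio: $R(l_1,l_2,l_3,l_4)=p_{l_1}^{\|l_2}\circ p_{l_4}^{\|l_3}|_{l_1}$ ($p_l^{\|l'}$ = projection to $l$ parallel to $l'$). The $\mathbb R$-tube of transverse Lagrangians $a,b$ is $\mathcal Y_{a,b}=\{l\in\mathcal X:R(a,l,\overline l,b)=-\mathrm{Id}\}$ (points $Z\in\mathcal X$ seen as complex Lagrangians via $\binom Z{\mathrm{Id}}$); if $(a,c,b,d)$ is maximal, $\mathcal Y_{a,b}\perp\mathcal Y_{c,d}$ (orthogonal submanifolds) iff $R(a,c,b,d)=2\mathrm{Id}$. A representation $\rho:W_3\to\mathrm{PSp}^\pm(4,\mathbb R)$ is maximal (set $\mathrm{Hom}^{\max}(W_3,\mathrm{PSp}^\pm(4,\mathbb R))$) if there is a maximal 6-tuple of Lagrangians $(P_1,P_2,Q_1,Q_2,R_1,R_2)$ such that $\rho(s_1),\rho(s_2),\rho(s_3)$ are reflections fixing $(P_1,P_2)$, $(Q_1,Q_2)$, $(R_1,R_2)$ respectively, and $\rho(s_1)X_1=X_2$, $\rho(s_1)Z_1=Z_2$, $\rho(s_2)X_1=X_2$, $\rho(s_2)Y_1=Y_2$, $\rho(s_3)Y_1=Y_2$,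 $\rho(s_3)Z_1=Z_2$, where $X_i,Y_i,Z_i$ are determined by $\mathcal Y_{P_1,P_2}\perp\mathcal Y_{X_1,X_2}\perp\mathcal Y_{Q_1,Q_2}\perp\mathcal Y_{Y_1,Y_2}\perp\mathcal Y_{R_1,R_2}\perp\mathcal Y_{Z_1,Z_2}\perp\mathcal Y_{P_1,P_2}$ (with $(X_1,X_2,Y_1,Y_2,Z_1,Z_2)$ maximal). $\Sigma_{0,3}$ is the oriented sphere with three boundary components; $\alpha,\beta,(\alpha\beta)^{-1}$ represent its boundary components, oriented so that the surface lies to the right of the boundary. Fix a finite-area hyperbolization, inducing an action of $\Gamma_{0,3}$ on $S^1=\partial\mathbb H^2$. A representation $\rho:\Gamma_{0,3}\to\mathrm{PSp}(4,\mathbb R)$ is maximal if there is a $\rho$-equivariant map $\xi:S^1\to\mathcal L(\mathbb R^4)$ that is monotone (positively oriented triples go to maximal triples) and right continuous. An element of $\mathrm{PSp}(4,\mathbb R)$ is Shilov hyperbolic if it is conjugate to $\begin{pmatrix}A&0\\0&A^{-T}\end{pmatrix}$ with $A\in\mathrm{GL}(2,\mathbb R)$ all of whose complex eigenvalues have modulus $>1$. $\mathrm{Hom}^{\max,\mathrm{Shilov}}(\Gamma_{0,3},\mathrm{PSp}(4,\mathbb R))$ is the set of maximal $\rho$ such that $\rho(\gamma)$ is Shilov hyperbolic for every (nontrivial) $\gamma\in\Gamma_{0,3}$. *)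

theory Defs
  imports
    "HOL-Analysis.Analysis"
    "HOL-Algebra.Group_Action"
    "HOL-Complex_Analysis.Riemann_Mapping"
begin

text \<open>A word is a list of letters \<^term>\<open>(s, True)\<close>, standing for the generator \<open>s\<close>, and
  \<^term>\<open>(s, False)\<close>, standing for its inverse.\<close>

type_synonym 's word = "('s \<times> bool) list"

inductive word_eq :: "'s word set \<Rightarrow> 's word \<Rightarrow> 's word \<Rightarrow> bool" for R where
  refl: "word_eq R u u"
| sym: "word_eq R u v \<Longrightarrow> word_eq R v u"
| trans: "word_eq R u v \<Longrightarrow> word_eq R v w \<Longrightarrow> word_eq R u w"
| append: "word_eq R u u' \<Longrightarrow> word_eq R v v' \<Longrightarrow> word_eq R (u @ v) (u' @ v')"
| cancel: "word_eq R [(s, b), (s, \<not> b)] []"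
| relator: "r \<in> R \<Longrightarrow> word_eq R r []"

definition word_class :: "'s word set \<Rightarrow> 's word \<Rightarrow> 's word set" where
  "word_class R u = {v. word_eq R u v}"

definition presented_group :: "'s word set \<Rightarrow> 's word set monoid" where
  "presented_group R =
     \<lparr>carrier = range (word_class R),
      monoid.mult = (\<lambda>A B. {w. \<exists>u\<in>A. \<exists>v\<in>B. word_eq R (u @ v) w}),
      one = word_class R []\<rparr>"

definition gen :: "'s word set \<Rightarrow> 's \<Rightarrow> 's word set" where
  "gen R s = word_class R [(s, True)]"

lemma word_class_eq_iff: "word_class R u = word_class R v \<longleftrightarrow> word_eq R u v"
  unfolding word_class_def by (blast intro: word_eq.intros)

lemma mult_presented_group:
  "word_class R u \<otimes>\<^bsub>presented_group R\<^esub> word_class R v = word_class R (u @ v)"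
  unfolding presented_group_def word_class_def
  by (auto intro: word_eq.intros)

lemma word_eq_inverse: "word_eq R (rev (map (\<lambda>(s, b). (s, \<not> b)) u) @ u) []"
proof (induction u)
  case Nil
  show ?case by (simp add: word_eq.refl)
next
  case (Cons a u)
  obtain s b where a: "a = (s, b)" by (cases a)
  let ?i = "rev (map (\<lambda>(s, b). (s, \<not> b)) u)"
  have "word_eq R ([(s, \<not> b), (s, \<not> \<not> b)] @ u) ([] @ u)"
    by (intro word_eq.append word_eq.cancel word_eq.refl)
  then have "word_eq R (?i @ [(s, \<not> b), (s, b)] @ u) (?i @ u)"
    by (intro word_eq.append[OF word_eq.refl]) simp
  then show ?case
    using Cons.IH by (auto simp: a intro: word_eq.trans)
qed

lemma group_presented_group: "group (presented_group R)"
proof (rule groupI)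
  fix x assume "x \<in> carrier (presented_group R)"
  then obtain u where u: "x = word_class R u"
    by (auto simp: presented_group_def)
  have "word_class R (rev (map (\<lambda>(s, b). (s, \<not> b)) u)) \<otimes>\<^bsub>presented_group R\<^esub> x
        = \<one>\<^bsub>presented_group R\<^esub>"
    unfolding u mult_presented_group
    by (simp add: presented_group_def word_class_eq_iff word_eq_inverse)
  then show "\<exists>y\<in>carrier (presented_group R). y \<otimes>\<^bsub>presented_group R\<^esub> x = \<one>\<^bsub>presented_group R\<^esub>"
    by (auto simp: presented_group_def)
next
  fix x y z
  assume "x \<in> carrier (presented_group R)" "y \<in> carrier (presented_group R)"
    "z \<in> carrier (presented_group R)"
  then obtain u v w where "x = word_class R u" "y = word_class R v" "z = word_class R w"
    by (auto simp: presented_group_def)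
  then show "x \<otimes>\<^bsub>presented_group R\<^esub> y \<otimes>\<^bsub>presented_group R\<^esub> z
      = x \<otimes>\<^bsub>presented_group R\<^esub> (y \<otimes>\<^bsub>presented_group R\<^esub> z)"
    by (simp add: mult_presented_group)
next
  fix x y
  assume "x \<in> carrier (presented_group R)" "y \<in> carrier (presented_group R)"
  then obtain u v where "x = word_class R u" "y = word_class R v"
    by (auto simp: presented_group_def)
  then show "x \<otimes>\<^bsub>presented_group R\<^esub> y \<in> carrier (presented_group R)"
    by (simp add: mult_presented_group) (simp add: presented_group_def)
next
  show "\<one>\<^bsub>presented_group R\<^esub> \<in> carrier (presented_group R)"
    by (simp add: presented_group_def)
next
  fix x assume "x \<in> carrier (presented_group R)"
  then obtain u where u: "x = word_class R u"
    by (auto simp: presented_group_def)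
  have "\<one>\<^bsub>presented_group R\<^esub> = word_class R []"
    by (simp add: presented_group_def)
  then show "\<one>\<^bsub>presented_group R\<^esub> \<otimes>\<^bsub>presented_group R\<^esub> x = x"
    by (simp add: u mult_presented_group)
qed

datatype pants_gen = Alpha | Beta
datatype W3_gen = S1 | S2 | S3

abbreviation W3_relators :: "W3_gen word set" where
  "W3_relators \<equiv> {[(s, True), (s, True)] | s. True}"

definition Gamma03 :: "pants_gen word set monoid" where
  "Gamma03 = presented_group {}"

definition \<alpha> :: "pants_gen word set" where "\<alpha> = gen {} Alpha"
definition \<beta> :: "pants_gen word set" where "\<beta> = gen {} Beta"

definition W3 :: "W3_gen word set monoid" where
  "W3 = presented_group W3_relators"

definition s1 :: "W3_gen word set" where "s1 = gen W3_relators S1"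
definition s2 :: "W3_gen word set" where "s2 = gen W3_relators S2"
definition s3 :: "W3_gen word set" where "s3 = gen W3_relators S3"

text \<open>\<open>R\<^sup>4\<close> is written as \<^typ>\<open>real ^ (2 + 2)\<close>: its coordinates are indexed by the disjoint sum of
  two copies of \<open>{1, 2}\<close>, so that \<open>2 + 2\<close> block decompositions can be written directly.\<close>

definition block_vec :: "'a ^ 2 \<Rightarrow> 'a ^ 2 \<Rightarrow> 'a ^ (2 + 2)" where
  "block_vec u v = (\<chi> k. case k of Inl i \<Rightarrow> u $ i | Inr i \<Rightarrow> v $ i)"

definition block_mat ::
  "'a ^ 2 ^ 2 \<Rightarrow> 'a ^ 2 ^ 2 \<Rightarrow> 'a ^ 2 ^ 2 \<Rightarrow> 'a ^ 2 ^ 2 \<Rightarrow> 'a ^ (2 + 2) ^ (2 + 2)" where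
  "block_mat A B C D =
     (\<chi> k. case k of Inl i \<Rightarrow> block_vec (A $ i) (B $ i) | Inr i \<Rightarrow> block_vec (C $ i) (D $ i))"

definition J :: "real ^ (2 + 2) ^ (2 + 2)" where
  "J = block_mat 0 (mat 1) (- mat 1) 0"

definition Sp :: "(real ^ (2 + 2) ^ (2 + 2)) set" where
  "Sp = {M. transpose M ** J ** M = J}"

definition Sp_minus :: "(real ^ (2 + 2) ^ (2 + 2)) set" where
  "Sp_minus = {M. transpose M ** J ** M = - J}"

definition Sp_group :: "(real ^ (2 + 2) ^ (2 + 2)) monoid" where
  "Sp_group = \<lparr>carrier = Sp, monoid.mult = (**), one = mat 1\<rparr>"

definition Sp_pm_group :: "(real ^ (2 + 2) ^ (2 + 2)) monoid" where
  "Sp_pm_group = \<lparr>carrier = Sp \<union> Sp_minus, monoid.mult = (**), one = mat 1\<rparr>"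

definition PSp :: "(real ^ (2 + 2) ^ (2 + 2)) set monoid" where
  "PSp = Sp_group Mod {mat 1, - mat 1}"

definition PSp_pm :: "(real ^ (2 + 2) ^ (2 + 2)) set monoid" where
  "PSp_pm = Sp_pm_group Mod {mat 1, - mat 1}"

lemma J_J: "J ** J = - mat 1"
  unfolding J_def block_mat_def block_vec_def matrix_matrix_mult_def mat_def
  by (auto simp: vec_eq_iff UNIV_Plus_UNIV[symmetric] sum.Plus sum_2 forall_2 split: sum.splits
      simp del: UNIV_Plus_UNIV)

lemma scaleR_matrix_mult: "(c *\<^sub>R A) ** B = c *\<^sub>R (A ** (B :: real ^ 'n ^ 'm))"
  by (simp add: matrix_matrix_mult_def vec_eq_iff sum_distrib_left mult.assoc)

lemma matrix_mult_scaleR: "A ** (c *\<^sub>R B) = c *\<^sub>R (A ** (B :: real ^ 'n ^ 'm))"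
  by (simp add: matrix_matrix_mult_def vec_eq_iff sum_distrib_left mult.left_commute)

lemma transpose_mat_1: "transpose (mat 1) = (mat 1 :: real ^ 'n ^ 'n)"
  by (simp add: transpose_mat)

lemma similitude_mult:
  assumes "transpose M ** J ** M = e *\<^sub>R J" "transpose N ** J ** N = f *\<^sub>R J"
  shows "transpose (M ** N) ** J ** (M ** N) = (e * f) *\<^sub>R J"
proof -
  have "transpose (M ** N) ** J ** (M ** N) = transpose N ** (transpose M ** J ** M) ** N"
    by (simp add: matrix_transpose_mul matrix_mul_assoc)
  also have "\<dots> = (e * f) *\<^sub>R J"
    by (simp add: assms scaleR_matrix_mult matrix_mult_scaleR)
  finally show ?thesis .
qed

lemma similitude_inverse:
  assumes M: "transpose M ** J ** M = e *\<^sub>R J" and e: "e * e = 1"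
  shows "\<exists>N. N ** M = mat 1 \<and> transpose N ** J ** N = e *\<^sub>R J"
proof -
  define N where "N = (- e) *\<^sub>R (J ** transpose M ** J)"
  have "N ** M = (- e) *\<^sub>R (J ** (transpose M ** J ** M))"
    unfolding N_def scaleR_matrix_mult by (simp add: matrix_mul_assoc)
  also have "\<dots> = mat 1"
    using e by (simp add: M matrix_mult_scaleR J_J)
  finally have NM: "N ** M = mat 1" .
  then have MN: "M ** N = mat 1"
    by (simp add: matrix_left_right_inverse)
  have "J = transpose (M ** N) ** J ** (M ** N)"
    by (simp add: MN transpose_mat_1)
  also have "\<dots> = transpose N ** (transpose M ** J ** M) ** N"
    by (simp add: matrix_transpose_mul matrix_mul_assoc)
  also have "\<dots> = e *\<^sub>R (transpose N ** J ** N)"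
    by (simp add: M scaleR_matrix_mult matrix_mult_scaleR)
  finally have "e *\<^sub>R J = e *\<^sub>R (e *\<^sub>R (transpose N ** J ** N))"
    by simp
  then have "e *\<^sub>R J = transpose N ** J ** N"
    using e by simp
  with NM show ?thesis by auto
qed

lemma Sp_pm_iff:
  "M \<in> Sp \<longleftrightarrow> transpose M ** J ** M = 1 *\<^sub>R J"
  "M \<in> Sp_minus \<longleftrightarrow> transpose M ** J ** M = (-1) *\<^sub>R J"
  by (simp_all add: Sp_def Sp_minus_def)

lemma group_Sp: "group Sp_group"
proof (rule groupI)
  fix x assume "x \<in> carrier Sp_group"
  then show "\<exists>y\<in>carrier Sp_group. y \<otimes>\<^bsub>Sp_group\<^esub> x = \<one>\<^bsub>Sp_group\<^esub>"
    using similitude_inverse[of x 1] by (auto simp: Sp_group_def Sp_pm_iff simp del: scaleR_one)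
next
  fix x y assume "x \<in> carrier Sp_group" "y \<in> carrier Sp_group"
  then show "x \<otimes>\<^bsub>Sp_group\<^esub> y \<in> carrier Sp_group"
    using similitude_mult[of x 1 y 1] by (simp add: Sp_group_def Sp_pm_iff)
qed (auto simp: Sp_group_def Sp_def transpose_mat_1 matrix_mul_assoc)

lemma group_Sp_pm: "group Sp_pm_group"
proof (rule groupI)
  fix x assume "x \<in> carrier Sp_pm_group"
  moreover have "\<exists>y\<in>Sp. y ** x = mat 1" if "x \<in> Sp"
    using similitude_inverse[of x 1] that unfolding Bex_def Sp_pm_iff by fastforce
  moreover have "\<exists>y\<in>Sp_minus. y ** x = mat 1" if "x \<in> Sp_minus"
    using similitude_inverse[of x "-1"] that unfolding Bex_def Sp_pm_iff by fastforce
  ultimately show "\<exists>y\<in>carrier Sp_pm_group. y \<otimes>\<^bsub>Sp_pm_group\<^esub> x = \<one>\<^bsub>Sp_pm_group\<^esub>"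
    by (auto simp: Sp_pm_group_def)
next
  fix x y assume "x \<in> carrier Sp_pm_group" "y \<in> carrier Sp_pm_group"
  then show "x \<otimes>\<^bsub>Sp_pm_group\<^esub> y \<in> carrier Sp_pm_group"
    using similitude_mult[of x 1 y 1] similitude_mult[of x 1 y "-1"]
      similitude_mult[of x "-1" y 1] similitude_mult[of x "-1" y "-1"]
    by (auto simp: Sp_pm_group_def Sp_pm_iff)
qed (auto simp: Sp_pm_group_def Sp_def transpose_mat_1 matrix_mul_assoc)

lemma minus_matrix_mult: "(- A) ** B = - (A ** (B :: real ^ 'n ^ 'm))"
  by (simp add: matrix_matrix_mult_def vec_eq_iff sum_negf)

lemma matrix_mult_minus: "A ** (- B) = - (A ** (B :: real ^ 'n ^ 'm))"
  by (simp add: matrix_matrix_mult_def vec_eq_iff sum_negf)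

lemma transpose_minus: "transpose (- A) = - transpose (A :: real ^ 'n ^ 'm)"
  by (simp add: transpose_def vec_eq_iff)

lemma center_normal:
  assumes "group G" and "monoid.mult G = (**)" and "\<one>\<^bsub>G\<^esub> = mat 1" and "- mat 1 \<in> carrier G"
  shows "normal {mat 1, - mat 1 :: real ^ 'n ^ 'n} G"
proof -
  interpret group G by fact
  have one: "mat 1 \<in> carrier G" using one_closed assms(3) by simp
  have "inv\<^bsub>G\<^esub> (mat 1) = mat 1" using inv_one assms(3) by simp
  moreover have "inv\<^bsub>G\<^esub> (- mat 1) = - mat 1"
    using assms by (intro inv_equality) (auto simp: minus_matrix_mult matrix_mult_minus)
  ultimately have "subgroup {mat 1, - mat 1} G"
    using assms one by (intro subgroupI) (auto simp: minus_matrix_mult matrix_mult_minus)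
  then show ?thesis
    by (intro normalI)
      (auto simp: r_coset_def l_coset_def assms minus_matrix_mult matrix_mult_minus)
qed

lemma group_PSp: "group PSp" and group_PSp_pm: "group PSp_pm"
  unfolding PSp_def PSp_pm_def
  by (intro normal.factorgroup_is_group center_normal group_Sp group_Sp_pm;
      simp add: Sp_group_def Sp_pm_group_def Sp_def transpose_minus transpose_mat_1
        minus_matrix_mult matrix_mult_minus)+

type_synonym lag = "(real ^ (2 + 2)) set"

definition Lagrangians :: "lag set" where
  "Lagrangians = {l. subspace l \<and> dim l = 2 \<and> (\<forall>u\<in>l. \<forall>v\<in>l. u \<bullet> (J *v v) = 0)}"

definition mat_lag :: "'a::comm_ring_1 ^ 2 ^ 2 \<Rightarrow> ('a ^ (2 + 2)) set" where
  "mat_lag X = range (\<lambda>w. block_vec (X *v w) w)"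

definition infinity_lag :: lag where
  "infinity_lag = range (\<lambda>w. block_vec w 0)"

text \<open>The action of an element of \<^term>\<open>PSp_pm\<close>, that is of a coset \<open>{M, - M}\<close>, on linear
  subspaces; both representatives give the same image.\<close>

definition act :: "(real ^ (2 + 2) ^ (2 + 2)) set \<Rightarrow> lag \<Rightarrow> lag" where
  "act g l = (\<Union>M\<in>g. (*v) M ` l)"

definition maximal_triple :: "lag \<Rightarrow> lag \<Rightarrow> lag \<Rightarrow> bool" where
  "maximal_triple l1 l2 l3 \<longleftrightarrow>
     {l1, l2, l3} \<subseteq> Lagrangians \<and>
     l1 \<inter> l2 = {0} \<and> l1 \<inter> l3 = {0} \<and> l2 \<inter> l3 = {0} \<and>
     (\<exists>M\<in>Sp. l1 = (*v) M ` infinity_lag \<and> l2 = (*v) M ` mat_lag 0 \<and> l3 = (*v) M ` mat_lag (mat 1))"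

definition maximal_tuple :: "lag list \<Rightarrow> bool" where
  "maximal_tuple ls \<longleftrightarrow>
     (\<forall>i j k. i < j \<and> j < k \<and> k < length ls \<longrightarrow> maximal_triple (ls ! i) (ls ! j) (ls ! k))"

text \<open>The Grassmannian topology, as the quotient topology from frames: a frame of \<open>l\<close> is a
  \<open>4 \<times> 2\<close> matrix whose columns span \<open>l\<close>.\<close>

definition lag_topology :: "lag topology" where
  "lag_topology = topology (\<lambda>U. U \<subseteq> Lagrangians \<and>
     openin (top_of_set {A :: real ^ 2 ^ (2 + 2). range ((*v) A) \<in> Lagrangians})
       {A. range ((*v) A) \<in> U})"

lemma openin_lag_topology:
  "openin lag_topology U \<longleftrightarrow> U \<subseteq> Lagrangians \<and>
     openin (top_of_set {A :: real ^ 2 ^ (2 + 2). range ((*v) A) \<in> Lagrangians})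
       {A. range ((*v) A) \<in> U}"
proof -
  let ?F = "\<lambda>U. {A :: real ^ 2 ^ (2 + 2). range ((*v) A) \<in> U}"
  have "?F (S \<inter> T) = ?F S \<inter> ?F T" for S T by auto
  moreover have "?F (\<Union>K) = \<Union>(?F ` K)" for K by auto
  ultimately have "istopology (\<lambda>U. U \<subseteq> Lagrangians \<and> openin (top_of_set (?F Lagrangians)) (?F U))"
    unfolding istopology_def
  proof (intro conjI allI impI, goal_cases)
    case (4 K)
    then show ?case by (metis (no_types, lifting) imageE openin_Union)
  qed (auto intro: openin_Int)
  then show ?thesis
    unfolding lag_topology_def by (subst topology_inverse') simp_all
qed

definition pos_def :: "real ^ 2 ^ 2 \<Rightarrow> bool" where
  "pos_def Y \<longleftrightarrow> transpose Y = Y \<and> (\<forall>v. v \<noteq> 0 \<longrightarrow> v \<bullet> (Y *v v) > 0)"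

definition Siegel :: "(complex ^ 2 ^ 2) set" where
  "Siegel = {\<chi> i j. Complex (X $ i $ j) (Y $ i $ j) | X Y. transpose X = X \<and> pos_def Y}"

definition complexify :: "lag \<Rightarrow> (complex ^ (2 + 2)) set" where
  "complexify l = {\<chi> k. Complex (x $ k) (y $ k) | x y. x \<in> l \<and> y \<in> l}"

definition conj_lag :: "(complex ^ (2 + 2)) set \<Rightarrow> (complex ^ (2 + 2)) set" where
  "conj_lag l = (\<lambda>v. \<chi> k. cnj (v $ k)) ` l"

definition proj_along :: "'v::ab_group_add set \<Rightarrow> 'v set \<Rightarrow> 'v \<Rightarrow> 'v" where
  "proj_along l l' v = (THE u. u \<in> l \<and> v - u \<in> l')"

text \<open>The cross-ratio is an endomorphism of \<open>l1\<close>; only its values on \<open>l1\<close> are meaningful.\<close>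

definition cross_ratio ::
  "'v::ab_group_add set \<Rightarrow> 'v set \<Rightarrow> 'v set \<Rightarrow> 'v set \<Rightarrow> 'v \<Rightarrow> 'v" where
  "cross_ratio l1 l2 l3 l4 = (\<lambda>v. proj_along l1 l2 (proj_along l4 l3 v))"

definition tube :: "lag \<Rightarrow> lag \<Rightarrow> (complex ^ 2 ^ 2) set" where
  "tube a b = {Z \<in> Siegel. \<forall>v\<in>complexify a.
     cross_ratio (complexify a) (mat_lag Z) (conj_lag (mat_lag Z)) (complexify b) v = - v}"

definition tangent_vectors :: "'v::real_normed_vector set \<Rightarrow> 'v \<Rightarrow> 'v set" where
  "tangent_vectors S p =
     {v. \<exists>c. c (0::real) = p \<and> range c \<subseteq> S \<and> (c has_vector_derivative v) (at 0)}"

text \<open>The \<open>Sp(4, R)\<close>-invariant Riemannian metric \<open>tr (Y\<^sup>-\<^sup>1 dZ Y\<^sup>-\<^sup>1 dZ*)\<close> of the Siegel space at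
  \<open>Z = X + iY\<close>, with \<open>dZ*\<close> the complex conjugate of \<open>dZ\<close>; the space is irreducible, so invariant
  metrics differ by a constant factor and orthogonality does not depend on the choice.\<close>

definition siegel_metric ::
  "complex ^ 2 ^ 2 \<Rightarrow> complex ^ 2 ^ 2 \<Rightarrow> complex ^ 2 ^ 2 \<Rightarrow> real" where
  "siegel_metric Z U V =
     (let Yi = map_matrix complex_of_real (matrix_inv (map_matrix Im Z))
      in Re (trace (Yi ** U ** Yi ** map_matrix cnj V)))"

definition orthogonal_submanifolds ::
  "(complex ^ 2 ^ 2) set \<Rightarrow> (complex ^ 2 ^ 2) set \<Rightarrow> bool" (infix \<open>\<bottom>\<^sub>X\<close> 50) where
  "S \<bottom>\<^sub>X T \<longleftrightarrow> S \<inter> T \<noteq> {} \<and>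
     (\<forall>Z\<in>S \<inter> T. \<forall>U\<in>tangent_vectors S Z. \<forall>V\<in>tangent_vectors T Z. siegel_metric Z U V = 0)"

definition reflection_fixing :: "(real ^ (2 + 2) ^ (2 + 2)) set \<Rightarrow> lag \<Rightarrow> lag \<Rightarrow> bool" where
  "reflection_fixing g l l' \<longleftrightarrow>
     (\<exists>R\<in>g. R \<in> Sp_minus \<and> R ** R = mat 1) \<and> act g l = l \<and> act g l' = l'"

text \<open>The pairs \<open>(X1, X2)\<close>, \<open>(Y1, Y2)\<close>, \<open>(Z1, Z2)\<close> are determined by the orthogonality
  relations up to the order within each pair, which is fixed by maximality of the second tuple;
  quantifying existentially over them therefore adds no freedom.\<close>

definition Hom_max_W3 :: "(W3_gen word set \<Rightarrow> (real ^ (2 + 2) ^ (2 + 2)) set) set" where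
  "Hom_max_W3 = {\<rho> \<in> hom W3 PSp_pm.
     \<exists>P1 P2 Q1 Q2 R1 R2 X1 X2 Y1 Y2 Z1 Z2.
       maximal_tuple [P1, P2, Q1, Q2, R1, R2] \<and>
       maximal_tuple [X1, X2, Y1, Y2, Z1, Z2] \<and>
       tube P1 P2 \<bottom>\<^sub>X tube X1 X2 \<and> tube X1 X2 \<bottom>\<^sub>X tube Q1 Q2 \<and>
       tube Q1 Q2 \<bottom>\<^sub>X tube Y1 Y2 \<and> tube Y1 Y2 \<bottom>\<^sub>X tube R1 R2 \<and>
       tube R1 R2 \<bottom>\<^sub>X tube Z1 Z2 \<and> tube Z1 Z2 \<bottom>\<^sub>X tube P1 P2 \<and>
       reflection_fixing (\<rho> s1) P1 P2 \<and>
       reflection_fixing (\<rho> s2) Q1 Q2 \<and>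
       reflection_fixing (\<rho> s3) R1 R2 \<and>
       act (\<rho> s1) X1 = X2 \<and> act (\<rho> s1) Z1 = Z2 \<and>
       act (\<rho> s2) X1 = X2 \<and> act (\<rho> s2) Y1 = Y2 \<and>
       act (\<rho> s3) Y1 = Y2 \<and> act (\<rho> s3) Z1 = Z2}"

text \<open>The hyperbolic plane is the unit disc, with boundary the unit circle oriented
  counterclockwise.\<close>

definition positively_oriented :: "complex \<Rightarrow> complex \<Rightarrow> complex \<Rightarrow> bool" where
  "positively_oriented x y z \<longleftrightarrow>
     (\<exists>a b c. x = cis a \<and> y = cis b \<and> z = cis c \<and> a < b \<and> b < c \<and> c < a + 2 * pi)"

text \<open>A parabolic isometry fixing the cusp \<open>p\<close> and moving every horocycle at \<open>p\<close> so that the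
  complement of its horodisc, hence the surface, lies to the right.  In the upper half plane with
  \<open>p = \<infinity>\<close> these are the translations \<open>z \<mapsto> z + t\<close> with \<open>t > 0\<close>.\<close>

definition boundary_parabolic :: "(complex \<Rightarrow> complex) \<Rightarrow> bool" where
  "boundary_parabolic f \<longleftrightarrow>
     (\<exists>p\<in>sphere 0 1. f p = p \<and> (\<forall>x\<in>sphere 0 1 - {p}. positively_oriented p x (f x)))"

text \<open>A finite-area hyperbolization of the interior of the pair of pants, given by its holonomy:
  an action on the closed disc by orientation preserving isometries which is free and properly
  discontinuous on the open disc, with a quotient of finite area, and for which
  \<open>\<alpha>\<close>, \<open>\<beta>\<close> and \<open>(\<alpha>\<beta>)\<^sup>-\<^sup>1\<close> go once around the three cusps with the surface to their right.\<close>

definition finite_area_hyperbolization :: "(pants_gen word set \<Rightarrow> complex \<Rightarrow> complex) \<Rightarrow> bool" where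
  "finite_area_hyperbolization h \<longleftrightarrow>
     group_action Gamma03 (cball 0 1) h \<and>
     (\<forall>\<gamma>\<in>carrier Gamma03. \<exists>t w. cmod w < 1 \<and> (\<forall>z\<in>cball 0 1. h \<gamma> z = Moebius_function t w z)) \<and>
     (\<forall>\<gamma>\<in>carrier Gamma03. \<gamma> \<noteq> \<one>\<^bsub>Gamma03\<^esub> \<longrightarrow> (\<forall>z\<in>ball 0 1. h \<gamma> z \<noteq> z)) \<and>
     (\<forall>K. compact K \<and> K \<subseteq> ball 0 1 \<longrightarrow> finite {\<gamma> \<in> carrier Gamma03. h \<gamma> ` K \<inter> K \<noteq> {}}) \<and>
     (\<exists>F\<in>sets borel. F \<subseteq> ball 0 1 \<and> (\<Union>\<gamma>\<in>carrier Gamma03. h \<gamma> ` F) = ball 0 1 \<and>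
        (\<integral>\<^sup>+z\<in>F. ennreal (4 / (1 - (cmod z)\<^sup>2)\<^sup>2) \<partial>lborel) < \<infinity>) \<and>
     boundary_parabolic (h \<alpha>) \<and> boundary_parabolic (h \<beta>) \<and>
     boundary_parabolic (h (inv\<^bsub>Gamma03\<^esub> (\<alpha> \<otimes>\<^bsub>Gamma03\<^esub> \<beta>)))"

definition maximal_representation ::
  "(pants_gen word set \<Rightarrow> complex \<Rightarrow> complex) \<Rightarrow>
   (pants_gen word set \<Rightarrow> (real ^ (2 + 2) ^ (2 + 2)) set) \<Rightarrow> bool" where
  "maximal_representation h \<rho> \<longleftrightarrow> \<rho> \<in> hom Gamma03 PSp \<and>
     (\<exists>\<xi>. \<xi> \<in> sphere 0 1 \<rightarrow> Lagrangians \<and>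
        (\<forall>\<gamma>\<in>carrier Gamma03. \<forall>x\<in>sphere 0 1. \<xi> (h \<gamma> x) = act (\<rho> \<gamma>) (\<xi> x)) \<and>
        (\<forall>x y z. positively_oriented x y z \<longrightarrow> maximal_triple (\<xi> x) (\<xi> y) (\<xi> z)) \<and>
        (\<forall>t. limitin lag_topology (\<lambda>s. \<xi> (cis s)) (\<xi> (cis t)) (at_right t)))"

definition Shilov_hyperbolic :: "(real ^ (2 + 2) ^ (2 + 2)) set \<Rightarrow> bool" where
  "Shilov_hyperbolic g \<longleftrightarrow>
     (\<exists>M\<in>g. \<exists>N\<in>Sp. \<exists>A :: real ^ 2 ^ 2. invertible A \<and>
        (\<forall>\<mu> v. v \<noteq> 0 \<and> map_matrix complex_of_real A *v v = \<mu> *s v \<longrightarrow> cmod \<mu> > 1) \<and>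
        M = N ** block_mat A 0 0 (transpose (matrix_inv A)) ** matrix_inv N)"

definition Hom_max_Shilov ::
  "(pants_gen word set \<Rightarrow> complex \<Rightarrow> complex) \<Rightarrow>
   (pants_gen word set \<Rightarrow> (real ^ (2 + 2) ^ (2 + 2)) set) set" where
  "Hom_max_Shilov h = {\<rho>. maximal_representation h \<rho> \<and>
     (\<forall>\<gamma>\<in>carrier Gamma03. \<gamma> \<noteq> \<one>\<^bsub>Gamma03\<^esub> \<longrightarrow> Shilov_hyperbolic (\<rho> \<gamma>))}"

end

theory Submission
  imports Defs
begin

text \<open>Maximality of triples is a partial cyclic order on Lagrangians: in the chart sending the first
  Lagrangian to \<open>\<infinity>\<close> it is the order of symmetric matrices by positive definite differences.
  Symplectic maps preserve it and antisymplectic ones reverse it.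

  Shilov hyperbolicity comes from ping-pong: the reflection \<open>\<rho>(s\<^sub>i)\<close> maps the complement of its
  interval \<open>(P\<^sub>1, P\<^sub>2)\<close>, \<open>(Q\<^sub>1, Q\<^sub>2)\<close>, \<open>(R\<^sub>1, R\<^sub>2)\<close> into that interval, so a cyclically reduced
  word of even length maps a closed interval into its interior.  Monotone limits of the orbits of
  the end points then give a repelling and an attracting fixed Lagrangian.

  For the equivariant map, the three parabolic generators determine the hyperbolization up to
  conjugacy: it is the action of the even words in the reflections in the sides of an ideal
  triangle.  Labelling the vertices of the triangle by \<open>X\<^sub>2, Y\<^sub>2, Z\<^sub>2\<close> (and their mirror images by
  \<open>X\<^sub>1, Y\<^sub>1, Z\<^sub>1\<close>) and reflecting, one labels all cusps monotonically, because each reflection inserts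
  vertices into one gap of a cyclically ordered configuration, both on the circle and among
  Lagrangians.  Cusps are dense, and right limits extend the labelling to the circle.  The right
  limit at a cusp need not be its label.\<close>

section \<open>Lagrangians and maximal triples\<close>

text \<open>Circle and Lagrangians are kept in step by ordering pairs (point, Lagrangian) by the
  conjunction of the two cyclic orders. Each reflection inserts vertices into a gap of this joint
  order, so any three distinct vertices of one colour are comparable in it. As the circle order is
  asymmetric, the orientation of the points then decides that of the labels; the labelling need not
  be known to be single valued beforehand.

  A circle reflection fixes two corners of the triangle, whereas the matrix reflection exchanges
  their labels \<open>X1\<close>, \<open>X2\<close> and so on. This forces two colours of labels.
  Even words preserve the colour, and one colour is kept.

  Points of the circle are lifted to plane vectors up to real scalars. A parabolic of the prescribed
  direction becomes a transvection \<open>v - wedge p v *\<^sub>R p\<close>, and the third parabolic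
  forces \<open>wedge p q\<close> to be 2 up to sign. Relative to \<open>p\<close> and
  \<open>q\<close> the side reflections are then integer matrices, and the cusps turn out to be all
  nonzero integer vectors.\<close>

lemma block_vec_simps [simp]:
  "block_vec u v $ Inl i = u $ i" "block_vec u v $ Inr i = v $ i"
  by (simp_all add: block_vec_def)

lemma block_mat_simps [simp]:
  "block_mat A B C D $ Inl i = block_vec (A $ i) (B $ i)"
  "block_mat A B C D $ Inr i = block_vec (C $ i) (D $ i)"
  by (simp_all add: block_mat_def)

lemma vec_sum_eq_iff:
  fixes x y :: "'a ^ ('m::finite + 'n::finite)"
  shows "x = y \<longleftrightarrow> (\<forall>i. x $ Inl i = y $ Inl i) \<and> (\<forall>i. x $ Inr i = y $ Inr i)"
  unfolding vec_eq_iff by (metis sum.exhaust)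

lemma sum_UNIV_Plus:
  "(\<Sum>k\<in>(UNIV :: ('m::finite + 'n::finite) set). f k) = (\<Sum>i\<in>UNIV. f (Inl i)) + (\<Sum>i\<in>UNIV. f (Inr i))"
  by (simp add: UNIV_Plus_UNIV[symmetric] sum.Plus del: UNIV_Plus_UNIV)

lemma block_vec_eq_iff [simp]: "block_vec u v = block_vec u' v' \<longleftrightarrow> u = u' \<and> v = v'"
  unfolding vec_sum_eq_iff vec_eq_iff[of u] vec_eq_iff[of v] by simp

lemma block_vec_cases: obtains u v where "x = block_vec u v"
proof
  show "x = block_vec (\<chi> i. x $ Inl i) (\<chi> i. x $ Inr i)"
    by (simp add: vec_sum_eq_iff)
qed

lemma block_vec_linear:
  fixes u v u' v' :: "real ^ 2"
  shows "block_vec u v + block_vec u' v' = block_vec (u + u') (v + v')"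
    and "block_vec u v - block_vec u' v' = block_vec (u - u') (v - v')"
    and "c *\<^sub>R block_vec u v = block_vec (c *\<^sub>R u) (c *\<^sub>R v)"
    and "- block_vec u v = block_vec (- u) (- v)"
    and "0 = block_vec (0 :: real ^ 2) 0"
  by (simp_all add: vec_sum_eq_iff)

lemma inner_block_vec:
  fixes u v u' v' :: "real ^ 2"
  shows "block_vec u v \<bullet> block_vec u' v' = u \<bullet> u' + v \<bullet> v'"
  by (simp add: inner_vec_def sum_UNIV_Plus)

lemma block_mat_eq_iff:
  "block_mat A B C D = block_mat A' B' C' D' \<longleftrightarrow> A = A' \<and> B = B' \<and> C = C' \<and> D = D'"
  unfolding vec_sum_eq_iff[of "block_mat A B C D"] vec_eq_iff[of A] vec_eq_iff[of B]
    vec_eq_iff[of C] vec_eq_iff[of D] by auto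

lemma block_mat_cases:
  fixes M :: "'a ^ (2 + 2) ^ (2 + 2)"
  obtains A B C D where "M = block_mat A B C D"
proof
  show "M = block_mat (\<chi> i j. M $ Inl i $ Inl j) (\<chi> i j. M $ Inl i $ Inr j)
    (\<chi> i j. M $ Inr i $ Inl j) (\<chi> i j. M $ Inr i $ Inr j)"
    by (simp add: vec_sum_eq_iff)
qed

lemma block_mat_mult:
  fixes A B C D A' B' C' D' :: "real ^ 2 ^ 2"
  shows "block_mat A B C D ** block_mat A' B' C' D' =
    block_mat (A ** A' + B ** C') (A ** B' + B ** D') (C ** A' + D ** C') (C ** B' + D ** D')"
  by (simp add: vec_sum_eq_iff matrix_matrix_mult_def sum_UNIV_Plus)

lemma block_mat_vec:
  fixes A B C D :: "real ^ 2 ^ 2"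
  shows "block_mat A B C D *v block_vec u v = block_vec (A *v u + B *v v) (C *v u + D *v v)"
  by (simp add: vec_sum_eq_iff matrix_vector_mult_def sum_UNIV_Plus)

lemma transpose_block_mat:
  "transpose (block_mat A B C D) = block_mat (transpose A) (transpose C) (transpose B) (transpose D)"
  by (simp add: vec_sum_eq_iff transpose_def)

lemma mat_block_mat: "(mat k :: real ^ (2 + 2) ^ (2 + 2)) = block_mat (mat k) 0 0 (mat k)"
  by (simp add: vec_sum_eq_iff mat_def)

lemma uminus_block_mat:
  fixes A B C D :: "real ^ 2 ^ 2"
  shows "- block_mat A B C D = block_mat (- A) (- B) (- C) (- D)"
  by (simp add: vec_sum_eq_iff)

lemma matrix_mult_zero [simp]:
  "A ** (0 :: real ^ 'n ^ 'm) = 0" "(0 :: real ^ 'm ^ 'k) ** B = 0"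
  by (simp_all add: matrix_matrix_mult_def vec_eq_iff)

lemma transpose_zero [simp]: "transpose (0 :: real ^ 'n ^ 'm) = 0"
  by (simp add: transpose_def vec_eq_iff)

lemma transpose_add: "transpose (A + B) = transpose A + transpose (B :: real ^ 'n ^ 'm)"
  by (simp add: transpose_def vec_eq_iff)

lemma transpose_diff: "transpose (A - B) = transpose A - transpose (B :: real ^ 'n ^ 'm)"
  by (simp add: transpose_def vec_eq_iff)

lemma uminus_matrix_vector_mult: "(- A) *v x = - (A *v (x :: real ^ 'n))"
  by (simp add: matrix_vector_mult_def vec_eq_iff sum_negf)

lemma mat_vec_uminus: "A *v (- x) = - (A *v (x :: real ^ 'n))"
  by (simp add: matrix_vector_mult_def vec_eq_iff sum_negf)

lemma inner_matrix_vector: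
  fixes A :: "real ^ 'n ^ 'm"
  shows "(A *v x) \<bullet> y = x \<bullet> (transpose A *v y)"
  by (metis dot_lmul_matrix inner_commute transpose_matrix_vector transpose_transpose)

section \<open>Symplectic and antisymplectic matrices in block form\<close>

lemma J_form_block_mat:
  fixes A B C D :: "real ^ 2 ^ 2"
  shows "transpose (block_mat A B C D) ** J ** block_mat A B C D =
    block_mat (transpose A ** C - transpose C ** A) (transpose A ** D - transpose C ** B)
      (transpose B ** C - transpose D ** A) (transpose B ** D - transpose D ** B)"
  unfolding J_def transpose_block_mat block_mat_mult
  by (simp add: matrix_mult_minus minus_matrix_mult)

text \<open>The lower left block of the form is minus the transpose of the upper right one, so three
  block equations are enough.\<close>

lemma block_mat_Sp_iff:
  fixes A B C D :: "real ^ 2 ^ 2"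
  shows "block_mat A B C D \<in> Sp \<longleftrightarrow>
    transpose A ** C = transpose C ** A \<and> transpose B ** D = transpose D ** B \<and>
    transpose A ** D - transpose C ** B = mat 1"
proof -
  have "transpose B ** C - transpose D ** A = - mat 1"
    if "transpose A ** D - transpose C ** B = mat 1"
  proof -
    have "transpose (transpose A ** D - transpose C ** B) = mat 1"
      using that by (simp add: transpose_mat_1)
    then have "transpose D ** A - transpose B ** C = mat 1"
      by (simp add: transpose_diff matrix_transpose_mul)
    then show ?thesis by (metis minus_diff_eq)
  qed
  then show ?thesis
    unfolding Sp_def J_form_block_mat mem_Collect_eq unfolding J_def block_mat_eq_iff by auto
qed

lemma block_mat_Sp_minus_iff:
  fixes A B C D :: "real ^ 2 ^ 2"
  shows "block_mat A B C D \<in> Sp_minus \<longleftrightarrow>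
    transpose A ** C = transpose C ** A \<and> transpose B ** D = transpose D ** B \<and>
    transpose A ** D - transpose C ** B = - mat 1"
proof -
  have "transpose B ** C - transpose D ** A = mat 1"
    if "transpose A ** D - transpose C ** B = - mat 1"
  proof -
    have "transpose (transpose A ** D - transpose C ** B) = - mat 1"
      using that by (simp add: transpose_mat_1 transpose_minus)
    then have "transpose D ** A - transpose B ** C = - mat 1"
      by (simp add: transpose_diff matrix_transpose_mul)
    then show ?thesis by (metis minus_diff_eq minus_minus)
  qed
  then show ?thesis
    unfolding Sp_minus_def J_form_block_mat mem_Collect_eq unfolding J_def block_mat_eq_iff uminus_block_mat by auto
qed

lemma Sp_mult: "M \<in> Sp \<Longrightarrow> N \<in> Sp \<Longrightarrow> M ** N \<in> Sp"
  using similitude_mult[of M 1 N 1] by (simp add: Sp_pm_iff)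

lemma Sp_minus_mult: "M \<in> Sp_minus \<Longrightarrow> N \<in> Sp_minus \<Longrightarrow> M ** N \<in> Sp"
  using similitude_mult[of M "-1" N "-1"] by (simp add: Sp_pm_iff)

lemma Sp_minus_Sp_mult: "M \<in> Sp_minus \<Longrightarrow> N \<in> Sp \<Longrightarrow> M ** N \<in> Sp_minus"
  using similitude_mult[of M "-1" N 1] by (simp add: Sp_pm_iff)

lemma Sp_one: "mat 1 \<in> Sp"
  by (simp add: Sp_def transpose_mat_1)

lemma Sp_inverse:
  assumes "M \<in> Sp"
  obtains N where "N \<in> Sp" "N ** M = mat 1" "M ** N = mat 1"
proof -
  from assms similitude_inverse[of M 1]
  obtain N where "N ** M = mat 1" "N \<in> Sp" by (auto simp: Sp_pm_iff)
  then show ?thesis using that[of N] by (simp add: matrix_left_right_inverse)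
qed

lemma Sp_invertible: "M \<in> Sp \<Longrightarrow> invertible M"
  by (meson Sp_inverse invertible_def)

lemma matrix_inv_inverse:
  assumes "invertible (M :: real ^ 'n ^ 'n)"
  shows "matrix_inv M ** M = mat 1" "M ** matrix_inv M = mat 1"
  using someI_ex[OF assms[unfolded invertible_def]] by (simp_all add: matrix_inv_def)

lemma Sp_matrix_inv: "M \<in> Sp \<Longrightarrow> matrix_inv M \<in> Sp"
proof -
  assume "M \<in> Sp"
  then obtain N where N: "N \<in> Sp" "M ** N = mat 1" using Sp_inverse by blast
  have "matrix_inv M ** (M ** N) = N"
    unfolding matrix_mul_assoc by (simp add: matrix_inv_inverse Sp_invertible \<open>M \<in> Sp\<close>)
  then show ?thesis using N by simp
qed

lemma Sp_inv_image:
  assumes "M \<in> Sp"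
  shows "(*v) (matrix_inv M) ` (*v) M ` l = l" "(*v) M ` (*v) (matrix_inv M) ` l = l"
  using Sp_invertible[OF assms]
  by (simp_all add: image_image matrix_vector_mul_assoc matrix_inv_inverse)

lemma image_matrix_mult: "(*v) (M ** N) ` l = (*v) M ` (*v) N ` (l :: (real ^ 'n) set)"
  by (simp add: image_image matrix_vector_mul_assoc)

lemma image_uminus_subspace:
  assumes "subspace (l :: (real ^ 'n) set)" shows "(*v) (- M) ` l = (*v) M ` l"
proof -
  have "(*v) (- M) ` l \<subseteq> (*v) M ` l" for M :: "real ^ 'n ^ 'm"
  proof
    fix y assume "y \<in> (*v) (- M) ` l"
    then obtain x where "x \<in> l" "y = M *v (- x)"
      by (auto simp: uminus_matrix_vector_mult mat_vec_uminus)
    then show "y \<in> (*v) M ` l" using assms subspace_neg by blast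
  qed
  from this[of M] this[of "- M"] show ?thesis by auto
qed

section \<open>The symplectic form and Lagrangian subspaces\<close>

definition symp :: "real ^ (2 + 2) \<Rightarrow> real ^ (2 + 2) \<Rightarrow> real" where
  "symp u v = u \<bullet> (J *v v)"

lemma symp_block_vec: "symp (block_vec u v) (block_vec u' v') = u \<bullet> v' - v \<bullet> u'"
  by (simp add: symp_def J_def block_mat_vec inner_block_vec uminus_matrix_vector_mult)

lemma symp_Sp: "M \<in> Sp \<Longrightarrow> symp (M *v u) (M *v v) = symp u v"
  unfolding symp_def Sp_def mem_Collect_eq inner_matrix_vector
  by (metis matrix_vector_mul_assoc matrix_mul_assoc)

lemma mem_infinity_lag: "block_vec u v \<in> infinity_lag \<longleftrightarrow> v = 0"
  by (auto simp: infinity_lag_def)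

lemma mem_mat_lag: "block_vec u v \<in> mat_lag X \<longleftrightarrow> u = X *v v"
  by (auto simp: mat_lag_def)

lemma mat_lag_inject: "mat_lag (X :: real ^ 2 ^ 2) = mat_lag Y \<longleftrightarrow> X = Y"
proof
  assume "mat_lag X = mat_lag Y"
  then have "X *v v = Y *v v" for v
    using mem_mat_lag[of "X *v v" v X] mem_mat_lag[of "X *v v" v Y] by simp
  then show "X = Y" by (simp add: matrix_eq)
qed simp

lemma Lagrangians_infinity_lag: "infinity_lag \<in> Lagrangians"
proof -
  let ?f = "\<lambda>w :: real ^ 2. block_vec w (0 :: real ^ 2)"
  have lin: "linear ?f" by (rule linearI) (simp_all add: block_vec_linear)
  have "dim (?f ` UNIV) = dim (UNIV :: (real ^ 2) set)"
    by (rule dim_image_eq[OF lin]) (simp add: inj_on_def)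
  moreover have "subspace (?f ` UNIV)" using lin by (rule linear_subspace_image) simp
  moreover have "symp u v = 0" if "u \<in> infinity_lag" "v \<in> infinity_lag" for u v
    using that by (auto simp: infinity_lag_def symp_block_vec)
  ultimately show ?thesis
    by (simp add: Lagrangians_def infinity_lag_def symp_def)
qed

lemma Lagrangians_mat_lag:
  assumes "transpose X = X" shows "mat_lag X \<in> Lagrangians"
proof -
  let ?f = "\<lambda>w :: real ^ 2. block_vec (X *v w) w"
  have lin: "linear ?f"
    by (rule linearI) (simp_all add: block_vec_linear matrix_vector_right_distrib scaleR_matrix_vector_assoc matrix_vector_mult_scaleR)
  have "dim (?f ` UNIV) = dim (UNIV :: (real ^ 2) set)"
    by (rule dim_image_eq[OF lin]) (simp add: inj_on_def)
  moreover have "subspace (?f ` UNIV)" using lin by (rule linear_subspace_image) simp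
  moreover have "symp u v = 0" if "u \<in> mat_lag X" "v \<in> mat_lag X" for u v
    using that by (auto simp: mat_lag_def symp_block_vec inner_matrix_vector assms)
  ultimately show ?thesis
    by (simp add: Lagrangians_def mat_lag_def symp_def)
qed

lemma Lagrangians_image:
  assumes "M \<in> Sp" "l \<in> Lagrangians" shows "(*v) M ` l \<in> Lagrangians"
proof -
  have "inj ((*v) M)"
    using Sp_invertible[OF assms(1)] by (simp add: inj_matrix_vector_mult)
  then have "dim ((*v) M ` l) = dim l"
    by (intro dim_image_eq) (auto intro: inj_on_subset)
  moreover have "subspace ((*v) M ` l)"
    using assms by (intro linear_subspace_image) (auto simp: Lagrangians_def)
  moreover have "symp u v = 0" if "u \<in> (*v) M ` l" "v \<in> (*v) M ` l" for u v
    using that assms symp_Sp[OF assms(1)] by (auto simp: Lagrangians_def symp_def)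
  ultimately show ?thesis using assms by (simp add: Lagrangians_def symp_def)
qed

text \<open>Being Lagrangian and pairwise transverse holds for \<open>infinity_lag\<close>, 0, Id
  and is transported by symplectic maps, which reduces maximality to the orbit condition.\<close>

lemma maximal_triple_iff:
  "maximal_triple l1 l2 l3 \<longleftrightarrow> (\<exists>M\<in>Sp. l1 = (*v) M ` infinity_lag \<and> l2 = (*v) M ` mat_lag 0 \<and> l3 = (*v) M ` mat_lag (mat 1))"
proof -
  have 0: "infinity_lag \<inter> mat_lag 0 = {0}" "infinity_lag \<inter> mat_lag (mat 1) = {0}"
    "mat_lag 0 \<inter> mat_lag (mat 1) = {0 :: real ^ (2 + 2)}"
    by (auto simp: infinity_lag_def mat_lag_def block_vec_linear)
  have *: "(*v) M ` l \<inter> (*v) M ` l' = {0}" if "M \<in> Sp" "l \<inter> l' = {0}" for M l l'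
  proof -
    have "inj ((*v) M)" using Sp_invertible[OF that(1)] by (simp add: inj_matrix_vector_mult)
    then have "(*v) M ` l \<inter> (*v) M ` l' = (*v) M ` {0}"
      using that by (simp add: image_Int[symmetric])
    then show ?thesis by simp
  qed
  have "transpose (0 :: real ^ 2 ^ 2) = 0" by simp
  then have "{l1, l2, l3} \<subseteq> Lagrangians \<and> l1 \<inter> l2 = {0} \<and> l1 \<inter> l3 = {0} \<and> l2 \<inter> l3 = {0}"
    if "M \<in> Sp" "l1 = (*v) M ` infinity_lag" "l2 = (*v) M ` mat_lag 0" "l3 = (*v) M ` mat_lag (mat 1)" for M
    unfolding that(2-4) using that(1) *[OF that(1)] 0
    by (simp add: Lagrangians_image Lagrangians_infinity_lag Lagrangians_mat_lag transpose_mat_1)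
  then show ?thesis
    unfolding maximal_triple_def by blast
qed

lemma maximal_triple_Sp:
  assumes "M \<in> Sp" "maximal_triple a b c"
  shows "maximal_triple ((*v) M ` a) ((*v) M ` b) ((*v) M ` c)"
proof -
  from assms(2) obtain N where N: "N \<in> Sp" "a = (*v) N ` infinity_lag" "b = (*v) N ` mat_lag 0" "c = (*v) N ` mat_lag (mat 1)"
    unfolding maximal_triple_iff by blast
  show ?thesis unfolding maximal_triple_iff
    by (rule bexI[of _ "M ** N"]) (simp_all add: N image_matrix_mult Sp_mult assms)
qed

lemma maximal_triple_Sp_iff:
  assumes "M \<in> Sp"
  shows "maximal_triple ((*v) M ` a) ((*v) M ` b) ((*v) M ` c) \<longleftrightarrow> maximal_triple a b c"
  using maximal_triple_Sp[OF assms, of a b c]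
    maximal_triple_Sp[OF Sp_matrix_inv[OF assms], of "(*v) M ` a" "(*v) M ` b" "(*v) M ` c"]
  by (auto simp: Sp_inv_image(1)[OF assms])

lemma maximal_triple_Lagrangians:
  assumes "maximal_triple a b c"
  shows "a \<in> Lagrangians" "b \<in> Lagrangians" "c \<in> Lagrangians"
  using assms by (auto simp: maximal_triple_def)

text \<open>The real Moebius maps \<open>z \<mapsto> 1 / (1 - z)\<close> and \<open>z \<mapsto> z / (z - 1)\<close> permute \<open>\<infinity>, 0, 1\<close>
  cyclically and by a transposition; acting diagonally they do the same with the
  Lagrangians \<open>\<infinity>, 0, Id\<close>.\<close>

lemma maximal_triple_rotate: "maximal_triple a b c \<Longrightarrow> maximal_triple b c a"
proof -
  assume "maximal_triple a b c"
  then obtain M where M: "M \<in> Sp" "a = (*v) M ` infinity_lag" "b = (*v) M ` mat_lag 0" "c = (*v) M ` mat_lag (mat 1)"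
    unfolding maximal_triple_iff by blast
  let ?N = "block_mat 0 (mat 1) (- mat 1) (mat 1) :: real ^ (2 + 2) ^ (2 + 2)"
  have N: "?N \<in> Sp" by (simp add: block_mat_Sp_iff transpose_mat_1 transpose_minus minus_matrix_mult)
  have "range (\<lambda>w :: real ^ 2. block_vec (0 :: real ^ 2) (- w)) = range (block_vec 0)"
    by (auto intro!: image_eqI[of _ _ "- _"])
  then have "(*v) ?N ` infinity_lag = mat_lag 0" "(*v) ?N ` mat_lag 0 = mat_lag (mat 1)"
    "(*v) ?N ` mat_lag (mat 1) = infinity_lag"
    by (auto simp: infinity_lag_def mat_lag_def image_image block_mat_vec uminus_matrix_vector_mult)
  then have "(*v) (M ** ?N) ` infinity_lag = b" "(*v) (M ** ?N) ` mat_lag 0 = c"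
    "(*v) (M ** ?N) ` mat_lag (mat 1) = a"
    by (simp_all add: image_matrix_mult M)
  then show ?thesis unfolding maximal_triple_iff
    by (intro bexI[of _ "M ** ?N"]) (simp_all add: Sp_mult[OF M(1) N])
qed

lemma maximal_triple_Sp_minus:
  assumes S: "S \<in> Sp_minus" and "maximal_triple a b c"
  shows "maximal_triple ((*v) S ` c) ((*v) S ` b) ((*v) S ` a)"
proof -
  from assms(2) obtain M where M: "M \<in> Sp" "a = (*v) M ` infinity_lag" "b = (*v) M ` mat_lag 0" "c = (*v) M ` mat_lag (mat 1)"
    unfolding maximal_triple_iff by blast
  let ?N = "block_mat (mat 1) 0 (mat 1) (- mat 1) :: real ^ (2 + 2) ^ (2 + 2)"
  have N: "?N \<in> Sp_minus" by (simp add: block_mat_Sp_minus_iff transpose_mat_1 transpose_minus minus_matrix_mult)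
  have "range (\<lambda>w :: real ^ 2. block_vec (0 :: real ^ 2) (- w)) = range (block_vec 0)"
    by (auto intro!: image_eqI[of _ _ "- _"])
  then have "(*v) ?N ` infinity_lag = mat_lag (mat 1)" "(*v) ?N ` mat_lag 0 = mat_lag 0"
    "(*v) ?N ` mat_lag (mat 1) = infinity_lag"
    by (auto simp: infinity_lag_def mat_lag_def image_image block_mat_vec uminus_matrix_vector_mult)
  then have "(*v) (S ** M ** ?N) ` infinity_lag = (*v) S ` c" "(*v) (S ** M ** ?N) ` mat_lag 0 = (*v) S ` b"
    "(*v) (S ** M ** ?N) ` mat_lag (mat 1) = (*v) S ` a"
    by (simp_all add: image_matrix_mult M)
  then show ?thesis unfolding maximal_triple_iff
    by (intro bexI[of _ "S ** M ** ?N"]) (simp_all add: Sp_minus_mult[OF Sp_minus_Sp_mult[OF S M(1)] N])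
qed

section \<open>The order in the chart at infinity\<close>

lemma transpose_mult_one_commute:
  fixes P S :: "real ^ 'n ^ 'n"
  assumes "transpose P ** S = mat 1"
  shows "S ** transpose P = mat 1" "P ** transpose S = mat 1" "transpose S ** P = mat 1"
proof -
  show 1: "S ** transpose P = mat 1" using assms by (simp add: matrix_left_right_inverse)
  have "transpose (S ** transpose P) = mat 1" "transpose (transpose P ** S) = mat 1"
    unfolding assms 1 by (simp_all add: transpose_mat_1)
  then show "P ** transpose S = mat 1" "transpose S ** P = mat 1"
    by (simp_all add: matrix_transpose_mul)
qed

lemma Sp_fix_infinity:
  assumes "N \<in> Sp" "(*v) N ` infinity_lag = infinity_lag"
  obtains P Q S :: "real ^ 2 ^ 2" where "N = block_mat P Q 0 S" "transpose P ** S = mat 1" "transpose Q ** S = transpose S ** Q"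
proof -
  obtain P Q C S where N: "N = block_mat P Q C S" by (rule block_mat_cases)
  have "C *v w = 0" for w
  proof -
    have "N *v block_vec w 0 \<in> infinity_lag"
      using assms(2) by (auto simp: mem_infinity_lag)
    then show ?thesis by (simp add: N block_mat_vec mem_infinity_lag)
  qed
  then have C: "C = 0" by (simp add: matrix_eq)
  with N assms(1) that[of P Q S] show ?thesis by (simp add: block_mat_Sp_iff)
qed

lemma matrix_mul_add_rdistrib: "(A + B) ** C = A ** C + B ** (C :: real ^ 'n ^ 'm)"
  by (simp add: matrix_matrix_mult_def vec_eq_iff distrib_right sum.distrib)

text \<open>The stabiliser of infinity acts on the chart by affine maps: \<open>S\<close> is inverse
  to \<open>transpose P\<close>, so \<open>S *v w = u\<close> means
  \<open>w = transpose P *v u\<close>.\<close>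

lemma image_mat_lag_upper:
  fixes P S :: "real ^ 2 ^ 2"
  assumes "transpose P ** S = mat 1"
  shows "(*v) (block_mat P Q 0 S) ` mat_lag X = mat_lag ((P ** X + Q) ** transpose P)"
proof -
  note inv = assms transpose_mult_one_commute[OF assms]
  have 1: "transpose P *v (S *v w) = w" "S *v (transpose P *v w) = w" for w
    unfolding matrix_vector_mul_assoc inv by simp_all
  show ?thesis
  proof (rule equalityI)
    show "(*v) (block_mat P Q 0 S) ` mat_lag X \<subseteq> mat_lag ((P ** X + Q) ** transpose P)"
    proof (rule image_subsetI)
      fix x assume "x \<in> mat_lag X"
      then obtain w where "x = block_vec (X *v w) w" by (auto simp: mat_lag_def)
      then show "block_mat P Q 0 S *v x \<in> mat_lag ((P ** X + Q) ** transpose P)"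
        by (simp add: block_mat_vec mem_mat_lag matrix_vector_mul_assoc[symmetric] 1
            matrix_vector_mult_add_rdistrib del: transpose_matrix_vector)
    qed
    show "mat_lag ((P ** X + Q) ** transpose P) \<subseteq> (*v) (block_mat P Q 0 S) ` mat_lag X"
    proof
      fix y assume "y \<in> mat_lag ((P ** X + Q) ** transpose P)"
      then obtain u where y: "y = block_vec (((P ** X + Q) ** transpose P) *v u) u"
        by (auto simp: mat_lag_def)
      show "y \<in> (*v) (block_mat P Q 0 S) ` mat_lag X"
        by (rule image_eqI[of _ _ "block_vec (X *v (transpose P *v u)) (transpose P *v u)"])
          (simp_all add: y block_mat_vec mem_mat_lag matrix_vector_mul_assoc[symmetric] 1
            matrix_vector_mult_add_rdistrib del: transpose_matrix_vector)
    qed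
  qed
qed

lemma pos_def_mult_transpose:
  fixes P S :: "real ^ 2 ^ 2"
  assumes "transpose P ** S = mat 1"
  shows "pos_def (P ** transpose P)"
  unfolding pos_def_def
proof (intro conjI allI impI)
  show "transpose (P ** transpose P) = P ** transpose P" by (simp add: matrix_transpose_mul)
  fix v :: "real ^ 2" assume v: "v \<noteq> 0"
  have "S *v (transpose P *v v) = v"
    unfolding matrix_vector_mul_assoc transpose_mult_one_commute[OF assms] by simp
  then have "transpose P *v v \<noteq> 0" using v by auto
  then have "0 < (transpose P *v v) \<bullet> (transpose P *v v)" unfolding inner_gt_zero_iff .
  also have "\<dots> = v \<bullet> (P ** transpose P *v v)"
    unfolding inner_matrix_vector transpose_transpose matrix_vector_mul_assoc ..
  finally show "0 < v \<bullet> (P ** transpose P *v v)" .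
qed

text \<open>Cholesky factorisation written out: \<open>P\<close> is lower triangular and
  \<open>S\<close> is its inverse transpose.\<close>

lemma pos_def_sqrt:
  assumes "pos_def Z"
  obtains P S :: "real ^ 2 ^ 2" where "P ** transpose P = Z" "transpose P ** S = mat 1"
proof -
  define a b d where "a = Z $ 1 $ 1" and "b = Z $ 1 $ 2" and "d = Z $ 2 $ 2"
  have b: "Z $ 2 $ 1 = b"
  proof -
    have "transpose Z $ 2 $ 1 = Z $ 2 $ 1" using assms by (simp add: pos_def_def)
    then show ?thesis by (simp add: transpose_def b_def)
  qed
  have form: "v \<bullet> (Z *v v) = a * (v $ 1)\<^sup>2 + 2 * b * (v $ 1) * (v $ 2) + d * (v $ 2)\<^sup>2" for v
    by (simp add: inner_vec_def matrix_vector_mult_def sum_2 a_def b b_def d_def power2_eq_square algebra_simps)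
  have pos: "v \<noteq> 0 \<Longrightarrow> v \<bullet> (Z *v v) > 0" for v using assms by (simp add: pos_def_def)
  have a: "a > 0" using pos[of "vector [1, 0]"] by (simp add: form vec_eq_iff forall_2)
  \<comment> \<open>The vector \<open>(- b, a)\<close> turns the form into \<open>a\<close> times
    the determinant.\<close>
  have "0 < a * b\<^sup>2 - 2 * b * b * a + d * a\<^sup>2"
    using pos[of "vector [- b, a]"] a by (simp add: form vec_eq_iff forall_2)
  then have "0 < a * (d * a - b\<^sup>2)" by (simp add: power2_eq_square algebra_simps)
  then have "d * a - b\<^sup>2 > 0" using a by (simp add: zero_less_mult_iff)
  then have e: "d - b\<^sup>2 / a > 0" using a by (simp add: field_simps)
  define p r where "p = sqrt a" and "r = sqrt (d - b\<^sup>2 / a)"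
  have p: "p > 0" "p * p = a" and r: "r > 0" "r * r = d - b\<^sup>2 / a"
    using a e by (simp_all add: p_def r_def)
  define P S :: "real ^ 2 ^ 2"
    where "P = vector [vector [p, 0], vector [b / p, r]]"
      and "S = vector [vector [1 / p, - b / (p * p * r)], vector [0, 1 / r]]"
  have "b / p * (b / p) = b\<^sup>2 / a" by (simp add: p(2) power2_eq_square)
  then have "b / p * (b / p) + r * r = d" by (simp only: r(2))
  then have "P ** transpose P = Z"
    using p(1) p(2)
    by (simp add: P_def vec_eq_iff forall_2 matrix_matrix_mult_def sum_2 transpose_def
        a_def[symmetric] b_def[symmetric] d_def[symmetric] b)
  moreover have "transpose P ** S = mat 1"
    using p(1) r(1)
    by (simp add: P_def S_def vec_eq_iff forall_2 matrix_matrix_mult_def sum_2 transpose_def mat_def field_simps)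
  ultimately show ?thesis using that by blast
qed

text \<open>Forwards, an element of the stabiliser of infinity sends 0 and Id to matrices differing
  by \<open>P ** transpose P\<close>. Backwards, a positive definite difference is factored in this
  form.\<close>

lemma maximal_triple_infinity_iff:
  "maximal_triple infinity_lag l m \<longleftrightarrow>
    (\<exists>X Y. transpose X = X \<and> transpose Y = Y \<and> pos_def (Y - X) \<and> l = mat_lag X \<and> m = mat_lag Y)"
proof
  assume "maximal_triple infinity_lag l m"
  then obtain N where N: "N \<in> Sp" "infinity_lag = (*v) N ` infinity_lag" "l = (*v) N ` mat_lag 0" "m = (*v) N ` mat_lag (mat 1)"
    unfolding maximal_triple_iff by blast
  obtain P Q S where PQS: "N = block_mat P Q 0 S" "transpose P ** S = mat 1" "transpose Q ** S = transpose S ** Q"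
    using Sp_fix_infinity[OF N(1) N(2)[symmetric]] by blast
  note inv = PQS(2) transpose_mult_one_commute[OF PQS(2)]
  define X where "X = Q ** transpose P"
  have "transpose X = P ** transpose Q ** (S ** transpose P)"
    by (simp add: X_def matrix_transpose_mul inv)
  also have "\<dots> = P ** (transpose Q ** S) ** transpose P" by (simp add: matrix_mul_assoc)
  also have "\<dots> = (P ** transpose S) ** Q ** transpose P" by (simp add: PQS(3) matrix_mul_assoc)
  finally have X: "transpose X = X" by (simp add: inv X_def)
  have l: "l = mat_lag X" and m: "m = mat_lag (P ** transpose P + X)"
    unfolding N(3,4) PQS(1) image_mat_lag_upper[OF PQS(2)]
    by (simp_all add: X_def matrix_mul_add_rdistrib)
  show "\<exists>X Y. transpose X = X \<and> transpose Y = Y \<and> pos_def (Y - X) \<and> l = mat_lag X \<and> m = mat_lag Y"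
    using X l m pos_def_mult_transpose[OF PQS(2)]
    by (intro exI[of _ X] exI[of _ "P ** transpose P + X"])
      (simp add: transpose_add matrix_transpose_mul)
next
  assume "\<exists>X Y. transpose X = X \<and> transpose Y = Y \<and> pos_def (Y - X) \<and> l = mat_lag X \<and> m = mat_lag Y"
  then obtain X Y where XY: "transpose X = X" "transpose Y = Y" "pos_def (Y - X)" "l = mat_lag X" "m = mat_lag Y"
    by blast
  obtain P S :: "real ^ 2 ^ 2" where PS: "P ** transpose P = Y - X" "transpose P ** S = mat 1"
    using pos_def_sqrt[OF XY(3)] by blast
  note inv = PS(2) transpose_mult_one_commute[OF PS(2)]
  \<comment> \<open>The block \<open>X ** S\<close> is chosen so that its product with
    \<open>transpose P\<close> is \<open>X\<close>: then 0 goes to \<open>X\<close> and Id to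
    \<open>P ** transpose P + X = Y\<close>.\<close>
  let ?N = "block_mat P (X ** S) 0 S"
  have N: "?N \<in> Sp" by (simp add: block_mat_Sp_iff PS(2) matrix_transpose_mul XY(1) matrix_mul_assoc)
  have XSP: "X ** S ** transpose P = X" by (simp add: matrix_mul_assoc[symmetric] inv)
  have "(*v) ?N ` infinity_lag = infinity_lag"
  proof
    show "(*v) ?N ` infinity_lag \<subseteq> infinity_lag" by (auto simp: infinity_lag_def block_mat_vec)
    show "infinity_lag \<subseteq> (*v) ?N ` infinity_lag"
    proof
      fix y assume "y \<in> infinity_lag"
      then obtain w where "y = block_vec w 0" by (auto simp: infinity_lag_def)
      then show "y \<in> (*v) ?N ` infinity_lag"
        by (intro image_eqI[of _ _ "block_vec (transpose S *v w) 0"])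
          (simp_all add: block_mat_vec mem_infinity_lag matrix_vector_mul_assoc inv del: transpose_matrix_vector)
    qed
  qed
  moreover have "(*v) ?N ` mat_lag 0 = l" "(*v) ?N ` mat_lag (mat 1) = m"
    unfolding image_mat_lag_upper[OF PS(2)] XY by (simp_all add: XSP PS(1) matrix_mul_add_rdistrib)
  ultimately show "maximal_triple infinity_lag l m"
    unfolding maximal_triple_iff using N by (intro bexI[of _ ?N]) simp_all
qed

lemma maximal_triple_chart:
  assumes "N \<in> Sp"
  shows "maximal_triple ((*v) N ` infinity_lag) l m \<longleftrightarrow>
    (\<exists>X Y. transpose X = X \<and> transpose Y = Y \<and> pos_def (Y - X) \<and>
      l = (*v) N ` mat_lag X \<and> m = (*v) N ` mat_lag Y)"
proof -
  have *: "l = (*v) N ` l' \<longleftrightarrow> (*v) (matrix_inv N) ` l = l'" for l l'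
    using Sp_inv_image[OF assms, of l] Sp_inv_image[OF assms, of l'] by (auto simp only:)
  have "maximal_triple ((*v) N ` infinity_lag) l m \<longleftrightarrow>
      maximal_triple infinity_lag ((*v) (matrix_inv N) ` l) ((*v) (matrix_inv N) ` m)"
    using maximal_triple_Sp_iff[OF assms, of infinity_lag "(*v) (matrix_inv N) ` l" "(*v) (matrix_inv N) ` m"]
    by (simp add: Sp_inv_image(2)[OF assms])
  then show ?thesis unfolding maximal_triple_infinity_iff * .
qed

lemma maximal_triple_obtain_chart:
  assumes "maximal_triple a b c"
  obtains N where "N \<in> Sp" "a = (*v) N ` infinity_lag"
  using assms unfolding maximal_triple_iff by blast

lemma image_mat_lag_inject:
  assumes "N \<in> Sp"
  shows "(*v) N ` mat_lag X = (*v) N ` mat_lag Y \<longleftrightarrow> X = Y"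
proof
  assume "(*v) N ` mat_lag X = (*v) N ` mat_lag Y"
  then have "(*v) (matrix_inv N) ` (*v) N ` mat_lag X = (*v) (matrix_inv N) ` (*v) N ` mat_lag Y"
    by (rule arg_cong)
  then show "X = Y" by (simp add: Sp_inv_image[OF assms] mat_lag_inject)
qed simp

lemma pos_def_add: "pos_def X \<Longrightarrow> pos_def Y \<Longrightarrow> pos_def (X + Y)"
  unfolding pos_def_def
  by (auto simp: transpose_add matrix_vector_mult_add_rdistrib inner_add_right add_pos_pos)

text \<open>In a chart with \<open>a\<close> at infinity, the differences add up and a sum of
  positive definite matrices is positive definite.\<close>

lemma maximal_triple_trans:
  assumes "maximal_triple a b c" "maximal_triple a c d"
  shows "maximal_triple a b d"
proof -
  obtain N where N: "N \<in> Sp" "a = (*v) N ` infinity_lag"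
    using maximal_triple_obtain_chart assms by blast
  obtain X Y where XY: "transpose X = X" "transpose Y = Y" "pos_def (Y - X)"
      "b = (*v) N ` mat_lag X" "c = (*v) N ` mat_lag Y"
    using assms(1) unfolding N(2) maximal_triple_chart[OF N(1)] by blast
  obtain Y' Z where Z: "transpose Z = Z" "pos_def (Z - Y')"
      "c = (*v) N ` mat_lag Y'" "d = (*v) N ` mat_lag Z"
    using assms(2) unfolding N(2) maximal_triple_chart[OF N(1)] by blast
  have "Y' = Y" using XY(5) Z(3) by (simp add: image_mat_lag_inject[OF N(1)])
  with Z have "pos_def (Z - Y)" by simp
  with XY(3) have "pos_def ((Y - X) + (Z - Y))" by (rule pos_def_add)
  then have "pos_def (Z - X)" by simp
  then show ?thesis unfolding N(2) maximal_triple_chart[OF N(1)] using XY Z by blast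
qed

section \<open>Limits of Lagrangians\<close>

text \<open>Convergence of symmetric coordinates in a single chart. It implies convergence in
  \<open>lag_topology\<close> and fits the order, whose monotone limits are limits of symmetric
  matrices.\<close>

definition lag_limit :: "'i filter \<Rightarrow> ('i \<Rightarrow> lag) \<Rightarrow> lag \<Rightarrow> bool" where
  "lag_limit F f l \<longleftrightarrow> (\<exists>N\<in>Sp. \<exists>X X0. (X \<longlongrightarrow> X0) F \<and> transpose X0 = X0 \<and>
     eventually (\<lambda>i. transpose (X i) = X i \<and> f i = (*v) N ` mat_lag (X i)) F \<and> l = (*v) N ` mat_lag X0)"

lemma tendsto_matrix_vector_mult:
  fixes X :: "'i \<Rightarrow> real ^ 'n ^ 'm"
  assumes "(X \<longlongrightarrow> X0) F"
  shows "((\<lambda>i. X i *v v) \<longlongrightarrow> X0 *v v) F"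
proof (rule vec_tendstoI)
  fix k
  have "((\<lambda>i. X i $ k) \<longlongrightarrow> X0 $ k) F" using assms by (rule tendsto_vec_nth)
  then have "((\<lambda>i. X i $ k \<bullet> v) \<longlongrightarrow> X0 $ k \<bullet> v) F"
    by (rule tendsto_inner[OF _ tendsto_const])
  then show "((\<lambda>i. (X i *v v) $ k) \<longlongrightarrow> (X0 *v v) $ k) F"
    by (simp add: matrix_vector_mul_component)
qed

lemma tendsto_symp:
  assumes "(f \<longlongrightarrow> a) F" "(g \<longlongrightarrow> b) F"
  shows "((\<lambda>i. symp (f i) (g i)) \<longlongrightarrow> symp a b) F"
  unfolding symp_def
  using assms(1) bounded_linear.tendsto[OF matrix_vector_mul_bounded_linear assms(2)]
  by (rule tendsto_inner)

lemma tendsto_block_vec: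
  fixes f g :: "'i \<Rightarrow> real ^ 2"
  assumes "(f \<longlongrightarrow> a) F" "(g \<longlongrightarrow> b) F"
  shows "((\<lambda>i. block_vec (f i) (g i)) \<longlongrightarrow> block_vec a b) F"
proof (rule vec_tendstoI)
  fix k :: "2 + 2"
  show "((\<lambda>i. block_vec (f i) (g i) $ k) \<longlongrightarrow> block_vec a b $ k) F"
    by (cases k) (auto intro: tendsto_vec_nth assms)
qed

lemma Lagrangian_symp:
  "l \<in> Lagrangians \<Longrightarrow> u \<in> l \<Longrightarrow> v \<in> l \<Longrightarrow> symp u v = 0"
  by (simp add: Lagrangians_def symp_def)

text \<open>Maximal isotropy: a Lagrangian contains everything symplectically orthogonal to
  it.\<close>

lemma mat_lag_symp_orthogonal:
  assumes "transpose X = X" "\<And>u. u \<in> mat_lag X \<Longrightarrow> symp u v = 0"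
  shows "v \<in> mat_lag X"
proof -
  obtain a b where v: "v = block_vec a b" by (rule block_vec_cases)
  have "w \<bullet> (X *v b - a) = 0" for w
  proof -
    have "block_vec (X *v w) w \<in> mat_lag X" by (simp add: mem_mat_lag)
    from assms(2)[OF this] show ?thesis
      by (simp add: v symp_block_vec inner_matrix_vector assms(1) inner_diff_right)
  qed
  from this[of "X *v b - a"] show ?thesis by (simp add: v mem_mat_lag)
qed

lemma lag_limit_Lagrangian: "lag_limit F f l \<Longrightarrow> l \<in> Lagrangians"
  by (auto simp: lag_limit_def Lagrangians_image Lagrangians_mat_lag)

text \<open>The two limits may be witnessed in different charts. Vectors of \<open>l\<close> and of
  \<open>l'\<close> are limits of vectors of the same Lagrangians \<open>f i\<close>, where the
  symplectic form vanishes. Hence \<open>l\<close> is orthogonal to \<open>l'\<close> and lies in it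
  by maximal isotropy.\<close>

lemma lag_limit_subset:
  assumes "F \<noteq> bot" "lag_limit F f l" "lag_limit F f l'"
  shows "l \<subseteq> l'"
proof
  fix u assume u: "u \<in> l"
  obtain N X X0 where N: "N \<in> Sp" "(X \<longlongrightarrow> X0) F" "transpose X0 = X0" "l = (*v) N ` mat_lag X0"
    "eventually (\<lambda>i. transpose (X i) = X i \<and> f i = (*v) N ` mat_lag (X i)) F"
    using assms(2) unfolding lag_limit_def by blast
  obtain N' X' X0' where N': "N' \<in> Sp" "(X' \<longlongrightarrow> X0') F" "transpose X0' = X0'" "l' = (*v) N' ` mat_lag X0'"
    "eventually (\<lambda>i. transpose (X' i) = X' i \<and> f i = (*v) N' ` mat_lag (X' i)) F"
    using assms(3) unfolding lag_limit_def by blast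
  obtain w where w: "u = N *v block_vec (X0 *v w) w" using u by (auto simp: N(4) mat_lag_def)
  have "symp u' (matrix_inv N' *v u) = 0" if u': "u' \<in> mat_lag X0'" for u'
  proof -
    obtain w' where w': "u' = block_vec (X0' *v w') w'" using u' by (auto simp: mat_lag_def)
    let ?g = "\<lambda>i. symp (N' *v block_vec (X' i *v w') w') (N *v block_vec (X i *v w) w)"
    have "(?g \<longlongrightarrow> symp (N' *v u') u) F"
      unfolding w w'
      by (intro tendsto_symp bounded_linear.tendsto[OF matrix_vector_mul_bounded_linear]
          tendsto_block_vec tendsto_matrix_vector_mult N N' tendsto_const)
    moreover have "eventually (\<lambda>i. ?g i = 0) F"
      using N(5) N'(5)
    proof eventually_elim
      case (elim i)
      have "f i \<in> Lagrangians" using elim(1) N(1) by (auto simp: Lagrangians_image Lagrangians_mat_lag)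
      moreover have "N' *v block_vec (X' i *v w') w' \<in> f i" using elim(2) by (auto simp: mat_lag_def)
      moreover have "N *v block_vec (X i *v w) w \<in> f i" using elim(1) by (auto simp: mat_lag_def)
      ultimately show ?case by (rule Lagrangian_symp)
    qed
    then have "(?g \<longlongrightarrow> 0) F" by (rule tendsto_eventually)
    ultimately have "symp (N' *v u') u = 0" using assms(1) tendsto_unique by blast
    moreover have "symp (N' *v u') (N' *v (matrix_inv N' *v u)) = symp u' (matrix_inv N' *v u)"
      by (rule symp_Sp[OF N'(1)])
    ultimately show ?thesis
      by (simp add: matrix_vector_mul_assoc matrix_inv_inverse Sp_invertible N'(1))
  qed
  then have "matrix_inv N' *v u \<in> mat_lag X0'" using mat_lag_symp_orthogonal N'(3) by blast
  moreover have "u = N' *v (matrix_inv N' *v u)"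
    by (simp add: matrix_vector_mul_assoc matrix_inv_inverse Sp_invertible N'(1))
  ultimately show "u \<in> l'" unfolding N'(4) by (rule image_eqI[rotated])
qed

lemma lag_limit_unique:
  assumes "F \<noteq> bot" "lag_limit F f l" "lag_limit F f l'"
  shows "l = l'"
  using lag_limit_subset assms by blast

lemma lag_limit_Sp:
  assumes "N \<in> Sp" "lag_limit F f l"
  shows "lag_limit F (\<lambda>i. (*v) N ` f i) ((*v) N ` l)"
proof -
  obtain N' X X0 where N': "N' \<in> Sp" "(X \<longlongrightarrow> X0) F" "transpose X0 = X0" "l = (*v) N' ` mat_lag X0"
    "eventually (\<lambda>i. transpose (X i) = X i \<and> f i = (*v) N' ` mat_lag (X i)) F"
    using assms(2) unfolding lag_limit_def by blast
  have "eventually (\<lambda>i. transpose (X i) = X i \<and> (*v) N ` f i = (*v) (N ** N') ` mat_lag (X i)) F"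
    using N'(5) by eventually_elim (simp add: image_matrix_mult)
  then show ?thesis
    unfolding lag_limit_def using N' Sp_mult[OF assms(1) N'(1)]
    by (intro bexI[of _ "N ** N'"] exI[of _ X] exI[of _ X0]) (simp_all add: image_matrix_mult)
qed

lemma lag_limit_filtermap: "lag_limit (filtermap g F) f l \<longleftrightarrow> lag_limit F (\<lambda>i. f (g i)) l"
proof
  assume "lag_limit F (\<lambda>i. f (g i)) l"
  then obtain N X X0 where N: "N \<in> Sp" "(X \<longlongrightarrow> X0) F" "transpose X0 = X0" "l = (*v) N ` mat_lag X0"
    "eventually (\<lambda>i. transpose (X i) = X i \<and> f (g i) = (*v) N ` mat_lag (X i)) F"
    unfolding lag_limit_def by blast
  \<comment> \<open>The given coordinates depend on \<open>i\<close>, while a limit along the image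
    filter needs them as a function of \<open>g i\<close>. Injectivity of the chart lets them be
    read off from \<open>f\<close>.\<close>
  define Y where "Y j = (THE Z. f j = (*v) N ` mat_lag Z)" for j
  have Y: "Y j = Z" if "f j = (*v) N ` mat_lag Z" for j Z
    unfolding Y_def that by (rule the_equality) (simp_all add: image_mat_lag_inject[OF N(1)])
  have YX: "eventually (\<lambda>i. Y (g i) = X i) F"
    using N(5) by eventually_elim (auto intro: Y)
  then have "((\<lambda>i. Y (g i)) \<longlongrightarrow> X0) F" using N(2) by (subst tendsto_cong)
  then have "(Y \<longlongrightarrow> X0) (filtermap g F)" by (simp add: filterlim_filtermap)
  moreover have "eventually (\<lambda>i. transpose (Y i) = Y i \<and> f i = (*v) N ` mat_lag (Y i)) (filtermap g F)"
    unfolding eventually_filtermap using N(5) YX by eventually_elim simp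
  ultimately show "lag_limit (filtermap g F) f l" unfolding lag_limit_def using N by blast
next
  assume "lag_limit (filtermap g F) f l"
  then show "lag_limit F (\<lambda>i. f (g i)) l"
    unfolding lag_limit_def filterlim_filtermap eventually_filtermap by blast
qed

lemma lag_limit_mono: "lag_limit F f l \<Longrightarrow> F' \<le> F \<Longrightarrow> lag_limit F' f l"
  unfolding lag_limit_def by (blast intro: tendsto_mono filter_leD)

text \<open>The chart \<open>X \<mapsto> N mat_lag X\<close> lifts to the continuous family of frames with columns
  \<open>N (X e\<^sub>i, e\<^sub>i)\<close>.\<close>

lemma lag_limit_imp_limitin:
  assumes "lag_limit F f l"
  shows "limitin lag_topology f l F"
proof -
  obtain N X X0 where N: "N \<in> Sp" "(X \<longlongrightarrow> X0) F" "transpose X0 = X0" "l = (*v) N ` mat_lag X0"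
    "eventually (\<lambda>i. transpose (X i) = X i \<and> f i = (*v) N ` mat_lag (X i)) F"
    using assms unfolding lag_limit_def by blast
  define frame :: "real ^ 2 ^ 2 \<Rightarrow> real ^ 2 ^ (2 + 2)"
    where "frame Y = N ** (\<chi> k. case k of Inl i \<Rightarrow> Y $ i | Inr i \<Rightarrow> mat 1 $ i)" for Y
  have "(\<chi> k. case k of Inl i \<Rightarrow> Y $ i | Inr i \<Rightarrow> mat 1 $ i) *v w = block_vec (Y *v w) w" for Y :: "real ^ 2 ^ 2" and w
  proof -
    have "(mat 1 *v w) $ i = w $ i" for i by simp
    then show ?thesis
      by (simp add: vec_sum_eq_iff matrix_vector_mult_def)
  qed
  then have range_frame: "range ((*v) (frame Y)) = (*v) N ` mat_lag Y" for Y
    unfolding frame_def mat_lag_def image_image matrix_vector_mul_assoc[symmetric] by simp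
  have frame_lim: "((\<lambda>i. frame (X i)) \<longlongrightarrow> frame X0) F"
  proof (intro vec_tendstoI)
    fix a :: "2 + 2" and b :: 2
    have "((\<lambda>i. (case k of Inl j \<Rightarrow> X i $ j | Inr j \<Rightarrow> mat 1 $ j) $ b) \<longlongrightarrow>
        (case k of Inl j \<Rightarrow> X0 $ j | Inr j \<Rightarrow> mat 1 $ j) $ b) F" for k
      by (cases k) (auto intro!: tendsto_vec_nth N(2))
    then show "((\<lambda>i. frame (X i) $ a $ b) \<longlongrightarrow> frame X0 $ a $ b) F"
      unfolding frame_def matrix_matrix_mult_def by (simp, intro tendsto_sum tendsto_mult tendsto_const)
  qed
  have l: "l \<in> Lagrangians" using N by (simp add: Lagrangians_image Lagrangians_mat_lag)
  have "topspace lag_topology = Lagrangians"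
    unfolding topspace_def openin_lag_topology by (auto intro: exI[of _ Lagrangians])
  moreover have "eventually (\<lambda>i. f i \<in> U) F" if U: "openin lag_topology U" "l \<in> U" for U
  proof -
    obtain T where T: "open T" "{A. range ((*v) A) \<in> U} = {A :: real ^ 2 ^ (2 + 2). range ((*v) A) \<in> Lagrangians} \<inter> T"
      using U(1) unfolding openin_lag_topology openin_open by blast
    have "range ((*v) (frame X0)) \<in> U" using U(2) by (simp add: range_frame N(4))
    then have "frame X0 \<in> T" using T(2) by blast
    then have "eventually (\<lambda>i. frame (X i) \<in> T) F" using frame_lim T(1) by (rule topological_tendstoD[rotated 2])
    with N(5) show ?thesis
    proof eventually_elim
      case (elim i)
      then have "range ((*v) (frame (X i))) \<in> Lagrangians"
        unfolding range_frame using N(1) by (simp add: Lagrangians_image Lagrangians_mat_lag)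
      then have "range ((*v) (frame (X i))) \<in> U" using elim(2) T(2) by blast
      then show "f i \<in> U" using elim(1) by (simp add: range_frame)
    qed
  qed
  ultimately show ?thesis unfolding limitin_def using l by simp
qed

section \<open>Symmetric matrices and their quadratic forms\<close>

definition qform :: "real ^ 2 ^ 2 \<Rightarrow> real ^ 2 \<Rightarrow> real" where
  "qform X v = v \<bullet> (X *v v)"

lemma qform_2: "qform X v = X $ 1 $ 1 * (v $ 1)\<^sup>2 + (X $ 1 $ 2 + X $ 2 $ 1) * (v $ 1) * (v $ 2) + X $ 2 $ 2 * (v $ 2)\<^sup>2"
  by (simp add: qform_def inner_vec_def matrix_vector_mult_def sum_2 power2_eq_square algebra_simps)

text \<open>Polarisation: the entries come from the values at \<open>e1\<close>, \<open>e2\<close>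
  and \<open>e1 + e2\<close>.\<close>

lemma sym_matrix_of_qform:
  assumes "transpose X = X"
  shows "X = vector [vector [qform X (vector [1, 0]), (qform X (vector [1, 1]) - qform X (vector [1, 0]) - qform X (vector [0, 1])) / 2],
    vector [(qform X (vector [1, 1]) - qform X (vector [1, 0]) - qform X (vector [0, 1])) / 2, qform X (vector [0, 1])]]"
proof -
  have "transpose X $ 2 $ 1 = X $ 2 $ 1" by (simp add: assms)
  then have "X $ 1 $ 2 = X $ 2 $ 1" by (simp add: transpose_def)
  then show ?thesis by (simp add: vec_eq_iff forall_2 qform_2)
qed

text \<open>By polarisation, pointwise convergence of the quadratic forms is enough; monotone
  families of matrices thereby reduce to monotone real functions, one for each vector.\<close>

lemma sym_matrix_converges:
  assumes "eventually (\<lambda>i. transpose (X i) = X i) F" "\<And>v. \<exists>L. ((\<lambda>i. qform (X i) v) \<longlongrightarrow> L) F"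
  obtains X0 where "transpose X0 = X0" "(X \<longlongrightarrow> X0) F"
proof -
  obtain L where L: "\<And>v. ((\<lambda>i. qform (X i) v) \<longlongrightarrow> L v) F" using assms(2) by metis
  define m where "m q = (vector [vector [q (vector [1, 0]), (q (vector [1, 1]) - q (vector [1, 0]) - q (vector [0, 1])) / 2],
    vector [(q (vector [1, 1]) - q (vector [1, 0]) - q (vector [0, 1])) / 2, q (vector [0, 1])]] :: real ^ 2 ^ 2)"
    for q :: "real ^ 2 \<Rightarrow> real"
  have "((\<lambda>i. m (qform (X i)) $ a $ b) \<longlongrightarrow> m L $ a $ b) F" for a b
    using exhaust_2[of a] exhaust_2[of b]
    by (elim disjE) (simp_all add: m_def tendsto_diff tendsto_divide L)
  then have "((\<lambda>i. m (qform (X i))) \<longlongrightarrow> m L) F" by (intro vec_tendstoI)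
  moreover have "eventually (\<lambda>i. X i = m (qform (X i))) F"
    using assms(1) by eventually_elim (simp add: m_def sym_matrix_of_qform[symmetric])
  ultimately have "(X \<longlongrightarrow> m L) F" by (subst tendsto_cong) 
  moreover have "transpose (m L) = m L"
    by (simp add: m_def transpose_def vec_eq_iff forall_2)
  ultimately show ?thesis using that by blast
qed

lemma pos_def_iff_qform: "pos_def X \<longleftrightarrow> transpose X = X \<and> (\<forall>v. v \<noteq> 0 \<longrightarrow> qform X v > 0)"
  by (simp add: pos_def_def qform_def)

lemma qform_diff: "qform (X - Y) v = qform X v - qform Y v"
  by (simp add: qform_def matrix_vector_mult_diff_rdistrib inner_diff_right)

lemma qform_zero [simp]: "qform X 0 = 0"
  by (simp add: qform_def)

lemma pos_def_diff_less: "pos_def (Y - X) \<Longrightarrow> v \<noteq> 0 \<Longrightarrow> qform X v < qform Y v"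
  by (simp add: pos_def_iff_qform qform_diff)

lemma pos_def_diff_le: "pos_def (Y - X) \<Longrightarrow> qform X v \<le> qform Y v"
  by (cases "v = 0") (auto dest: pos_def_diff_less)

lemma tendsto_qform: "(X \<longlongrightarrow> X0) F \<Longrightarrow> ((\<lambda>i. qform (X i) v) \<longlongrightarrow> qform X0 v) F"
  unfolding qform_def by (intro tendsto_inner tendsto_const tendsto_matrix_vector_mult)

section \<open>Shilov hyperbolic matrices\<close>

text \<open>Outside the chart the value is unspecified, whence the clauses \<open>l = ...\<close>
  and \<open>m = ...\<close> in \<open>maximal_triple_coord\<close>.\<close>

definition lag_coord :: "real ^ (2 + 2) ^ (2 + 2) \<Rightarrow> lag \<Rightarrow> real ^ 2 ^ 2" where
  "lag_coord N l = (THE X. l = (*v) N ` mat_lag X)"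

lemma lag_coord_eq [simp]: "N \<in> Sp \<Longrightarrow> lag_coord N ((*v) N ` mat_lag X) = X"
  by (simp add: lag_coord_def image_mat_lag_inject eq_commute[of X])

lemma maximal_triple_coord:
  assumes "N \<in> Sp"
  shows "maximal_triple ((*v) N ` infinity_lag) l m \<longleftrightarrow>
    transpose (lag_coord N l) = lag_coord N l \<and> transpose (lag_coord N m) = lag_coord N m \<and>
    l = (*v) N ` mat_lag (lag_coord N l) \<and> m = (*v) N ` mat_lag (lag_coord N m) \<and>
    pos_def (lag_coord N m - lag_coord N l)"
    (is "_ \<longleftrightarrow> ?R")
proof
  assume "maximal_triple ((*v) N ` infinity_lag) l m"
  then show ?R unfolding maximal_triple_chart[OF assms] using assms by auto
next
  assume ?R
  then show "maximal_triple ((*v) N ` infinity_lag) l m"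
    unfolding maximal_triple_chart[OF assms] by blast
qed

lemma maximal_triple_trans':
  assumes "maximal_triple a b c" "maximal_triple a c d"
  shows "maximal_triple b c d"
proof -
  have "maximal_triple c d a" "maximal_triple c a b"
    using assms maximal_triple_rotate by blast+
  then have "maximal_triple c d b" by (rule maximal_triple_trans)
  then show ?thesis using maximal_triple_rotate by blast
qed

text \<open>In the chart with \<open>r\<close> at infinity the sequence is increasing and bounded by
  \<open>u\<close>, so its quadratic forms converge pointwise.\<close>

lemma maximal_triple_increasing_limit:
  assumes inc: "\<And>n. maximal_triple r (f n) (f (Suc n))" and bd: "\<And>n. maximal_triple r (f n) u"
  obtains l where "lag_limit sequentially f l" "\<And>n. maximal_triple r (f n) l"
proof -
  obtain N where N: "N \<in> Sp" "r = (*v) N ` infinity_lag"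
    using inc[of 0] maximal_triple_obtain_chart by blast
  define X where "X n = lag_coord N (f n)" for n
  note tri = maximal_triple_coord[OF N(1), folded N(2)]
  have sym: "transpose (X n) = X n" "f n = (*v) N ` mat_lag (X n)" and less: "pos_def (X (Suc n) - X n)" for n
    using inc[of n] unfolding tri X_def by blast+
  have bound: "pos_def (lag_coord N u - X n)" for n
    using bd[of n] unfolding tri X_def by blast
  have incseq: "incseq (\<lambda>n. qform (X n) v)" for v
    by (rule incseq_SucI) (rule pos_def_diff_le[OF less])
  have lim: "(\<lambda>n. qform (X n) v) \<longlonglongrightarrow> (SUP n. qform (X n) v)" for v
    by (rule LIMSEQ_incseq_SUP[OF _ incseq]) (auto intro!: bdd_aboveI pos_def_diff_le[OF bound])
  obtain X0 where X0: "transpose X0 = X0" "X \<longlonglongrightarrow> X0"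
    by (rule sym_matrix_converges[of X sequentially]) (auto simp: sym intro: lim)
  show ?thesis
  proof (rule that)
    show "lag_limit sequentially f ((*v) N ` mat_lag X0)"
      unfolding lag_limit_def using N(1) X0 sym by (intro bexI[of _ N] exI[of _ X] exI[of _ X0]) auto
    fix n
    \<comment> \<open>A weak inequality at \<open>Suc n\<close>, preceded by the strict step from
      \<open>n\<close>, stays strict at \<open>n\<close> in the limit.\<close>
    have "qform (X (Suc n)) v \<le> qform X0 v" for v
      by (rule incseq_le[OF incseq tendsto_qform[OF X0(2)]])
    then have "pos_def (X0 - X n)"
      unfolding pos_def_iff_qform using X0(1) sym(1) pos_def_diff_less[OF less[of n]]
      by (simp add: transpose_diff qform_diff) (meson less_le_trans)
    then show "maximal_triple r (f n) ((*v) N ` mat_lag X0)"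
      unfolding tri using N(1) X0(1) sym[of n] X_def[of n, symmetric] by simp
  qed
qed

lemma maximal_triple_decreasing_limit:
  assumes dec: "\<And>n. maximal_triple r (f (Suc n)) (f n)" and bd: "\<And>n. maximal_triple r u (f n)"
  obtains l where "lag_limit sequentially f l" "\<And>n. maximal_triple r l (f n)"
proof -
  obtain N where N: "N \<in> Sp" "r = (*v) N ` infinity_lag"
    using dec[of 0] maximal_triple_obtain_chart by blast
  define X where "X n = lag_coord N (f n)" for n
  note tri = maximal_triple_coord[OF N(1), folded N(2)]
  have sym: "transpose (X n) = X n" "f n = (*v) N ` mat_lag (X n)" and less: "pos_def (X n - X (Suc n))" for n
    using dec[of n] unfolding tri X_def by blast+
  have bound: "pos_def (X n - lag_coord N u)" for n
    using bd[of n] unfolding tri X_def by blast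
  have decseq: "decseq (\<lambda>n. qform (X n) v)" for v
    by (rule decseq_SucI) (rule pos_def_diff_le[OF less])
  have lim: "(\<lambda>n. qform (X n) v) \<longlonglongrightarrow> (INF n. qform (X n) v)" for v
    by (rule LIMSEQ_decseq_INF[OF _ decseq]) (auto intro!: bdd_belowI pos_def_diff_le[OF bound])
  obtain X0 where X0: "transpose X0 = X0" "X \<longlonglongrightarrow> X0"
    by (rule sym_matrix_converges[of X sequentially]) (auto simp: sym intro: lim)
  show ?thesis
  proof (rule that)
    show "lag_limit sequentially f ((*v) N ` mat_lag X0)"
      unfolding lag_limit_def using N(1) X0 sym by (intro bexI[of _ N] exI[of _ X] exI[of _ X0]) auto
    fix n
    have "qform X0 v \<le> qform (X (Suc n)) v" for v
      by (rule decseq_ge[OF decseq tendsto_qform[OF X0(2)]])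
    then have "pos_def (X n - X0)"
      unfolding pos_def_iff_qform using X0(1) sym(1) pos_def_diff_less[OF less[of n]]
      by (simp add: transpose_diff qform_diff) (meson le_less_trans)
    then show "maximal_triple r ((*v) N ` mat_lag X0) (f n)"
      unfolding tri using N(1) X0(1) sym[of n] X_def[of n, symmetric] by simp
  qed
qed

section \<open>Expansion, fixed Lagrangians and nested intervals\<close>

definition expanding :: "real ^ 2 ^ 2 \<Rightarrow> bool" where
  "expanding A \<longleftrightarrow> invertible A \<and>
     (\<forall>\<mu> v. v \<noteq> 0 \<and> map_matrix complex_of_real A *v v = \<mu> *s v \<longrightarrow> cmod \<mu> > 1)"

definition Shilov_matrix :: "real ^ (2 + 2) ^ (2 + 2) \<Rightarrow> bool" where
  "Shilov_matrix M \<longleftrightarrow> (\<exists>N\<in>Sp. \<exists>A. expanding A \<and>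
     M = N ** block_mat A 0 0 (transpose (matrix_inv A)) ** matrix_inv N)"

lemma Shilov_hyperbolic_iff: "Shilov_hyperbolic g \<longleftrightarrow> (\<exists>M\<in>g. Shilov_matrix M)"
  unfolding Shilov_hyperbolic_def Shilov_matrix_def expanding_def by blast

lemma matrix_inv_unique:
  fixes A B :: "real ^ 'n ^ 'n"
  assumes "A ** B = mat 1" shows "matrix_inv A = B"
proof -
  have "invertible A" using assms invertible_right_inverse by blast
  then have "matrix_inv A ** (A ** B) = B" unfolding matrix_mul_assoc by (simp add: matrix_inv_inverse)
  then show ?thesis by (simp add: assms)
qed

text \<open>The hypothesis says that \<open>transpose P\<close> expands norms. With
  \<open>v = transpose P *v w\<close> one has \<open>norm w < norm v\<close>, and Cauchy-Schwarz
  applied to \<open>v \<bullet> v = w \<bullet> (P *v v)\<close> passes the expansion on to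
  \<open>P\<close>.\<close>

lemma norm_expanding:
  fixes P :: "real ^ 2 ^ 2"
  assumes "invertible P" "pos_def (P ** transpose P - mat 1)" "v \<noteq> 0"
  shows "norm v < norm (P *v v)"
proof -
  have T: "norm x < norm (transpose P *v x)" if "x \<noteq> 0" for x
  proof -
    have "0 < x \<bullet> ((P ** transpose P - mat 1) *v x)" using assms(2) that by (simp add: pos_def_def)
    also have "\<dots> = x \<bullet> (P *v (transpose P *v x)) - x \<bullet> x"
      by (simp add: matrix_vector_mult_diff_rdistrib inner_diff_right matrix_vector_mul_assoc del: transpose_matrix_vector)
    also have "x \<bullet> (P *v (transpose P *v x)) = (transpose P *v x) \<bullet> (transpose P *v x)"
      unfolding inner_matrix_vector transpose_transpose ..
    finally have "(norm x)\<^sup>2 < (norm (transpose P *v x))\<^sup>2" by (simp add: power2_norm_eq_inner)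
    then show ?thesis by (simp add: power2_less_imp_less)
  qed
  define w where "w = transpose (matrix_inv P) *v v"
  have "transpose P ** transpose (matrix_inv P) = transpose (matrix_inv P ** P)"
    by (simp add: matrix_transpose_mul)
  then have Pw: "transpose P *v w = v"
    unfolding w_def matrix_vector_mul_assoc by (simp add: matrix_inv_inverse assms(1) transpose_mat_1)
  then have "w \<noteq> 0" using assms(3) by auto
  have "(norm v)\<^sup>2 = (transpose P *v w) \<bullet> v" by (simp only: Pw power2_norm_eq_inner)
  also have "\<dots> = w \<bullet> (P *v v)" unfolding inner_matrix_vector transpose_transpose ..
  also have "\<dots> \<le> norm w * norm (P *v v)" by (rule norm_cauchy_schwarz)
  also have "\<dots> \<le> norm v * norm (P *v v)"
    using T[OF \<open>w \<noteq> 0\<close>] unfolding Pw by (intro mult_right_mono) simp_all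
  finally have le: "norm v \<le> norm (P *v v)" using assms(3) by (simp add: power2_eq_square)
  then have "P *v v \<noteq> 0" using assms(3) by auto
  then have "norm w * norm (P *v v) < norm v * norm (P *v v)"
    using T[OF \<open>w \<noteq> 0\<close>] unfolding Pw by simp
  moreover have "(norm v)\<^sup>2 \<le> norm w * norm (P *v v)"
    unfolding \<open>(norm v)\<^sup>2 = (transpose P *v w) \<bullet> v\<close> \<open>(transpose P *v w) \<bullet> v = w \<bullet> (P *v v)\<close>
    by (rule norm_cauchy_schwarz)
  ultimately have "norm v * norm v < norm v * norm (P *v v)" by (simp add: power2_eq_square)
  then show ?thesis using assms(3) by simp
qed

text \<open>Split a complex eigenvector into real and imaginary parts \<open>a\<close>,
  \<open>b\<close>: the squared modulus of the eigenvalue times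
  \<open>(norm a)\<^sup>2 + (norm b)\<^sup>2\<close> equals the same sum for \<open>P *v a\<close>
  and \<open>P *v b\<close>, and one of the two parts is nonzero.\<close>

lemma expandingI:
  assumes "invertible P" "\<And>v. v \<noteq> 0 \<Longrightarrow> norm v < norm (P *v v)"
  shows "expanding P"
  unfolding expanding_def
proof (intro conjI allI impI, fact, elim conjE)
  fix \<mu> and v :: "complex ^ 2"
  assume v: "v \<noteq> 0" and eig: "map_matrix complex_of_real P *v v = \<mu> *s v"
  define a b :: "real ^ 2" where "a = (\<chi> i. Re (v $ i))" and "b = (\<chi> i. Im (v $ i))"
  have comp: "\<mu> * v $ i = Complex ((P *v a) $ i) ((P *v b) $ i)" for i
  proof -
    have "\<mu> * v $ i = (map_matrix complex_of_real P *v v) $ i" by (simp add: eig)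
    then show ?thesis
      by (simp add: complex_eq_iff matrix_vector_mult_def map_matrix_def a_def b_def)
  qed
  have sq: "(norm x)\<^sup>2 = (\<Sum>i\<in>UNIV. (x $ i)\<^sup>2)" for x :: "real ^ 2"
    unfolding power2_norm_eq_inner inner_vec_def by (simp add: power2_eq_square)
  have "(cmod (\<mu> * v $ i))\<^sup>2 = (cmod \<mu>)\<^sup>2 * ((a $ i)\<^sup>2 + (b $ i)\<^sup>2)" for i
    by (simp add: norm_mult power_mult_distrib cmod_power2[of "v $ i"] a_def b_def)
  then have "(cmod \<mu>)\<^sup>2 * ((norm a)\<^sup>2 + (norm b)\<^sup>2) = (\<Sum>i\<in>UNIV. (cmod (\<mu> * v $ i))\<^sup>2)"
    unfolding sq by (simp add: sum_distrib_left[symmetric] sum.distrib)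
  also have "\<dots> = (norm (P *v a))\<^sup>2 + (norm (P *v b))\<^sup>2"
    unfolding comp sq by (simp add: cmod_power2 sum.distrib)
  finally have eq: "(cmod \<mu>)\<^sup>2 * ((norm a)\<^sup>2 + (norm b)\<^sup>2) = (norm (P *v a))\<^sup>2 + (norm (P *v b))\<^sup>2" .
  have le: "(norm x)\<^sup>2 \<le> (norm (P *v x))\<^sup>2" and less: "x \<noteq> 0 \<Longrightarrow> (norm x)\<^sup>2 < (norm (P *v x))\<^sup>2" for x
    using assms(2)[of x] by (cases "x = 0"; simp add: power_mono power_strict_mono less_imp_le)+
  have ab: "a \<noteq> 0 \<or> b \<noteq> 0" using v by (auto simp: a_def b_def vec_eq_iff complex_eq_iff)
  then have pos: "(norm a)\<^sup>2 + (norm b)\<^sup>2 > 0" by (auto simp: add_pos_nonneg add_nonneg_pos)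
  have "(norm a)\<^sup>2 + (norm b)\<^sup>2 < (norm (P *v a))\<^sup>2 + (norm (P *v b))\<^sup>2"
    using ab by (blast intro: add_less_le_mono add_le_less_mono le less)
  then have "1 * ((norm a)\<^sup>2 + (norm b)\<^sup>2) < (cmod \<mu>)\<^sup>2 * ((norm a)\<^sup>2 + (norm b)\<^sup>2)"
    by (simp add: eq)
  then have "1 < (cmod \<mu>)\<^sup>2" using pos by (simp only: mult_less_cancel_right)
  then show "1 < cmod \<mu>" using power2_less_imp_less[of 1 "cmod \<mu>"] by simp
qed

text \<open>Move \<open>l1\<close>, \<open>l2\<close>, \<open>c\<close> to infinity, 0, Id. Fixing
  the first two makes \<open>g\<close> block diagonal, and it moves Id to
  \<open>P ** transpose P\<close>, which exceeds Id because \<open>c\<close> advances.\<close>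

lemma Shilov_matrix_of_fixed:
  assumes g: "g \<in> Sp" and fix1: "(*v) g ` l1 = l1" and fix2: "(*v) g ` l2 = l2"
    and "maximal_triple l1 l2 c" and exp: "maximal_triple l1 c ((*v) g ` c)"
  shows "Shilov_matrix g"
proof -
  obtain N where N: "N \<in> Sp" "l1 = (*v) N ` infinity_lag" "l2 = (*v) N ` mat_lag 0" "c = (*v) N ` mat_lag (mat 1)"
    using assms(4) unfolding maximal_triple_iff by blast
  define g' where "g' = matrix_inv N ** g ** N"
  have g': "g' \<in> Sp" unfolding g'_def by (intro Sp_mult Sp_matrix_inv N g)
  have conj: "(*v) g' ` l = (*v) (matrix_inv N) ` (*v) g ` (*v) N ` l" for l
    by (simp add: g'_def image_matrix_mult)
  have "(*v) g' ` infinity_lag = infinity_lag"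
    unfolding conj N(2)[symmetric] fix1 by (simp add: N(2) Sp_inv_image[OF N(1)])
  then obtain P Q S :: "real ^ 2 ^ 2" where PQS: "g' = block_mat P Q 0 S" "transpose P ** S = mat 1"
    using Sp_fix_infinity[OF g'] by blast
  note inv = transpose_mult_one_commute[OF PQS(2)]
  have "(*v) g' ` mat_lag 0 = mat_lag 0"
    unfolding conj N(3)[symmetric] fix2 by (simp add: N(3) Sp_inv_image[OF N(1)])
  then have "Q ** transpose P = 0"
    unfolding PQS(1) image_mat_lag_upper[OF PQS(2)] by (simp add: mat_lag_inject)
  then have "Q ** transpose P ** S = 0" by simp
  then have Q: "Q = 0" unfolding matrix_mul_assoc[symmetric] PQS(2) by simp
  have Pi: "matrix_inv P = transpose S" "invertible P"
    using matrix_inv_unique[OF inv(2)] inv(2) invertible_right_inverse by auto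
  have gN: "g = N ** g' ** matrix_inv N"
  proof -
    have "N ** g' ** matrix_inv N = (N ** matrix_inv N) ** g ** (N ** matrix_inv N)"
      by (simp add: g'_def matrix_mul_assoc)
    then show ?thesis by (simp add: matrix_inv_inverse Sp_invertible N(1))
  qed
  have "(*v) g ` c = (*v) N ` (*v) g' ` mat_lag (mat 1)"
    unfolding conj N(4) by (simp add: Sp_inv_image[OF N(1)])
  also have "\<dots> = (*v) N ` mat_lag (P ** transpose P)"
    unfolding PQS(1) image_mat_lag_upper[OF PQS(2)] Q by simp
  finally have "pos_def (P ** transpose P - mat 1)"
    using exp unfolding N(2) maximal_triple_coord[OF N(1)] by (simp add: N(4) N(1))
  then have "expanding P" using expandingI norm_expanding Pi(2) by blast
  moreover have "g' = block_mat P 0 0 (transpose (matrix_inv P))"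
    by (simp add: PQS(1) Q Pi)
  ultimately show ?thesis unfolding Shilov_matrix_def using gN N(1) by metis
qed

text \<open>The hypotheses say that \<open>c\<close>, \<open>g c\<close>, \<open>g d\<close>,
  \<open>d\<close> are in cyclic order, so \<open>g\<close> maps the interval from \<open>c\<close>
  to \<open>d\<close> inside itself. The forward orbit of \<open>c\<close> increases to the fixed
  Lagrangian \<open>l1\<close>, and its backward orbit, outside the interval, decreases to the fixed
  Lagrangian \<open>l2\<close>.\<close>

lemma Shilov_matrix_of_nested:
  assumes g: "g \<in> Sp" and F1: "maximal_triple c ((*v) g ` c) ((*v) g ` d)"
    and F2: "maximal_triple c ((*v) g ` d) d"
  shows "Shilov_matrix g"
proof -
  let ?M = maximal_triple
  define G where "G = (`) ((*v) g)"
  define H where "H = (`) ((*v) (matrix_inv g))"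
  have GH [simp]: "G (H l) = l" "H (G l) = l" for l
    unfolding G_def H_def by (simp_all add: Sp_inv_image g)
  have MG: "?M a b c \<Longrightarrow> ?M (G a) (G b) (G c)" for a b c
    unfolding G_def by (rule maximal_triple_Sp[OF g])
  have MH: "?M a b c \<Longrightarrow> ?M (H a) (H b) (H c)" for a b c
    unfolding H_def by (rule maximal_triple_Sp[OF Sp_matrix_inv[OF g]])
  note rot = maximal_triple_rotate and tr = maximal_triple_trans and tr' = maximal_triple_trans'
  have F1: "?M c (G c) (G d)" and F2: "?M c (G d) d" using assms by (simp_all add: G_def)
  have F3: "?M c (G c) d" using F1 F2 by (rule tr)
  have F4: "?M (G c) (G d) d" using F1 F2 by (rule tr')
  define up where "up n = (G ^^ n) c" for n
  define dn where "dn n = (H ^^ n) c" for n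
  have up: "up 0 = c" "up (Suc n) = G (up n)" and dn: "dn 0 = c" "dn (Suc n) = H (dn n)" for n
    by (simp_all add: up_def dn_def)
  have Q: "?M c (up (Suc n)) (G d) \<and> ?M c (up (Suc n)) d" for n
  proof (induction n)
    case 0 show ?case using F1 F3 by (simp add: up)
  next
    case (Suc n)
    then have "?M (G c) (up (Suc (Suc n))) (G d)" using MG[of c "up (Suc n)" d] by (simp add: up)
    then have "?M (G d) c (up (Suc (Suc n)))" using tr[OF rot[OF rot[OF F1]]] rot by blast
    then have "?M c (up (Suc (Suc n))) (G d)" by (rule rot)
    then show ?case using F2 tr by blast
  qed
  \<comment> \<open>From here on \<open>G d\<close> is the base point. It serves as infinity for
    both orbits of \<open>c\<close>: the forward one is bounded by \<open>G (G d)\<close>, the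
    backward one by \<open>d\<close>.\<close>
  have B1: "?M (G d) (G c) (G (G d))" using MG[OF rot[OF rot[OF F2]]] .
  have B: "?M (G d) (up (Suc n)) (G (G d))" for n
  proof (cases n)
    case 0 then show ?thesis using B1 by (simp add: up)
  next
    case (Suc m)
    have "?M (G (G d)) (G c) (up (Suc n))"
      using MG[OF rot[OF rot[OF conjunct1[OF Q[of m]]]]] by (simp add: up Suc)
    then have "?M (G (G d)) (G d) (up (Suc n))" using tr[OF rot[OF rot[OF B1]]] by blast
    then show ?thesis by (rule rot)
  qed
  have A: "?M (G d) (up n) (up (Suc n))" for n
  proof (induction n)
    case 0 show ?case using rot[OF rot[OF F1]] by (simp add: up)
  next
    case (Suc n)
    have "?M (G (G d)) (up (Suc n)) (up (Suc (Suc n)))" using MG[OF Suc] by (simp add: up)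
    then show ?case using tr'[OF rot[OF rot[OF B]]] by blast
  qed
  have "?M (G d) (up n) (G (G d))" for n using tr[OF A B] .
  from maximal_triple_increasing_limit[of "G d" up, OF A this]
  obtain l1 where l1: "lag_limit sequentially up l1" "\<And>n. ?M (G d) (up n) l1" by blast
  have S: "?M d (dn (Suc n)) c" for n
  proof (induction n)
    case 0 show ?case using MH[OF rot[OF rot[OF F1]]] by (simp add: dn)
  next
    case (Suc n)
    have 1: "?M (H d) (dn (Suc (Suc n))) (H c)" using MH[OF Suc] by (simp add: dn)
    have 2: "?M (H d) (H c) c" using MH[OF rot[OF rot[OF F3]]] by simp
    have 3: "?M d (H d) c" using MH[OF rot[OF F4]] by simp
    have "?M c (H d) (dn (Suc (Suc n)))" using tr[OF 1 2] rot by blast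
    then have "?M c d (dn (Suc (Suc n)))" using tr[OF rot[OF rot[OF 3]]] by blast
    then show ?case by (rule rot)
  qed
  have L: "?M (G d) d (dn n)" for n
  proof (cases n)
    case 0 then show ?thesis using rot[OF F2] by (simp add: dn)
  next
    case (Suc m)
    show ?thesis using tr'[OF F2 rot[OF rot[OF S[of m]]]] Suc by simp
  qed
  have D: "?M (G d) (dn (Suc n)) (dn n)" for n
  proof (induction n)
    case 0
    show ?case using rot[OF tr[OF F2 rot[OF rot[OF S[of 0]]]]] by (simp add: dn(1))
  next
    case (Suc n)
    have "?M d (dn (Suc (Suc n))) (dn (Suc n))" using MH[OF Suc] by (simp add: dn)
    then have "?M (dn (Suc n)) d (dn (Suc (Suc n)))" using rot by blast
    then have "?M (dn (Suc n)) (G d) (dn (Suc (Suc n)))" using tr[OF rot[OF rot[OF L]]] by blast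
    then show ?case by (rule rot)
  qed
  from maximal_triple_decreasing_limit[of "G d" dn d, OF D L]
  obtain l2 where l2: "lag_limit sequentially dn l2" "\<And>n. ?M (G d) l2 (dn n)" by blast
  have "lag_limit sequentially (\<lambda>n. up (Suc n)) (G l1)"
    using lag_limit_Sp[OF g l1(1)] by (simp add: up G_def)
  \<comment> \<open>Dropping the first term keeps the limit, whereas applying \<open>G\<close>
    termwise gives \<open>G l1\<close>; uniqueness makes \<open>l1\<close> fixed.\<close>
  moreover have Suc_le: "filtermap Suc sequentially \<le> sequentially"
    using filterlim_Suc by (simp add: filterlim_def)
  then have "lag_limit sequentially (\<lambda>n. up (Suc n)) l1"
    using lag_limit_mono[OF l1(1) Suc_le] by (simp add: lag_limit_filtermap)
  ultimately have fix1: "G l1 = l1" using lag_limit_unique sequentially_bot by blast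
  have "lag_limit sequentially (\<lambda>n. dn (Suc n)) (H l2)"
    using lag_limit_Sp[OF Sp_matrix_inv[OF g] l2(1)] by (simp add: dn H_def)
  moreover have "lag_limit sequentially (\<lambda>n. dn (Suc n)) l2"
    using lag_limit_mono[OF l2(1) Suc_le] by (simp add: lag_limit_filtermap)
  ultimately have "H l2 = l2" using lag_limit_unique sequentially_bot by blast
  then have fix2: "G l2 = l2" by (metis GH(1))
  have "?M (G d) l2 c" "?M (G d) c l1" using l1(2)[of 0] l2(2)[of 0] by (simp_all add: up dn)
  then have "?M l2 c l1" by (rule tr')
  then have "?M l1 l2 c" using rot by blast
  moreover have "?M c (G c) l1" using tr'[OF A[of 0] l1(2)[of "Suc 0"]] by (simp add: up)
  then have "?M l1 c (G c)" using rot by blast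
  ultimately show ?thesis
    using Shilov_matrix_of_fixed[OF g, of l1 l2 c] fix1 fix2 by (simp add: G_def)
qed

text \<open>\<open>R ** N\<close> is antisymplectic, so it is corrected on the right by an
  antisymplectic involution \<open>D\<close> commuting with the block diagonal normal form. This
  permits cyclic reduction of words one letter at a time.\<close>

lemma Shilov_matrix_conj_reflection:
  assumes R: "R \<in> Sp_minus" "R ** R = mat 1" and "Shilov_matrix M"
  shows "Shilov_matrix (R ** M ** R)"
proof -
  obtain N A where N: "N \<in> Sp" "expanding A" "M = N ** block_mat A 0 0 (transpose (matrix_inv A)) ** matrix_inv N"
    using assms(3) unfolding Shilov_matrix_def by blast
  let ?B = "block_mat A 0 0 (transpose (matrix_inv A))"
  define D :: "real ^ (2 + 2) ^ (2 + 2)" where "D = block_mat (mat 1) 0 0 (- mat 1)"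
  have D: "D \<in> Sp_minus" "D ** D = mat 1" "D ** ?B ** D = ?B"
    by (simp_all add: D_def block_mat_Sp_minus_iff transpose_mat_1 transpose_minus block_mat_mult
        mat_block_mat minus_matrix_mult matrix_mult_minus)
  have N': "R ** N ** D \<in> Sp" by (intro Sp_minus_mult Sp_minus_Sp_mult R D N)
  have "R ** N ** D ** (D ** matrix_inv N ** R) = R ** (N ** (D ** D) ** matrix_inv N) ** R"
    by (simp add: matrix_mul_assoc)
  also have "\<dots> = mat 1" by (simp add: D R matrix_inv_inverse Sp_invertible N(1))
  finally have inv: "matrix_inv (R ** N ** D) = D ** matrix_inv N ** R" by (rule matrix_inv_unique)
  have "R ** N ** D ** ?B ** (D ** matrix_inv N ** R) = R ** (N ** (D ** ?B ** D) ** matrix_inv N) ** R"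
    by (simp add: matrix_mul_assoc)
  then show ?thesis unfolding Shilov_matrix_def
    by (intro bexI[OF _ N'] exI[of _ A]) (simp add: inv D(3) N(2,3))
qed

section \<open>The circle\<close>

definition wedge :: "complex \<Rightarrow> complex \<Rightarrow> real" where
  "wedge u v = Im (cnj u * v)"

text \<open>For \<open>v \<noteq> 0\<close> this is the square of \<open>v / |v|\<close>. It
  identifies the real lines of the plane with the points of the circle, so that disc isometries act
  through real linear maps and orientation is read off from the area form
  \<open>wedge\<close>.\<close>

definition circ :: "complex \<Rightarrow> complex" where
  "circ v = v / cnj v"

lemma wedge_eq: "wedge u v = Re u * Im v - Im u * Re v"
  by (simp add: wedge_def)

lemma wedge_linear [simp]:
  "wedge (u + u') v = wedge u v + wedge u' v" "wedge u (v + v') = wedge u v + wedge u v'"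
  "wedge (u - u') v = wedge u v - wedge u' v" "wedge u (v - v') = wedge u v - wedge u v'"
  "wedge (c *\<^sub>R u) v = c * wedge u v" "wedge u (c *\<^sub>R v) = c * wedge u v"
  "wedge (- u) v = - wedge u v" "wedge u (- v) = - wedge u v" "wedge u u = 0" "wedge 0 v = 0" "wedge u 0 = 0"
  by (simp_all add: wedge_eq algebra_simps)

lemma wedge_swap: "wedge v u = - wedge u v"
  by (simp add: wedge_eq)

lemma wedge_decompose: "wedge p q *\<^sub>R v = wedge v q *\<^sub>R p + wedge p v *\<^sub>R q"
  by (simp add: wedge_eq complex_eq_iff algebra_simps)

lemma circ_sphere: "v \<noteq> 0 \<Longrightarrow> circ v \<in> sphere 0 1"
  by (simp add: circ_def norm_divide)

lemma circ_eq_iff: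
  assumes "u \<noteq> 0" "v \<noteq> 0" shows "circ u = circ v \<longleftrightarrow> wedge u v = 0"
proof -
  have "circ u = circ v \<longleftrightarrow> u * cnj v = v * cnj u"
    using assms by (simp add: circ_def frac_eq_eq)
  also have "\<dots> \<longleftrightarrow> wedge u v = 0"
    by (auto simp: complex_eq_iff wedge_eq algebra_simps)
  finally show ?thesis .
qed

lemma wedge_zero_parallel:
  assumes "u \<noteq> 0" "wedge u v = 0" obtains r where "v = r *\<^sub>R u"
proof
  have "of_real ((cmod u)\<^sup>2) * v = (cnj u * v) * u"
    by (simp add: complex_norm_square[symmetric] mult_ac)
  also have "cnj u * v = of_real (Re (cnj u * v))"
    using assms(2) by (simp add: wedge_def complex_eq_iff)
  finally show "v = (Re (cnj u * v) / (cmod u)\<^sup>2) *\<^sub>R u"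
    using assms(1) by (simp add: scaleR_conv_of_real field_simps)
qed

lemma circ_scaleR: "r \<noteq> 0 \<Longrightarrow> circ (r *\<^sub>R v) = circ v"
  by (cases "v = 0") (simp_all add: circ_def scaleR_conv_of_real)

lemma circ_cis: "circ (cis (a / 2)) = cis a"
  by (simp add: circ_def cis_cnj cis_divide)

lemma wedge_cis: "wedge (cis a) (cis b) = sin (b - a)"
  by (simp add: wedge_eq sin_diff mult.commute)

lemma sphere_cis: assumes "z \<in> sphere 0 1" obtains b where "a \<le> b" "b < a + 2 * pi" "z = cis b"
proof
  let ?t = "Arg2pi (z / cis a)"
  have "z / cis a = cis ?t"
    using Arg2pi[of "z / cis a"] assms by (simp add: norm_divide is_Arg_def cis_conv_exp[of "Arg2pi _"])
  then show "z = cis (a + ?t)" by (simp add: field_simps cis_mult[symmetric])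
  show "a \<le> a + ?t" "a + ?t < a + 2 * pi"
    using Arg2pi_ge_0[of "z / cis a"] Arg2pi_lt_2pi[of "z / cis a"] by simp_all
qed

lemma circ_surj: assumes "z \<in> sphere 0 1" obtains v where "v \<noteq> 0" "z = circ v"
proof -
  obtain b where "z = cis b" using sphere_cis[OF assms, of 0] by blast
  then show ?thesis using that[of "cis (b / 2)"] by (simp add: circ_cis)
qed

lemma circ_eq_cis: assumes "v \<noteq> 0" "circ v = cis a" obtains r where "r \<noteq> 0" "v = r *\<^sub>R cis (a / 2)"
proof -
  have "wedge (cis (a / 2)) v = 0" using assms circ_eq_iff[of "cis (a / 2)" v] by (simp add: circ_cis)
  then obtain r where "v = r *\<^sub>R cis (a / 2)" using wedge_zero_parallel[of "cis (a / 2)" v] by auto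
  then show ?thesis using that assms(1) by auto
qed

text \<open>Each vector enters the product twice, so its sign depends only on the lines. For unit
  vectors of half the angles the three factors are sines of half the angle differences.\<close>

lemma positively_oriented_circ:
  assumes "u \<noteq> 0" "v \<noteq> 0" "w \<noteq> 0"
  shows "positively_oriented (circ u) (circ v) (circ w) \<longleftrightarrow> wedge u v * wedge v w * wedge u w > 0"
proof -
  obtain a where a: "circ u = cis a" using sphere_cis[OF circ_sphere[OF assms(1)], of 0] by blast
  have key: "wedge u v * wedge v w * wedge u w > 0 \<longleftrightarrow> sin ((b - a) / 2) * sin ((c - b) / 2) * sin ((c - a) / 2) > 0"
    if eqs: "circ u = cis a" "circ v = cis b" "circ w = cis c" for a b c
  proof -
    obtain r s t where r: "r \<noteq> 0" "u = r *\<^sub>R cis (a / 2)" "s \<noteq> 0" "v = s *\<^sub>R cis (b / 2)" "t \<noteq> 0" "w = t *\<^sub>R cis (c / 2)"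
      using circ_eq_cis[OF assms(1) eqs(1)] circ_eq_cis[OF assms(2) eqs(2)] circ_eq_cis[OF assms(3) eqs(3)] by metis
    have "wedge u v * wedge v w * wedge u w = (r * s * t)\<^sup>2 * (sin ((b - a) / 2) * sin ((c - b) / 2) * sin ((c - a) / 2))"
      by (simp add: r wedge_cis power2_eq_square diff_divide_distrib)
    moreover have "(r * s * t)\<^sup>2 > 0" using r by simp
    ultimately show ?thesis by (simp add: zero_less_mult_iff)
  qed
  show ?thesis
  proof
    assume "positively_oriented (circ u) (circ v) (circ w)"
    then obtain a b c where abc: "circ u = cis a" "circ v = cis b" "circ w = cis c" "a < b" "b < c" "c < a + 2 * pi"
      unfolding positively_oriented_def by blast
    then have "sin ((b - a) / 2) > 0" "sin ((c - b) / 2) > 0" "sin ((c - a) / 2) > 0"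
      by (auto intro!: sin_gt_zero)
    then show "wedge u v * wedge v w * wedge u w > 0" unfolding key[OF abc(1-3)] by simp
  next
    assume pos: "wedge u v * wedge v w * wedge u w > 0"
    obtain b where b: "a \<le> b" "b < a + 2 * pi" "circ v = cis b" using sphere_cis[OF circ_sphere[OF assms(2)]] by blast
    obtain c where c: "a \<le> c" "c < a + 2 * pi" "circ w = cis c" using sphere_cis[OF circ_sphere[OF assms(3)]] by blast
    have s: "sin ((b - a) / 2) * sin ((c - b) / 2) * sin ((c - a) / 2) > 0"
      using pos unfolding key[OF a b(3) c(3)] .
    have "a \<noteq> b" "a \<noteq> c" using s by auto
    with b c have "sin ((b - a) / 2) > 0" "sin ((c - a) / 2) > 0" by (auto intro!: sin_gt_zero)
    with s have "sin ((c - b) / 2) > 0" by (simp add: zero_less_mult_iff)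
    moreover have "sin ((c - b) / 2) \<le> 0" if "c \<le> b"
    proof -
      have "sin ((b - c) / 2) \<ge> 0" using that b c by (intro sin_ge_zero) auto
      moreover have "(c - b) / 2 = - ((b - c) / 2)" by (simp add: field_simps)
      ultimately show ?thesis by (simp only: sin_minus)
    qed
    ultimately have "b < c" by fastforce
    with a b c \<open>a \<noteq> b\<close> show "positively_oriented (circ u) (circ v) (circ w)"
      unfolding positively_oriented_def by (intro exI[of _ a] exI[of _ b] exI[of _ c]) auto
  qed
qed

lemma positively_oriented_sphere:
  "positively_oriented x y z \<Longrightarrow> x \<in> sphere 0 1 \<and> y \<in> sphere 0 1 \<and> z \<in> sphere 0 1"
  by (auto simp: positively_oriented_def)

lemma positively_oriented_rotate: "positively_oriented x y z \<Longrightarrow> positively_oriented y z x"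
proof -
  assume "positively_oriented x y z"
  then obtain a b c where abc: "x = cis a" "y = cis b" "z = cis c" "a < b" "b < c" "c < a + 2 * pi"
    unfolding positively_oriented_def by blast
  have "x = cis (a + 2 * pi)" by (simp add: abc cis_mult[symmetric])
  then show ?thesis unfolding positively_oriented_def
    using abc by (intro exI[of _ b] exI[of _ c] exI[of _ "a + 2 * pi"]) auto
qed

text \<open>The counterclockwise angle from \<open>x\<close>, in the interval from 0 up to but
  excluding \<open>2 * pi\<close>. Cutting the circle at \<open>x\<close> in this way turns the
  axioms of the cyclic order into linear inequalities.\<close>

definition angle_from :: "complex \<Rightarrow> complex \<Rightarrow> real" where
  "angle_from x y = Arg2pi (y / x)"

lemma angle_from_cis: assumes "a \<le> b" "b < a + 2 * pi" shows "angle_from (cis a) (cis b) = b - a"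
proof -
  have "cis b / cis a = of_real 1 * exp (\<i> * of_real (b - a))"
    unfolding cis_divide by (simp add: cis_conv_exp)
  then show ?thesis unfolding angle_from_def using assms by (intro Arg2pi_unique[of 1]) auto
qed

lemma positively_oriented_angle_from:
  assumes "x \<in> sphere 0 1" "y \<in> sphere 0 1" "z \<in> sphere 0 1"
  shows "positively_oriented x y z \<longleftrightarrow> 0 < angle_from x y \<and> angle_from x y < angle_from x z"
proof
  assume "positively_oriented x y z"
  then show "0 < angle_from x y \<and> angle_from x y < angle_from x z"
    unfolding positively_oriented_def by (auto simp: angle_from_cis)
next
  assume *: "0 < angle_from x y \<and> angle_from x y < angle_from x z"
  obtain a where a: "x = cis a" using sphere_cis[OF assms(1), of 0] by blast
  obtain b where b: "a \<le> b" "b < a + 2 * pi" "y = cis b" using sphere_cis[OF assms(2)] by blast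
  obtain c where c: "a \<le> c" "c < a + 2 * pi" "z = cis c" using sphere_cis[OF assms(3)] by blast
  from * a b c show "positively_oriented x y z"
    unfolding positively_oriented_def by (intro exI[of _ a] exI[of _ b] exI[of _ c]) (auto simp: angle_from_cis)
qed

lemma angle_from_inject:
  assumes "x \<in> sphere 0 1" "y \<in> sphere 0 1" "z \<in> sphere 0 1" "angle_from x y = angle_from x z" shows "y = z"
proof -
  obtain a where a: "x = cis a" using sphere_cis[OF assms(1), of 0] by blast
  obtain b where b: "a \<le> b" "b < a + 2 * pi" "y = cis b" using sphere_cis[OF assms(2)] by blast
  obtain c where c: "a \<le> c" "c < a + 2 * pi" "z = cis c" using sphere_cis[OF assms(3)] by blast
  from assms(4) a b c show ?thesis by (simp add: angle_from_cis)
qed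

lemma angle_from_pos:
  assumes "x \<in> sphere 0 1" "y \<in> sphere 0 1" "x \<noteq> y" shows "0 < angle_from x y"
proof -
  obtain a where a: "x = cis a" using sphere_cis[OF assms(1), of 0] by blast
  obtain b where b: "a \<le> b" "b < a + 2 * pi" "y = cis b" using sphere_cis[OF assms(2)] by blast
  from assms(3) a b show ?thesis by (cases "a = b") (auto simp: angle_from_cis)
qed

lemma positively_oriented_trans:
  assumes "positively_oriented a b c" "positively_oriented a c d"
  shows "positively_oriented a b d"
proof -
  note 1 = positively_oriented_sphere[OF assms(1)] positively_oriented_sphere[OF assms(2)]
  from assms 1 show ?thesis by (simp add: positively_oriented_angle_from)
qed

lemma positively_oriented_asym:
  assumes "positively_oriented a b c" shows "\<not> positively_oriented a c b"
  using assms positively_oriented_sphere[OF assms] by (simp add: positively_oriented_angle_from)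

lemma positively_oriented_total:
  assumes "x \<in> sphere 0 1" "y \<in> sphere 0 1" "z \<in> sphere 0 1" "x \<noteq> y" "y \<noteq> z" "x \<noteq> z"
  shows "positively_oriented x y z \<or> positively_oriented x z y"
proof -
  have "angle_from x y \<noteq> angle_from x z" "0 < angle_from x y" "0 < angle_from x z"
    using angle_from_inject[OF assms(1-3)] angle_from_pos[of x y] angle_from_pos[of x z] assms by blast+
  then show ?thesis using assms(1-3) by (simp add: positively_oriented_angle_from) linarith
qed

lemma positively_oriented_distinct:
  "positively_oriented x y z \<Longrightarrow> x \<noteq> y \<and> y \<noteq> z \<and> x \<noteq> z"
  using positively_oriented_asym[of x x z] positively_oriented_asym[of x y y] positively_oriented_asym[of x y x]
    positively_oriented_rotate[of x y x] positively_oriented_asym[of y x x] positively_oriented_rotate[of x x z]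
    positively_oriented_rotate[of x z x] by auto

section \<open>Normal form of the hyperbolization\<close>

text \<open>The lift is \<open>v - w * cnj v\<close> followed by a rotation by \<open>t / 2\<close>.
  It scales areas by \<open>1 - (cmod w)\<^sup>2\<close>, which is positive inside the disc.\<close>

lemma Moebius_function_circ:
  assumes "cmod w < 1"
  obtains F k where "linear F" "k > 0" "\<And>u v. wedge (F u) (F v) = k * wedge u v"
    "\<And>v. v \<noteq> 0 \<Longrightarrow> F v \<noteq> 0" "\<And>v. v \<noteq> 0 \<Longrightarrow> Moebius_function t w (circ v) = circ (F v)"
proof
  define F where "F v = cis (t / 2) * (v - w * cnj v)" for v
  show "linear F"
    by (rule linearI) (simp_all add: F_def algebra_simps scaleR_conv_of_real)
  show "1 - (cmod w)\<^sup>2 > 0" using assms by (simp add: abs_square_less_1)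
  have "wedge (cis a * x) (cis a * y) = wedge x y" for a x y
  proof -
    have "cnj (cis a * x) * (cis a * y) = (cnj (cis a) * cis a) * (cnj x * y)" by (simp add: mult_ac)
    also have "cnj (cis a) * cis a = 1" by (simp add: cis_cnj cis_mult)
    finally show ?thesis by (simp only: wedge_def mult_1)
  qed
  moreover have "wedge (u - w * cnj u) (v - w * cnj v) = (1 - (cmod w)\<^sup>2) * wedge u v" for u v
    by (simp add: wedge_eq cmod_power2) (simp add: algebra_simps power2_eq_square)
  ultimately show "wedge (F u) (F v) = (1 - (cmod w)\<^sup>2) * wedge u v" for u v
    by (simp add: F_def)
  fix v :: complex assume v: "v \<noteq> 0"
  have ne: "v - w * cnj v \<noteq> 0"
  proof
    assume "v - w * cnj v = 0"
    then have "cmod v = cmod w * cmod v" by (metis complex_mod_cnj eq_iff_diff_eq_0 norm_mult)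
    then show False using v assms by simp
  qed
  then show "F v \<noteq> 0" by (simp add: F_def)
  have ne': "cnj v - cnj w * v \<noteq> 0"
    using ne by (metis complex_cnj_cnj complex_cnj_diff complex_cnj_mult complex_cnj_zero)
  have "circ (F v) = cis (t / 2) / cnj (cis (t / 2)) * ((v - w * cnj v) / (cnj v - cnj w * v))"
    by (simp add: circ_def F_def)
  also have "cis (t / 2) / cnj (cis (t / 2)) = exp (\<i> * of_real t)"
    using circ_cis[of t] by (simp add: circ_def cis_conv_exp)
  also have "(v - w * cnj v) / (cnj v - cnj w * v) = (circ v - w) / (1 - cnj w * circ v)"
    using v ne' by (simp add: circ_def divide_simps)
  finally show "Moebius_function t w (circ v) = circ (F v)"
    by (simp add: Moebius_function_def)
qed

text \<open>The fixed point gives an eigenvector \<open>p\<close>, so \<open>F\<close> is triangular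
  in a basis \<open>p\<close>, \<open>q\<close>. Since all other points move the same way, an affine
  function of \<open>s\<close> has no zero; this forces equal eigenvalues and leaves a shear. The
  direction of motion fixes the sign of the shear.\<close>

lemma boundary_parabolic_transvection:
  assumes F: "linear F" "\<And>u v. wedge (F u) (F v) = k * wedge u v" "k > 0"
    "\<And>v. v \<noteq> 0 \<Longrightarrow> F v \<noteq> 0" "\<And>v. v \<noteq> 0 \<Longrightarrow> f (circ v) = circ (F v)"
    and "boundary_parabolic f"
  obtains p where "p \<noteq> 0" "\<And>v. v \<noteq> 0 \<Longrightarrow> f (circ v) = circ (v - wedge p v *\<^sub>R p)"
proof -
  obtain z where z: "z \<in> sphere 0 1" "f z = z" "\<And>x. x \<in> sphere 0 1 - {z} \<Longrightarrow> positively_oriented z x (f x)"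
    using assms(6) unfolding boundary_parabolic_def by blast
  obtain p where p: "p \<noteq> 0" "z = circ p" using circ_surj[OF z(1)] .
  have "wedge p (F p) = 0" using z(2) p F(4,5) circ_eq_iff[of p "F p"] by simp
  then obtain l where l: "F p = l *\<^sub>R p" using wedge_zero_parallel p(1) by blast
  then have l0: "l \<noteq> 0" using F(4)[OF p(1)] by auto
  define q where "q = (1 / (cmod p)\<^sup>2) *\<^sub>R (- \<i> * p)"
  have "wedge p (- \<i> * p) = - (cmod p)\<^sup>2"
    unfolding cmod_power2 by (simp add: wedge_eq power2_eq_square)
  then have pq: "wedge p q = -1" using p(1) by (simp add: q_def)
  then have qp: "wedge q p = 1" by (simp add: wedge_swap[of q p])
  define m n where "m = - wedge (F q) q" and "n = - wedge p (F q)"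
  have Fq: "F q = m *\<^sub>R p + n *\<^sub>R q"
    using wedge_decompose[of p q "F q"] by (simp add: pq m_def n_def) (metis add_uminus_conv_diff minus_add_distrib minus_minus)
  have Fadd: "F (s *\<^sub>R p + y *\<^sub>R q) = (s * l + y * m) *\<^sub>R p + (y * n) *\<^sub>R q" for s y
    by (simp add: linear_add[OF F(1)] linear_cmul[OF F(1)] l Fq scaleR_add_right scaleR_add_left)
  \<comment> \<open>Every line other than that of \<open>p\<close> is spanned by exactly one vector
    \<open>s *\<^sub>R p + q\<close>.\<close>
  have pos: "n * (s * (l - n) + m) > 0" for s
  proof -
    let ?x = "s *\<^sub>R p + 1 *\<^sub>R q"
    have px: "wedge p ?x = -1" by (simp add: pq)
    have "?x \<noteq> 0"
    proof
      assume "?x = 0"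
      then have "-1 = wedge p 0" using px by (simp only:)
      then show False by simp
    qed
    then have "circ p \<noteq> circ ?x" using px p(1) by (simp add: circ_eq_iff)
    then have "positively_oriented (circ p) (circ ?x) (circ (F ?x))"
      using z(3)[of "circ ?x"] circ_sphere[OF \<open>?x \<noteq> 0\<close>] F(5)[OF \<open>?x \<noteq> 0\<close>] p(2) by simp
    then have "wedge p ?x * wedge ?x (F ?x) * wedge p (F ?x) > 0"
      using positively_oriented_circ[OF p(1) \<open>?x \<noteq> 0\<close> F(4)[OF \<open>?x \<noteq> 0\<close>]] by simp
    moreover have "wedge p (F ?x) = - n" unfolding Fadd by (simp add: pq)
    moreover have "wedge ?x (F ?x) = s * (l - n) + m" unfolding Fadd by (simp add: pq qp algebra_simps)
    ultimately have "-1 * (s * (l - n) + m) * (- n) > 0" by (simp only: px)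
    moreover have "-1 * (s * (l - n) + m) * (- n) = n * (s * (l - n) + m)" by (simp add: algebra_simps)
    ultimately show ?thesis by (simp only:)
  qed
  have ln: "l = n"
  proof (rule ccontr)
    assume "l \<noteq> n"
    then have "(- m / (l - n)) * (l - n) + m = 0" by simp
    then show False using pos[of "- m / (l - n)"] by (simp only:)
  qed
  have c: "m / l > 0" using pos[of 0] ln l0 by (simp add: zero_less_mult_iff zero_less_divide_iff) blast
  \<comment> \<open>The shear coefficient \<open>m / l\<close> is positive, so its square root can
    be absorbed into \<open>p\<close>.\<close>
  define p' where "p' = sqrt (m / l) *\<^sub>R p"
  show ?thesis
  proof
    have "m \<noteq> 0" using c by auto
    then show "p' \<noteq> 0" using p(1) l0 by (simp add: p'_def)
    fix v :: complex assume v: "v \<noteq> 0"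
    have dec: "v = (- wedge v q) *\<^sub>R p + (- wedge p v) *\<^sub>R q"
      using wedge_decompose[of p q v] by (simp add: pq) (metis add_uminus_conv_diff minus_add_distrib minus_minus)
    have "F v = l *\<^sub>R (v - (m / l * wedge p v) *\<^sub>R p)"
    proof -
      have "F v = ((- wedge v q) * l + (- wedge p v) * m) *\<^sub>R p + ((- wedge p v) * n) *\<^sub>R q"
        by (subst dec) (rule Fadd)
      also have "\<dots> = l *\<^sub>R (((- wedge v q) *\<^sub>R p + (- wedge p v) *\<^sub>R q) - (m / l * wedge p v) *\<^sub>R p)"
        using l0 ln by (simp add: scaleR_add_right scaleR_diff_right scaleR_add_left scaleR_diff_left mult_ac)
      finally show ?thesis using dec by simp
    qed
    moreover have "wedge p' v *\<^sub>R p' = (sqrt (m / l) * sqrt (m / l) * wedge p v) *\<^sub>R p"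
      by (simp add: p'_def mult_ac)
    then have "(m / l * wedge p v) *\<^sub>R p = wedge p' v *\<^sub>R p'"
      using c real_sqrt_mult_self[of "m / l"] by (simp only: abs_of_pos)
    ultimately show "f (circ v) = circ (v - wedge p' v *\<^sub>R p')"
      using F(5)[OF v] l0 by (simp add: circ_scaleR)
  qed
qed

definition transvection :: "complex \<Rightarrow> complex \<Rightarrow> complex" where
  "transvection p v = v - wedge p v *\<^sub>R p"

lemma Moebius_boundary_parabolic:
  assumes w: "cmod w < 1" "\<And>z. z \<in> cball 0 1 \<Longrightarrow> f z = Moebius_function t w z"
    and f: "boundary_parabolic f"
  shows "\<exists>p. p \<noteq> 0 \<and> (\<forall>v. v \<noteq> 0 \<longrightarrow> f (circ v) = circ (transvection p v))"
proof (rule Moebius_function_circ[OF w(1), where t = t])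
  fix F :: "complex \<Rightarrow> complex" and k
  assume F: "linear F" "k > 0" "\<And>u v. wedge (F u) (F v) = k * wedge u v"
      "\<And>v. v \<noteq> 0 \<Longrightarrow> F v \<noteq> 0" "\<And>v. v \<noteq> 0 \<Longrightarrow> Moebius_function t w (circ v) = circ (F v)"
  have fF: "f (circ v) = circ (F v)" if "v \<noteq> 0" for v
  proof -
    have "circ v \<in> cball 0 1" using circ_sphere[OF that] by auto
    then show ?thesis using w(2) F(5)[OF that] by simp
  qed
  obtain p where "p \<noteq> 0" "\<And>v. v \<noteq> 0 \<Longrightarrow> f (circ v) = circ (v - wedge p v *\<^sub>R p)"
    using boundary_parabolic_transvection[OF F(1,3,2,4) fF f] by blast
  then show ?thesis by (intro exI[of _ p]) (simp add: transvection_def)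
qed

lemma wedge_transvection: "wedge (transvection p u) (transvection p v) = wedge u v"
  by (simp add: transvection_def wedge_swap[of u p])

lemma transvection_inverse: "transvection p (v + wedge p v *\<^sub>R p) = v"
  by (simp add: transvection_def)

lemma transvection_eq_0_iff [simp]: "transvection p v = 0 \<longleftrightarrow> v = 0"
proof
  assume "transvection p v = 0"
  then have "wedge p (transvection p v) = 0" by simp
  then have "wedge p v = 0" by (simp add: transvection_def)
  with \<open>transvection p v = 0\<close> show "v = 0" by (simp add: transvection_def)
qed (simp add: transvection_def)

text \<open>Every vector is an eigenvector of a map of the circle that is trivial, so the quadratic form
  \<open>u \<mapsto> wedge (T\<^sub>r\<^sup>-\<^sup>1 u) (T\<^sub>p T\<^sub>q u)\<close> vanishes identically.\<close>

lemma wedge_of_parabolic_triple: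
  assumes "p \<noteq> 0" "q \<noteq> 0" "r \<noteq> 0"
    and triv: "\<And>u. wedge (u + wedge r u *\<^sub>R r) (transvection p (transvection q u)) = 0"
  shows "(wedge p q)\<^sup>2 = 4"
proof -
  let ?w = "wedge p q"
  have qp: "wedge q p = - ?w" by (rule wedge_swap)
  show ?thesis
  proof (cases "?w = 0")
    \<comment> \<open>If \<open>p\<close> and \<open>q\<close> are parallel, so is \<open>r\<close>.
      Three shears along one line with coefficients of the same sign cannot compose to the
      identity.\<close>
    case True
    then obtain e where e: "q = e *\<^sub>R p" using wedge_zero_parallel assms(1) by blast
    have "wedge r p * wedge r p = 0"
      using triv[of p] by (simp add: e transvection_def)
    then have "wedge r p = 0" by simp
    then have "wedge p r = 0" using wedge_swap[of p r] by simp
    then obtain d where d: "r = d *\<^sub>R p" using wedge_zero_parallel assms(1) by blast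
    define u where "u = \<i> * p"
    have "wedge p u = (cmod p)\<^sup>2" unfolding cmod_power2 by (simp add: u_def wedge_eq power2_eq_square)
    then have a: "wedge p u > 0" using assms(1) by simp
    have "(1 + e\<^sup>2 + d\<^sup>2) * (wedge p u)\<^sup>2 = 0"
      using triv[of u] by (simp add: e d transvection_def wedge_swap[of u p] power2_eq_square algebra_simps)
    moreover have "1 + e\<^sup>2 + d\<^sup>2 > 0" by (simp add: add_pos_nonneg)
    ultimately show ?thesis using a by simp
  next
    case False
    \<comment> \<open>Coordinates of \<open>r\<close> in the basis \<open>p\<close>,
      \<open>q\<close> by Cramer's rule. The equations \<open>E1\<close>, \<open>E2\<close>,
      \<open>E3\<close> below are the vanishing of the quadratic form at \<open>p\<close>, at
      \<open>q\<close>, and of its polarisation at the two.\<close>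
    define x y where "x = wedge r q / ?w" and "y = wedge p r / ?w"
    have rp: "wedge r p = - y * ?w" and rq: "wedge r q = x * ?w"
      using False by (simp_all add: x_def y_def wedge_swap[of r p])
    have "?w *\<^sub>R r = ?w *\<^sub>R (x *\<^sub>R p + y *\<^sub>R q)"
      using wedge_decompose[of p q r] False by (simp add: x_def y_def scaleR_add_right)
    then have r: "r = x *\<^sub>R p + y *\<^sub>R q" using False by simp
    have tp: "transvection p (transvection q p) = (1 - ?w\<^sup>2) *\<^sub>R p + ?w *\<^sub>R q"
      by (simp add: transvection_def qp scaleR_diff_left power2_eq_square algebra_simps)
    have tq: "transvection p (transvection q q) = q - ?w *\<^sub>R p" by (simp add: transvection_def)
    have tpq: "transvection p (transvection q (p + q)) = transvection p (transvection q p) + transvection p (transvection q q)"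
      by (simp add: transvection_def scaleR_add_left scaleR_diff_left scaleR_add_right algebra_simps)
    have rp': "p + wedge r p *\<^sub>R r = (1 - x * y * ?w) *\<^sub>R p - (y\<^sup>2 * ?w) *\<^sub>R q"
      unfolding rp by (subst r) (simp add: algebra_simps power2_eq_square)
    have rq': "q + wedge r q *\<^sub>R r = (x\<^sup>2 * ?w) *\<^sub>R p + (1 + x * y * ?w) *\<^sub>R q"
      unfolding rq by (subst r) (simp add: algebra_simps power2_eq_square)
    have rpq': "p + q + wedge r (p + q) *\<^sub>R r = (p + wedge r p *\<^sub>R r) + (q + wedge r q *\<^sub>R r)"
      by (simp add: algebra_simps)
    have "wedge ((1 - x * y * ?w) *\<^sub>R p - (y\<^sup>2 * ?w) *\<^sub>R q) ((1 - ?w\<^sup>2) *\<^sub>R p + ?w *\<^sub>R q) = 0"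
      using triv[of p] unfolding tp rp' .
    then have "?w * ?w * ((1 - x * y * ?w) + y\<^sup>2 * (1 - ?w\<^sup>2)) = 0"
      by (simp add: qp algebra_simps power2_eq_square)
    then have E1: "(1 - x * y * ?w) + y\<^sup>2 * (1 - ?w\<^sup>2) = 0" using False by simp
    have "wedge ((x\<^sup>2 * ?w) *\<^sub>R p + (1 + x * y * ?w) *\<^sub>R q) (q - ?w *\<^sub>R p) = 0"
      using triv[of q] unfolding tq rq' .
    then have "?w * ?w * (x\<^sup>2 + 1 + x * y * ?w) = 0"
      by (simp add: qp algebra_simps power2_eq_square)
    then have E2: "x\<^sup>2 + 1 + x * y * ?w = 0" using False by simp
    have "wedge (((1 - x * y * ?w) *\<^sub>R p - (y\<^sup>2 * ?w) *\<^sub>R q) + ((x\<^sup>2 * ?w) *\<^sub>R p + (1 + x * y * ?w) *\<^sub>R q))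
        (((1 - ?w\<^sup>2) *\<^sub>R p + ?w *\<^sub>R q) + (q - ?w *\<^sub>R p)) = 0"
      using triv[of "p + q"] unfolding tpq rpq' tp tq rp' rq' .
    moreover have "wedge ((1 - x * y * ?w) *\<^sub>R p - (y\<^sup>2 * ?w) *\<^sub>R q) ((1 - ?w\<^sup>2) *\<^sub>R p + ?w *\<^sub>R q) = 0"
      using triv[of p] unfolding tp rp' .
    moreover have "wedge ((x\<^sup>2 * ?w) *\<^sub>R p + (1 + x * y * ?w) *\<^sub>R q) (q - ?w *\<^sub>R p) = 0"
      using triv[of q] unfolding tq rq' .
    ultimately have "wedge ((1 - x * y * ?w) *\<^sub>R p - (y\<^sup>2 * ?w) *\<^sub>R q) (q - ?w *\<^sub>R p)
        + wedge ((x\<^sup>2 * ?w) *\<^sub>R p + (1 + x * y * ?w) *\<^sub>R q) ((1 - ?w\<^sup>2) *\<^sub>R p + ?w *\<^sub>R q) = 0"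
      by (simp only: wedge_linear(1,2))
    then have "?w * ((1 - x * y * ?w) - y\<^sup>2 * ?w\<^sup>2 + x\<^sup>2 * ?w\<^sup>2 - (1 - ?w\<^sup>2) * (1 + x * y * ?w)) = 0"
      by (simp add: qp algebra_simps power2_eq_square)
    then have E3: "(1 - x * y * ?w) - y\<^sup>2 * ?w\<^sup>2 + x\<^sup>2 * ?w\<^sup>2 - (1 - ?w\<^sup>2) * (1 + x * y * ?w) = 0"
      using False by simp
    \<comment> \<open>Eliminating \<open>x * y * ?w\<close> gives two values of
      \<open>y\<^sup>2 * ?w\<^sup>2\<close>, whence \<open>y\<^sup>2 = x\<^sup>2\<close>. Squaring
      the expression for \<open>x * y * ?w\<close> then yields \<open>x\<^sup>2 = 1\<close>.\<close>
    have xyw: "x * y * ?w = - (1 + x\<^sup>2)" using E2 by simp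
    have 1: "y\<^sup>2 * ?w\<^sup>2 = 2 + x\<^sup>2 + y\<^sup>2" using E1 unfolding xyw by (simp add: algebra_simps)
    have 2: "y\<^sup>2 * ?w\<^sup>2 = 2 + 2 * x\<^sup>2" using E3 unfolding xyw by (simp add: algebra_simps)
    have yx: "y\<^sup>2 = x\<^sup>2" using 1 2 by simp
    have "x\<^sup>2 * (y\<^sup>2 * ?w\<^sup>2) = (1 + x\<^sup>2)\<^sup>2"
    proof -
      have "x\<^sup>2 * (y\<^sup>2 * ?w\<^sup>2) = (x * y * ?w)\<^sup>2" by (simp add: power_mult_distrib)
      then show ?thesis unfolding xyw by (simp only: power2_minus)
    qed
    then have "(x\<^sup>2 + 1) * (x\<^sup>2 - 1) = 0" unfolding 2 by (simp add: algebra_simps power2_eq_square)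
    moreover have "x\<^sup>2 + 1 > 0" by (simp add: add_nonneg_pos)
    ultimately have "x\<^sup>2 = 1" by simp
    with yx 2 show ?thesis by simp
  qed
qed

lemma carrier_Gamma03_gen: "\<alpha> \<in> carrier Gamma03" "\<beta> \<in> carrier Gamma03"
  by (simp_all add: \<alpha>_def \<beta>_def gen_def Gamma03_def presented_group_def)

lemma group_Gamma03: "group Gamma03"
  by (simp add: Gamma03_def group_presented_group)

text \<open>The three boundary elements give transvection vectors \<open>p\<close>,
  \<open>q\<close>, \<open>r\<close>, and \<open>T\<^sub>p T\<^sub>q\<close> inverts
  \<open>T\<^sub>r\<close> on the circle. Only the sign of \<open>wedge p q\<close> is left open; a
  transvection does not change when its vector is negated, so -2 can be arranged. With this sign
  \<open>q\<close>, \<open>p + q\<close>, \<open>p\<close> are positively oriented.\<close>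

lemma hyperbolization_normal_form:
  assumes h: "finite_area_hyperbolization h"
  obtains p q where "wedge p q = - 2" "\<And>v. v \<noteq> 0 \<Longrightarrow> h \<alpha> (circ v) = circ (transvection p v)"
    "\<And>v. v \<noteq> 0 \<Longrightarrow> h \<beta> (circ v) = circ (transvection q v)"
proof -
  interpret group Gamma03 by (rule group_Gamma03)
  interpret group_action Gamma03 "cball 0 1" h
    using h unfolding finite_area_hyperbolization_def by (rule conjunct1)
  let ?\<gamma> = "inv\<^bsub>Gamma03\<^esub> (\<alpha> \<otimes>\<^bsub>Gamma03\<^esub> \<beta>)"
  note gens = carrier_Gamma03_gen
  have \<gamma>: "?\<gamma> \<in> carrier Gamma03" using gens by simp
  have par: "boundary_parabolic (h \<alpha>)" "boundary_parabolic (h \<beta>)" "boundary_parabolic (h ?\<gamma>)"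
    using h unfolding finite_area_hyperbolization_def by - (elim conjE, assumption)+
  have mob: "\<forall>g\<in>carrier Gamma03. \<exists>t w. cmod w < 1 \<and> (\<forall>z\<in>cball 0 1. h g z = Moebius_function t w z)"
    using h unfolding finite_area_hyperbolization_def by - (elim conjE, assumption)
  have nf: "\<exists>p. p \<noteq> 0 \<and> (\<forall>v. v \<noteq> 0 \<longrightarrow> h g (circ v) = circ (transvection p v))"
    if g: "g \<in> carrier Gamma03" "boundary_parabolic (h g)" for g
  proof -
    obtain t w where w: "cmod w < 1" "\<And>z. z \<in> cball 0 1 \<Longrightarrow> h g z = Moebius_function t w z"
      using bspec[OF mob g(1)] by blast
    then show ?thesis using Moebius_boundary_parabolic[of w "h g" t] g(2) by blast
  qed
  obtain p where p: "p \<noteq> 0" "\<And>v. v \<noteq> 0 \<Longrightarrow> h \<alpha> (circ v) = circ (transvection p v)" using nf[OF gens(1) par(1)] by metis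
  obtain q where q: "q \<noteq> 0" "\<And>v. v \<noteq> 0 \<Longrightarrow> h \<beta> (circ v) = circ (transvection q v)" using nf[OF gens(2) par(2)] by metis
  obtain r where r: "r \<noteq> 0" "\<And>v. v \<noteq> 0 \<Longrightarrow> h ?\<gamma> (circ v) = circ (transvection r v)" using nf[OF \<gamma> par(3)] by metis
  have "wedge (u + wedge r u *\<^sub>R r) (transvection p (transvection q u)) = 0" for u
  proof (cases "u = 0")
    case False
    let ?v = "u + wedge r u *\<^sub>R r"
    have "transvection r ?v \<noteq> 0" using False by (simp only: transvection_inverse not_False_eq_True)
    then have v0: "?v \<noteq> 0" by (simp only: transvection_eq_0_iff not_False_eq_True)
    have cb: "circ v \<in> cball 0 1" if "v \<noteq> 0" for v using circ_sphere[OF that] by auto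
    have "h (\<alpha> \<otimes>\<^bsub>Gamma03\<^esub> \<beta>) (h ?\<gamma> (circ ?v)) = circ ?v"
      using orbit_sym_aux[OF \<gamma> cb[OF v0] HOL.refl] gens by simp
    moreover have "h ?\<gamma> (circ ?v) = circ u" using r(2)[OF v0] by (simp add: transvection_inverse)
    moreover have "h (\<alpha> \<otimes>\<^bsub>Gamma03\<^esub> \<beta>) (circ u) = circ (transvection p (transvection q u))"
      using composition_rule[OF cb[OF False] gens] p(2) q(2) False by simp
    ultimately have "circ ?v = circ (transvection p (transvection q u))" by simp
    then show ?thesis using v0 False by (simp add: circ_eq_iff)
  qed simp
  then have "(wedge p q)\<^sup>2 = 4" using wedge_of_parabolic_triple p(1) q(1) r(1) by blast
  then have "(wedge p q)\<^sup>2 = 2\<^sup>2" by simp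
  then have "wedge p q = 2 \<or> wedge p q = - 2" unfolding power2_eq_iff .
  then show ?thesis
  proof
    assume "wedge p q = - 2" then show ?thesis using that p(2) q(2) by blast
  next
    assume "wedge p q = 2"
    then have "wedge p (- q) = - 2" by simp
    moreover have "transvection (- q) = transvection q" by (rule ext) (simp add: transvection_def)
    ultimately show ?thesis using that[of p "- q"] p(2) q(2) by simp
  qed
qed

section \<open>Cyclic orders and reflections of a triangle\<close>

locale partial_cyclic_order =
  fixes R :: "'p \<Rightarrow> 'p \<Rightarrow> 'p \<Rightarrow> bool"
  assumes rotate: "R a b c \<Longrightarrow> R b c a"
    and trans: "R a b c \<Longrightarrow> R a c d \<Longrightarrow> R a b d"
begin

lemma trans': "R a b c \<Longrightarrow> R a c d \<Longrightarrow> R b c d"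
proof -
  assume "R a b c" "R a c d"
  then have "R c d a" "R c a b" using rotate by blast+
  then have "R c d b" by (rule trans)
  then show "R b c d" using rotate by blast
qed

text \<open>Cutting the cyclic order open at \<open>u\<close> leaves the transitive relation
  \<open>R u\<close>; the set is required to be linearly ordered by it.\<close>

definition comparable :: "'p \<Rightarrow> 'p set \<Rightarrow> bool" where
  "comparable u S \<longleftrightarrow> (\<forall>x\<in>S. \<forall>y\<in>S. x = y \<or> R u x y \<or> R u y x)"

definition chain :: "'p \<Rightarrow> 'p \<Rightarrow> 'p set \<Rightarrow> bool" where
  "chain u v S \<longleftrightarrow> (\<forall>x\<in>S. R u x v) \<and> comparable u S"

lemma comparable_insert_Un:
  assumes S: "chain u m S" and T: "comparable m T" "\<And>x. x \<in> T \<Longrightarrow> R u m x"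
  shows "comparable u (insert m (S \<union> T))"
proof -
  have 1: "R u x m" if "x \<in> S" for x using S that by (simp add: chain_def)
  have 2: "R u x y" if "x \<in> S" "y \<in> T" for x y using 1[OF that(1)] T(2)[OF that(2)] trans by blast
  have 3: "R u x y" if "x \<in> T" "y \<in> T" "R m x y" for x y
    using rotate[OF rotate[OF trans'[OF that(3) rotate[OF T(2)[OF that(2)]]]]] .
  show ?thesis
    unfolding comparable_def
  proof (intro ballI)
    fix x y assume "x \<in> insert m (S \<union> T)" "y \<in> insert m (S \<union> T)"
    moreover have "x = y \<or> R u x y \<or> R u y x" if "x \<in> S" "y \<in> S"
      using S that by (simp add: chain_def comparable_def)
    moreover have "x = y \<or> R u x y \<or> R u y x" if "x \<in> T" "y \<in> T"
      using T(1) that 3 unfolding comparable_def by metis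
    ultimately show "x = y \<or> R u x y \<or> R u y x" using 1 2 T(2) by (elim insertE UnE) simp_all
  qed
qed

lemma chain_concat:
  assumes "chain u m S" "chain m v T" "R u m v"
  shows "chain u v (insert m (S \<union> T))"
proof -
  have "R u m x" "R u x v" if "x \<in> T" for x
  proof -
    have "R m x v" using assms(2) that by (simp add: chain_def)
    moreover have "R m v u" using assms(3) by (rule rotate)
    ultimately have "R m x u" "R x v u" using trans trans' by blast+
    then show "R u m x" "R u x v" by (auto intro: rotate[of x u m] rotate[of m x u] rotate[of v u x] rotate[of x v u])
  qed
  moreover have "R u x v" if "x \<in> S" for x
    using assms(1,3) that trans unfolding chain_def by blast
  ultimately show ?thesis
    using assms comparable_insert_Un[OF assms(1), of T] unfolding chain_def by blast
qed

text \<open>The closing case of \<open>chain_concat\<close>: the second interval runs back to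
  \<open>u\<close>.\<close>

lemma comparable_loop:
  assumes "chain u m S" "chain m u T"
  shows "comparable u (insert m (S \<union> T))"
proof (rule comparable_insert_Un[OF assms(1)])
  show "comparable m T" using assms(2) by (simp add: chain_def)
  fix x assume "x \<in> T"
  then have "R m x u" using assms(2) by (simp add: chain_def)
  then show "R u m x" by (intro rotate[of x] rotate[of m])
qed

text \<open>Reversing the orientation exchanges the end points of the interval.\<close>

lemma chain_image:
  assumes "\<And>a b c. R a b c \<Longrightarrow> R (f c) (f b) (f a)" "chain u v S"
  shows "chain (f v) (f u) (f ` S)"
proof -
  have "R (f v) (f y) (f x)" if "R u x y" "y \<in> S" for x y
  proof -
    have "R u y v" using assms(2) that(2) by (simp add: chain_def)
    with that(1) have "R x y v" using trans' by blast
    then show ?thesis by (rule assms(1))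
  qed
  then show ?thesis
    using assms unfolding chain_def comparable_def by fast
qed

text \<open>Comparability seen from a single base point reaches arbitrary triples through
  \<open>trans'\<close> and rotation.\<close>

lemma comparable_total:
  assumes "comparable u S" "x \<in> insert u S" "y \<in> insert u S" "z \<in> insert u S" "x \<noteq> y" "y \<noteq> z" "x \<noteq> z"
  shows "R x y z \<or> R x z y"
proof -
  have cmp: "R u a b \<or> R u b a" if "a \<in> S" "b \<in> S" "a \<noteq> b" for a b
    using assms(1) that unfolding comparable_def by blast
  show ?thesis
  proof (cases "u \<in> {x, y, z}")
    case True
    then consider "x = u" | "y = u" | "z = u" by blast
    then show ?thesis
    proof cases
      case 1
      then show ?thesis using cmp[of y z] assms(2-) by auto
    next
      case 2
      then have "R u x z \<or> R u z x" using cmp[of x z] assms(2-) by auto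
      then show ?thesis using rotate[of u x z] rotate[of u z x] rotate[of z x u] 2 by blast
    next
      case 3
      then have "R u x y \<or> R u y x" using cmp[of x y] assms(2-) by auto
      then show ?thesis using rotate[of u x y] rotate[of u y x] rotate[of y x u] 3 by blast
    qed
  next
    case False
    then have "R u x y \<or> R u y x" "R u y z \<or> R u z y" "R u x z \<or> R u z x"
      using cmp assms(2-) by auto
    then show ?thesis
      using trans'[of u x y z] trans'[of u x z y] trans'[of u y x z] trans'[of u y z x] trans'[of u z x y]
        trans'[of u z y x] rotate[of y z x] rotate[of z x y] rotate[of z y x] rotate[of y x z] by blast
  qed
qed

end

section \<open>Reflections of an ideal triangle and the vertices they generate\<close>

primrec next_side :: "W3_gen \<Rightarrow> W3_gen" where
  "next_side S1 = S2" | "next_side S2 = S3" | "next_side S3 = S1"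

lemma next_side_cube [simp]: "next_side (next_side (next_side i)) = i"
  by (cases i) simp_all

lemma next_side_neq [simp]: "next_side i \<noteq> i" "next_side (next_side i) \<noteq> i"
  by (cases i; simp)+

lemma W3_gen_cases: "j = i \<or> j = next_side i \<or> j = next_side (next_side i)"
  by (cases i; cases j) simp_all

text \<open>A triangle with vertices \<open>V e i\<close>, where \<open>V e i\<close> is opposite to the side \<open>i\<close> from
  \<open>V e (i + 1)\<close> to \<open>V e (i + 2)\<close>, and a reflection \<open>s i\<close> in every side.  The labels \<open>V True\<close> and
  \<open>V False\<close> of the vertices are exchanged by the reflections, whence the two colours.\<close>

locale reflection_triangle = partial_cyclic_order R for R :: "'p \<Rightarrow> 'p \<Rightarrow> 'p \<Rightarrow> bool" +
  fixes C :: "'p set" and s :: "W3_gen \<Rightarrow> 'p \<Rightarrow> 'p" and V :: "bool \<Rightarrow> W3_gen \<Rightarrow> 'p"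
  assumes V_C: "V e i \<in> C" and s_C: "x \<in> C \<Longrightarrow> s i x \<in> C"
    and s_s: "x \<in> C \<Longrightarrow> s i (s i x) = x"
    and s_R: "R a b c \<Longrightarrow> R (s i c) (s i b) (s i a)"
    and s_V: "j \<noteq> i \<Longrightarrow> s i (V e j) = V (\<not> e) j"
    and V_R: "R (V e S1) (V e S2) (V e S3)"
begin

text \<open>Vertices of colour \<open>e\<close> beyond side \<open>i\<close>, up to depth
  \<open>n\<close>. The reflection \<open>s i\<close> fills the gap with the mirror image of what
  lies on the near side, namely the opposite vertex and whatever is beyond the two other sides; it
  changes the colour, hence the negations.\<close>

primrec side :: "nat \<Rightarrow> bool \<Rightarrow> W3_gen \<Rightarrow> 'p set" where
  "side 0 e i = {}"
| "side (Suc n) e i = s i ` insert (V (\<not> e) i) (side n (\<not> e) (next_side i) \<union> side n (\<not> e) (next_side (next_side i)))"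

definition vertices :: "bool \<Rightarrow> 'p set" where
  "vertices e = range (V e) \<union> (\<Union>n i. side n e i)"

lemma V_R_next_side: "R (V e i) (V e (next_side i)) (V e (next_side (next_side i)))"
  using V_R[of e] rotate[OF V_R[of e]] rotate[OF rotate[OF V_R[of e]]] by (cases i) simp_all

text \<open>The two other gaps, joined at the vertex opposite to side \<open>i\<close>, form one
  chain. Its mirror image fills the gap at \<open>i\<close>: \<open>s i\<close> reverses the order
  and changes only the colour of the end points.\<close>

lemma chain_side: "chain (V e (next_side i)) (V e (next_side (next_side i))) (side n e i)"
proof (induction n arbitrary: e i)
  case 0
  show ?case by (simp add: chain_def comparable_def)
next
  case (Suc n)
  let ?e = "\<not> e"
  have 1: "chain (V ?e (next_side (next_side i))) (V ?e i) (side n ?e (next_side i))" using Suc[of ?e "next_side i"] by simp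
  have 2: "chain (V ?e i) (V ?e (next_side i)) (side n ?e (next_side (next_side i)))" using Suc[of ?e "next_side (next_side i)"] by simp
  have "R (V ?e (next_side (next_side i))) (V ?e i) (V ?e (next_side i))" using V_R_next_side[of ?e "next_side (next_side i)"] by simp
  from chain_image[of "s i", OF s_R chain_concat[OF 1 2 this]]
  show ?case by (simp add: s_V)
qed

lemma side_C: "side n e i \<subseteq> C"
  by (induction n arbitrary: e i) (auto intro: V_C s_C)

lemma vertices_C: "vertices e \<subseteq> C"
  using side_C V_C by (auto simp: vertices_def)

lemma side_mono: "side n e i \<subseteq> side (Suc n) e i"
proof (induction n arbitrary: e i)
  case (Suc n)
  show ?case
    unfolding side.simps(2)[of "Suc n" e i] side.simps(2)[of n e i]
    by (intro image_mono insert_mono Un_mono Suc)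
qed simp

lemma side_le: "m \<le> n \<Longrightarrow> side m e i \<subseteq> side n e i"
  by (rule lift_Suc_mono_le[of "\<lambda>n. side n e i"]) (rule side_mono)

lemma vertices_total:
  assumes "x \<in> vertices e" "y \<in> vertices e" "z \<in> vertices e" "x \<noteq> y" "y \<noteq> z" "x \<noteq> z"
  shows "R x y z \<or> R x z y"
proof -
  \<comment> \<open>The three corners and three gaps, nested in the shape produced by
    \<open>chain_concat\<close> followed by \<open>comparable_loop\<close>. The sets grow with
    \<open>n\<close>, so one depth contains all three points.\<close>
  let ?S = "\<lambda>n. insert (V e S1) (insert (V e S3) (insert (V e S2) (side n e S3 \<union> side n e S1) \<union> side n e S2))"
  have mono: "?S m \<subseteq> ?S n" if "m \<le> n" for m n
    using side_le[OF that, of e S1] side_le[OF that, of e S2] side_le[OF that, of e S3] by blast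
  have ex: "\<exists>n. x \<in> ?S n" if "x \<in> vertices e" for x
  proof -
    from that consider j where "x = V e j" | n j where "x \<in> side n e j" unfolding vertices_def by blast
    then show ?thesis
    proof cases
      case 1 then show ?thesis by (cases j) auto
    next
      case 2 then show ?thesis by (cases j) blast+
    qed
  qed
  obtain n1 where n1: "x \<in> ?S n1" using ex assms(1) by blast
  obtain n2 where n2: "y \<in> ?S n2" using ex assms(2) by blast
  obtain n3 where n3: "z \<in> ?S n3" using ex assms(3) by blast
  define n where "n = max n1 (max n2 n3)"
  have "x \<in> ?S n" using n1 mono[of n1 n] unfolding n_def by (rule subsetD[rotated]) simp
  moreover have "y \<in> ?S n" using n2 mono[of n2 n] unfolding n_def by (rule subsetD[rotated]) simp
  moreover have "z \<in> ?S n" using n3 mono[of n3 n] unfolding n_def by (rule subsetD[rotated]) simp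
  ultimately have n: "x \<in> ?S n" "y \<in> ?S n" "z \<in> ?S n" .
  have 1: "chain (V e S1) (V e S2) (side n e S3)" using chain_side[of e S3 n] by simp
  have 2: "chain (V e S2) (V e S3) (side n e S1)" using chain_side[of e S1 n] by simp
  have 3: "chain (V e S3) (V e S1) (side n e S2)" using chain_side[of e S2 n] by simp
  have "comparable (V e S1) (insert (V e S3) (insert (V e S2) (side n e S3 \<union> side n e S1) \<union> side n e S2))"
    by (rule comparable_loop[OF chain_concat[OF 1 2 V_R] 3])
  from comparable_total[OF this n assms(4-6)] show ?thesis .
qed

text \<open>For a vertex beyond side \<open>i\<close> itself, \<open>s i\<close> undoes the last
  reflection; every other vertex is a corner on side \<open>i\<close> or moves one level deeper
  beyond it.\<close>

lemma vertices_reflect: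
  assumes "x \<in> vertices e" shows "s i x \<in> vertices (\<not> e)"
proof -
  have sub: "side n e' j \<subseteq> vertices e'" and V: "V e' j \<in> vertices e'" for n e' j
    by (auto simp: vertices_def)
  from assms consider j where "x = V e j" | n j where "x \<in> side n e j" unfolding vertices_def by blast
  then show ?thesis
  proof cases
    case 1
    show ?thesis
    proof (cases "j = i")
      case True
      then have "s i x \<in> side (Suc 0) (\<not> e) i" using 1 by simp
      then show ?thesis using sub by blast
    next
      case False then show ?thesis using 1 V by (simp add: s_V)
    qed
  next
    case (2 n j)
    show ?thesis
    proof (cases "j = i")
      case True
      with 2 obtain m where "n = Suc m" by (cases n) auto
      with 2 True obtain y where y: "x = s i y"
        "y \<in> insert (V (\<not> e) i) (side m (\<not> e) (next_side i) \<union> side m (\<not> e) (next_side (next_side i)))" by auto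
      then have "y \<in> C" using side_C V_C by blast
      then have "s i x = y" using y(1) s_s by simp
      moreover have "y \<in> vertices (\<not> e)"
        using y(2) V[of "\<not> e" i] sub[of m "\<not> e"] by blast
      ultimately show ?thesis by simp
    next
      case False
      then have "j = next_side i \<or> j = next_side (next_side i)" using W3_gen_cases[of j i] by blast
      then have "s i x \<in> side (Suc n) (\<not> e) i" using 2 by auto
      then show ?thesis using sub by blast
    qed
  qed
qed

end

section \<open>Extension of monotone labellings\<close>

interpretation pos: partial_cyclic_order positively_oriented
  by unfold_locales (rule positively_oriented_rotate, assumption, rule positively_oriented_trans)

lemma positively_oriented_rotate_iff: "positively_oriented x y z \<longleftrightarrow> positively_oriented y z x"
  using positively_oriented_rotate[of x y z] positively_oriented_rotate[of y z x] positively_oriented_rotate[of z x y] by blast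

text \<open>Labelled points approaching \<open>x\<close> from its counterclockwise side. As the
  filter lives on pairs, the label is simply \<open>snd\<close>, and no function from points to
  labels has to be chosen.\<close>

definition arc_filter :: "(complex \<times> lag) set \<Rightarrow> complex \<Rightarrow> (complex \<times> lag) filter" where
  "arc_filter G x = (INF y\<in>sphere 0 1 - {x}. principal {p \<in> G. positively_oriented x (fst p) y})"

locale monotone_dense =
  fixes G :: "(complex \<times> lag) set"
  assumes G_sphere: "p \<in> G \<Longrightarrow> fst p \<in> sphere 0 1"
    and mono: "p \<in> G \<Longrightarrow> q \<in> G \<Longrightarrow> r \<in> G \<Longrightarrow> positively_oriented (fst p) (fst q) (fst r) \<Longrightarrow>
      maximal_triple (snd p) (snd q) (snd r)"
    and dense: "x \<in> sphere 0 1 \<Longrightarrow> y \<in> sphere 0 1 \<Longrightarrow> x \<noteq> y \<Longrightarrow> \<exists>p\<in>G. positively_oriented x (fst p) y"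
begin

lemma eventually_arc_filter:
  assumes x: "x \<in> sphere 0 1"
  shows "eventually P (arc_filter G x) \<longleftrightarrow>
    (\<exists>y\<in>sphere 0 1 - {x}. \<forall>p\<in>G. positively_oriented x (fst p) y \<longrightarrow> P p)"
proof -
  have "- x \<in> sphere 0 1 - {x}" using x by auto
  then have ne: "sphere 0 1 - {x} \<noteq> {}" by blast
  have dir: "\<exists>c\<in>sphere 0 1 - {x}. principal {p \<in> G. positively_oriented x (fst p) c} \<le>
      inf (principal {p \<in> G. positively_oriented x (fst p) a}) (principal {p \<in> G. positively_oriented x (fst p) b})"
    if ab: "a \<in> sphere 0 1 - {x}" "b \<in> sphere 0 1 - {x}" for a b
  proof -
    consider "a = b" | "positively_oriented x a b" | "positively_oriented x b a"
      using positively_oriented_total[of x a b] x ab by auto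
    then show ?thesis
    proof cases
      case 1 then show ?thesis using ab by auto
    next
      case 2
      then show ?thesis using ab(1) positively_oriented_trans[of x _ a b] by (intro bexI[of _ a]) auto
    next
      case 3
      then show ?thesis using ab(2) positively_oriented_trans[of x _ b a] by (intro bexI[of _ b]) auto
    qed
  qed
  show ?thesis
  proof -
    have "eventually P (arc_filter G x) \<longleftrightarrow>
        (\<exists>y\<in>sphere 0 1 - {x}. eventually P (principal {p \<in> G. positively_oriented x (fst p) y}))"
      unfolding arc_filter_def by (rule eventually_INF_base[OF ne]) (rule dir)
    then show ?thesis by (simp only: eventually_principal) blast
  qed
qed

lemma arc_filter_nontrivial: assumes "x \<in> sphere 0 1" shows "arc_filter G x \<noteq> bot"
proof
  assume "arc_filter G x = bot"
  then have "eventually (\<lambda>_. False) (arc_filter G x)" by simp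
  then show False unfolding eventually_arc_filter[OF assms] using dense[OF assms] by blast
qed

lemma eventually_arc:
  assumes "x \<in> sphere 0 1" "y \<in> sphere 0 1" "x \<noteq> y"
  shows "eventually (\<lambda>p. p \<in> G \<and> positively_oriented x (fst p) y) (arc_filter G x)"
  unfolding eventually_arc_filter[OF assms(1)] using assms(2,3) by blast

definition qval :: "real ^ (2 + 2) ^ (2 + 2) \<Rightarrow> real ^ 2 \<Rightarrow> complex \<times> lag \<Rightarrow> real" where
  "qval N v p = qform (lag_coord N (snd p)) v"

lemma chart_less:
  assumes N: "N \<in> Sp" "snd r = (*v) N ` infinity_lag" and r: "r \<in> G"
    and pq: "p \<in> G" "q \<in> G" "positively_oriented (fst r) (fst p) (fst q)"
  shows "pos_def (lag_coord N (snd q) - lag_coord N (snd p))"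
    and "transpose (lag_coord N (snd p)) = lag_coord N (snd p)" "snd p = (*v) N ` mat_lag (lag_coord N (snd p))"
    and "transpose (lag_coord N (snd q)) = lag_coord N (snd q)" "snd q = (*v) N ` mat_lag (lag_coord N (snd q))"
  using mono[OF r pq] unfolding N(2) maximal_triple_coord[OF N(1)] by blast+

text \<open>\<open>X\<close> is the right limit at \<open>x\<close> in the chart based at the label
  of \<open>r\<close>. Its quadratic form is the infimum of those of the labels after
  \<open>x\<close> (third and fifth clause) and bounds those before \<open>x\<close> from above
  (fourth clause).\<close>

definition chart_value :: "real ^ (2 + 2) ^ (2 + 2) \<Rightarrow> complex \<times> lag \<Rightarrow> complex \<Rightarrow> real ^ 2 ^ 2 \<Rightarrow> bool" where
  "chart_value N r x X \<longleftrightarrow> transpose X = X \<and> lag_limit (arc_filter G x) snd ((*v) N ` mat_lag X) \<and>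
    (\<forall>p\<in>G. \<forall>v. positively_oriented (fst r) x (fst p) \<longrightarrow> qform X v \<le> qval N v p) \<and>
    (\<forall>p\<in>G. \<forall>v. positively_oriented (fst r) (fst p) x \<longrightarrow> qval N v p \<le> qform X v) \<and>
    (\<forall>v. \<forall>e>0. \<exists>p\<in>G. positively_oriented (fst r) x (fst p) \<and> qval N v p < qform X v + e)"

lemma chart_valueD:
  assumes "chart_value N r x X"
  shows "transpose X = X" "lag_limit (arc_filter G x) snd ((*v) N ` mat_lag X)"
    "\<And>p v. p \<in> G \<Longrightarrow> positively_oriented (fst r) x (fst p) \<Longrightarrow> qform X v \<le> qval N v p"
    "\<And>p v. p \<in> G \<Longrightarrow> positively_oriented (fst r) (fst p) x \<Longrightarrow> qval N v p \<le> qform X v"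
    "\<And>v e. e > 0 \<Longrightarrow> \<exists>p\<in>G. positively_oriented (fst r) x (fst p) \<and> qval N v p < qform X v + e"
  using assms unfolding chart_value_def by blast+

text \<open>For each vector the form values decrease as the points approach \<open>x\<close> and are
  bounded below, so they tend to their infimum; polarisation assembles these limits into one
  matrix.\<close>

lemma chart_limit:
  assumes N: "N \<in> Sp" "snd r = (*v) N ` infinity_lag" and r: "r \<in> G"
    and x: "x \<in> sphere 0 1" "x \<noteq> fst r"
  shows "\<exists>X. chart_value N r x X"
proof -
  note less = chart_less[OF N r]
  have rs: "fst r \<in> sphere 0 1" by (rule G_sphere[OF r])
  let ?A = "{p \<in> G. positively_oriented (fst r) x (fst p)}"
  let ?F = "arc_filter G x"
  have A_arc: "p \<in> ?A \<longleftrightarrow> p \<in> G \<and> positively_oriented x (fst p) (fst r)" for p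
    using positively_oriented_rotate_iff[of "fst r" x "fst p"] by simp
  have evA: "eventually (\<lambda>p. p \<in> ?A) ?F"
    using eventually_arc[OF x(1) rs x(2)] by eventually_elim (simp only: A_arc)
  \<comment> \<open>The label at \<open>b\<close>, before \<open>x\<close>, bounds the values from
    below; \<open>d\<close>, after \<open>x\<close>, makes the set of values nonempty.\<close>
  obtain b where b: "b \<in> G" "positively_oriented (fst r) (fst b) x" using dense[OF rs x(1) x(2)[symmetric]] by blast
  obtain d where d: "d \<in> ?A" using dense[OF x(1) rs x(2)] A_arc by blast
  have bp: "positively_oriented (fst r) (fst c) (fst p)"
    if "positively_oriented (fst r) (fst c) x" "p \<in> ?A" for c p
    using that positively_oriented_trans by blast
  have sym: "transpose (lag_coord N (snd p)) = lag_coord N (snd p)" "snd p = (*v) N ` mat_lag (lag_coord N (snd p))"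
    if "p \<in> ?A" for p
    using less(4,5)[OF b(1) _ bp[OF b(2) that]] that by blast+
  have mono_q: "qval N v p \<le> qval N v q" if "p \<in> G" "q \<in> G" "positively_oriented (fst r) (fst p) (fst q)" for p q v
    unfolding qval_def by (rule pos_def_diff_le[OF less(1)[OF that]])
  have lower: "qval N v c \<le> qval N v p" if "c \<in> G" "positively_oriented (fst r) (fst c) x" "p \<in> ?A" for c p v
    using mono_q[OF that(1) _ bp[OF that(2,3)]] that(3) by blast
  define L where "L v = Inf (qval N v ` ?A)" for v
  have bdd: "bdd_below (qval N v ` ?A)" for v
    using lower[OF b] by (intro bdd_belowI2) 
  have L_le: "L v \<le> qval N v p" if "p \<in> ?A" for p v
    unfolding L_def by (rule cInf_lower[OF imageI[OF that] bdd])
  have L_approx: "\<exists>p\<in>?A. qval N v p < y" if "L v < y" for v y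
  proof -
    have "qval N v ` ?A \<noteq> {}" using d by blast
    from cInf_lessD[OF this that[unfolded L_def]] show ?thesis by blast
  qed
  have lim: "(qval N v \<longlongrightarrow> L v) ?F" for v
  proof (rule decreasing_tendsto)
    show "eventually (\<lambda>p. L v \<le> qval N v p) ?F" using evA by eventually_elim (rule L_le)
    fix y assume "L v < y"
    then obtain q where q: "q \<in> ?A" "qval N v q < y" using L_approx by blast
    have "x \<noteq> fst q" using q(1) positively_oriented_distinct by blast
    then have "eventually (\<lambda>p. p \<in> G \<and> positively_oriented x (fst p) (fst q)) ?F"
      using q(1) G_sphere by (intro eventually_arc[OF x(1)]) auto
    then show "eventually (\<lambda>p. qval N v p < y) ?F"
    proof eventually_elim
      case (elim p)
      have "positively_oriented x (fst q) (fst r)" using q(1) A_arc by blast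
      then have "positively_oriented (fst p) (fst q) (fst r)"
        using elim pos.trans' by blast
      then have "positively_oriented (fst r) (fst p) (fst q)"
        by (simp only: positively_oriented_rotate_iff[of "fst r"])
      then show ?case using mono_q[of p q v] elim q by auto
    qed
  qed
  have "eventually (\<lambda>p. transpose (lag_coord N (snd p)) = lag_coord N (snd p)) ?F"
    using evA by eventually_elim (rule sym)
  moreover have "\<exists>l. ((\<lambda>p. qform (lag_coord N (snd p)) v) \<longlongrightarrow> l) ?F" for v
    using lim[of v] unfolding qval_def by blast
  ultimately obtain X where X: "transpose X = X" "((\<lambda>p. lag_coord N (snd p)) \<longlongrightarrow> X) ?F"
    using sym_matrix_converges[of "\<lambda>p. lag_coord N (snd p)" ?F] by blast
  have XL: "qform X v = L v" for v
    using tendsto_unique[OF arc_filter_nontrivial[OF x(1)] tendsto_qform[OF X(2)] lim[of v, unfolded qval_def]] .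
  show ?thesis
    unfolding chart_value_def
  proof (intro exI[of _ X] conjI ballI allI impI X(1))
    show "lag_limit ?F snd ((*v) N ` mat_lag X)"
      unfolding lag_limit_def
    proof (intro bexI[OF _ N(1)] exI conjI)
      show "((\<lambda>p. lag_coord N (snd p)) \<longlongrightarrow> X) ?F" by (rule X(2))
      show "eventually (\<lambda>p. transpose (lag_coord N (snd p)) = lag_coord N (snd p) \<and>
          snd p = (*v) N ` mat_lag (lag_coord N (snd p))) ?F"
        using evA by eventually_elim (intro conjI sym)
    qed (simp_all add: X(1))
    show "qform X v \<le> qval N v p" if "p \<in> G" "positively_oriented (fst r) x (fst p)" for p v
      unfolding XL using that by (intro L_le) simp
    show "qval N v p \<le> qform X v" if p: "p \<in> G" "positively_oriented (fst r) (fst p) x" for p v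
      unfolding XL L_def by (rule cInf_greatest) (use d in blast, use lower[OF p] in blast)
    show "\<exists>p\<in>G. positively_oriented (fst r) x (fst p) \<and> qval N v p < qform X v + e" if "0 < e" for v e
    proof -
      have "L v < qform X v + e" using that by (simp add: XL)
      then show ?thesis using L_approx by blast
    qed
  qed
qed

definition \<xi> :: "complex \<Rightarrow> lag" where
  "\<xi> x = (THE l. lag_limit (arc_filter G x) snd l)"

lemma \<xi>_eq: "x \<in> sphere 0 1 \<Longrightarrow> lag_limit (arc_filter G x) snd l \<Longrightarrow> \<xi> x = l"
  unfolding \<xi>_def by (rule the_equality) (assumption, erule (1) lag_limit_unique[OF arc_filter_nontrivial])

text \<open>A chart based at the label of \<open>r\<close> is obtained from a maximal triple
  containing it. Density supplies the two further points, successively closer to the antipode of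
  \<open>x\<close>.\<close>

lemma G_nonempty_avoid:
  assumes "x \<in> sphere 0 1" obtains r N where "r \<in> G" "fst r \<noteq> x" "N \<in> Sp" "snd r = (*v) N ` infinity_lag"
proof -
  have "x \<noteq> 0" using assms by auto
  then have 1: "- x \<in> sphere 0 1" "x \<noteq> - x" using assms by (simp_all add: eq_neg_iff_add_eq_0)
  obtain r where r: "r \<in> G" "positively_oriented x (fst r) (- x)" using dense[OF assms 1] by blast
  have rs: "fst r \<in> sphere 0 1" "fst r \<noteq> x" "fst r \<noteq> - x"
    using G_sphere[OF r(1)] positively_oriented_distinct[OF r(2)] by auto
  obtain p where p: "p \<in> G" "positively_oriented (fst r) (fst p) (- x)" using dense[OF rs(1) 1(1) rs(3)] by blast
  have "fst p \<in> sphere 0 1" "fst p \<noteq> - x" using G_sphere[OF p(1)] positively_oriented_distinct[OF p(2)] by auto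
  then obtain q where q: "q \<in> G" "positively_oriented (fst p) (fst q) (- x)" using dense 1(1) by blast
  have "positively_oriented (fst r) (fst p) (fst q)"
    using pos.trans'[of "- x" "fst r" "fst p" "fst q"] p(2) q(2)
    by (simp only: positively_oriented_rotate_iff[of "- x"])
  then have "maximal_triple (snd r) (snd p) (snd q)" using mono r(1) p(1) q(1) by blast
  then obtain N where "N \<in> Sp" "snd r = (*v) N ` infinity_lag" using maximal_triple_obtain_chart by blast
  then show ?thesis using that r(1) rs(2) by blast
qed

lemma lag_limit_\<xi>: assumes "x \<in> sphere 0 1" shows "lag_limit (arc_filter G x) snd (\<xi> x)"
proof -
  obtain r N where r: "r \<in> G" "fst r \<noteq> x" "N \<in> Sp" "snd r = (*v) N ` infinity_lag"
    using G_nonempty_avoid[OF assms] .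
  obtain X where "chart_value N r x X"
    using chart_limit[OF r(3,4,1) assms r(2)[symmetric]] by blast
  note X = chart_valueD[OF this]
  show ?thesis unfolding \<xi>_eq[OF assms X(2)] by (rule X(2))
qed

lemma \<xi>_Lagrangian: "x \<in> sphere 0 1 \<Longrightarrow> \<xi> x \<in> Lagrangians"
  using lag_limit_\<xi> lag_limit_Lagrangian by blast

text \<open>\<open>f\<close> carries the arcs starting at \<open>x\<close> to those starting at
  \<open>f x\<close>, and the labels along with them. Both sides are limits of the same transported
  labels, hence equal.\<close>

lemma \<xi>_equivariant:
  assumes N: "N \<in> Sp" and f: "\<And>x. x \<in> sphere 0 1 \<Longrightarrow> f x \<in> sphere 0 1"
    and f_pos: "\<And>x y z. x \<in> sphere 0 1 \<Longrightarrow> y \<in> sphere 0 1 \<Longrightarrow> z \<in> sphere 0 1 \<Longrightarrow>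
      positively_oriented (f x) (f y) (f z) \<longleftrightarrow> positively_oriented x y z"
    and f_surj: "f ` sphere 0 1 = sphere 0 1"
    and fG: "\<And>p. p \<in> G \<Longrightarrow> (f (fst p), (*v) N ` snd p) \<in> G"
    and x: "x \<in> sphere 0 1"
  shows "\<xi> (f x) = (*v) N ` \<xi> x"
proof -
  define g where "g p = (f (fst p), (*v) N ` snd p)" for p :: "complex \<times> lag"
  have le: "filtermap g (arc_filter G x) \<le> arc_filter G (f x)"
  proof (rule filter_leI)
    fix P assume "eventually P (arc_filter G (f x))"
    then obtain y where y: "y \<in> sphere 0 1 - {f x}" "\<And>p. p \<in> G \<Longrightarrow> positively_oriented (f x) (fst p) y \<Longrightarrow> P p"
      unfolding eventually_arc_filter[OF f[OF x]] by blast
    have "y \<in> f ` sphere 0 1" using y(1) unfolding f_surj by simp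
    then obtain y' where y': "y' \<in> sphere 0 1" "y = f y'" by blast
    have "eventually (\<lambda>p. p \<in> G \<and> positively_oriented x (fst p) y') (arc_filter G x)"
      using y(1) y' by (intro eventually_arc x) auto
    then show "eventually P (filtermap g (arc_filter G x))"
      unfolding eventually_filtermap
    proof eventually_elim
      case (elim p)
      then show ?case
        using y(2)[OF fG[of p]] f_pos[OF x G_sphere[of p] y'(1)] by (simp add: g_def y'(2))
    qed
  qed
  have nt: "arc_filter G x \<noteq> bot" by (rule arc_filter_nontrivial[OF x])
  have "lag_limit (filtermap g (arc_filter G x)) snd (\<xi> (f x))"
    using lag_limit_mono[OF lag_limit_\<xi>[OF f[OF x]] le] .
  then have "lag_limit (arc_filter G x) (\<lambda>p. (*v) N ` snd p) (\<xi> (f x))"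
    by (simp add: lag_limit_filtermap g_def)
  moreover have "lag_limit (arc_filter G x) (\<lambda>p. (*v) N ` snd p) ((*v) N ` \<xi> x)"
    by (rule lag_limit_Sp[OF N lag_limit_\<xi>[OF x]])
  ultimately show ?thesis by (rule lag_limit_unique[OF nt])
qed

text \<open>Limits preserve only weak inequalities. Two labelled points \<open>p\<close>,
  \<open>q\<close> strictly between \<open>x\<close> and \<open>y\<close> restore strictness: the
  limit at \<open>x\<close> is at most the label of \<open>p\<close>, which is below that of
  \<open>q\<close>, which is at most the limit at \<open>y\<close>.\<close>

lemma \<xi>_chart_less:
  assumes N: "N \<in> Sp" "snd r = (*v) N ` infinity_lag" and r: "r \<in> G"
    and xy: "positively_oriented (fst r) x y"
  shows "maximal_triple (snd r) (\<xi> x) (\<xi> y)"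
proof -
  have s: "x \<in> sphere 0 1" "y \<in> sphere 0 1" "x \<noteq> y" "x \<noteq> fst r" "y \<noteq> fst r"
    using positively_oriented_sphere[OF xy] positively_oriented_distinct[OF xy] by auto
  obtain X where "chart_value N r x X"
    using chart_limit[OF N r s(1,4)] by blast
  note X = chart_valueD[OF this]
  obtain Y where "chart_value N r y Y"
    using chart_limit[OF N r s(2,5)] by blast
  note Y = chart_valueD[OF this]
  obtain p where p: "p \<in> G" "positively_oriented x (fst p) y" using dense[OF s(1-3)] by blast
  have ps: "fst p \<in> sphere 0 1" "fst p \<noteq> y" using G_sphere[OF p(1)] positively_oriented_distinct[OF p(2)] by auto
  obtain q where q: "q \<in> G" "positively_oriented (fst p) (fst q) y" using dense[OF ps(1) s(2) ps(2)] by blast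
  note rot = positively_oriented_rotate and tr = positively_oriented_trans
  have y1: "positively_oriented y (fst r) x" using rot[OF rot[OF xy]] .
  have y2: "positively_oriented y x (fst p)" using rot[OF rot[OF p(2)]] .
  have y3: "positively_oriented y (fst p) (fst q)" using rot[OF rot[OF q(2)]] .
  have rxp: "positively_oriented (fst r) x (fst p)" by (rule pos.trans'[OF y1 y2])
  have yrp: "positively_oriented y (fst r) (fst p)" by (rule tr[OF y1 y2])
  have rpq: "positively_oriented (fst r) (fst p) (fst q)" by (rule pos.trans'[OF yrp y3])
  have "positively_oriented y (fst r) (fst q)" by (rule tr[OF yrp y3])
  then have rqy: "positively_oriented (fst r) (fst q) y" by (rule rot)
  have "pos_def (Y - X)"
    unfolding pos_def_iff_qform qform_diff
  proof (intro conjI allI impI)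
    show "transpose (Y - X) = Y - X" by (simp add: transpose_diff X Y)
    fix v :: "real ^ 2" assume "v \<noteq> 0"
    then have "qval N v p < qval N v q"
      unfolding qval_def by (rule pos_def_diff_less[OF chart_less(1)[OF N r p(1) q(1) rpq]])
    with X(3)[OF p(1) rxp, of v] Y(4)[OF q(1) rqy, of v] show "0 < qform Y v - qform X v" by simp
  qed
  then show ?thesis
    unfolding N(2) maximal_triple_chart[OF N(1)]
    using X(1) Y(1) \<xi>_eq[OF s(1) X(2)] \<xi>_eq[OF s(2) Y(2)] by blast
qed

text \<open>\<open>\<xi>_chart_less\<close> has the label of a point of \<open>G\<close> in first
  place. Choosing that point between \<open>z\<close> and \<open>x\<close>, its instances for
  \<open>x\<close>, \<open>y\<close> and for \<open>y\<close>, \<open>z\<close> combine by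
  transitivity and eliminate it.\<close>

lemma \<xi>_monotone:
  assumes "positively_oriented x y z" shows "maximal_triple (\<xi> x) (\<xi> y) (\<xi> z)"
proof -
  note rot = positively_oriented_rotate and tr = positively_oriented_trans
  have s: "x \<in> sphere 0 1" "z \<in> sphere 0 1" "z \<noteq> x"
    using positively_oriented_sphere[OF assms] positively_oriented_distinct[OF assms] by auto
  obtain r where r: "r \<in> G" "positively_oriented z (fst r) x" using dense[OF s(2,1,3)] by blast
  have zxy: "positively_oriented z x y" using rot[OF rot[OF assms]] .
  have rx: "positively_oriented (fst r) x z" by (rule rot[OF r(2)])
  have zry: "positively_oriented z (fst r) y" by (rule tr[OF r(2) zxy])
  have ryz: "positively_oriented (fst r) y z" by (rule rot[OF zry])
  have rxy: "positively_oriented (fst r) x y"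
    using rot[OF rot[OF tr[OF rot[OF zxy] rot[OF rot[OF r(2)]]]]] .
  have "fst r \<in> sphere 0 1" "x \<noteq> fst r" using G_sphere[OF r(1)] positively_oriented_distinct[OF r(2)] by auto
  obtain p where p: "p \<in> G" "positively_oriented (fst r) (fst p) x"
    using dense[OF \<open>fst r \<in> sphere 0 1\<close> s(1) \<open>x \<noteq> fst r\<close>[symmetric]] by blast
  have "fst p \<in> sphere 0 1" "fst p \<noteq> x" using G_sphere[OF p(1)] positively_oriented_distinct[OF p(2)] by auto
  then obtain q where q: "q \<in> G" "positively_oriented (fst p) (fst q) x" using dense s(1) by blast
  have "positively_oriented (fst r) (fst p) (fst q)"
    using pos.trans'[of x "fst r" "fst p" "fst q"] p(2) q(2)
    by (simp only: positively_oriented_rotate_iff[of x])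
  then have "maximal_triple (snd r) (snd p) (snd q)" using mono r(1) p(1) q(1) by blast
  then obtain N where N: "N \<in> Sp" "snd r = (*v) N ` infinity_lag" using maximal_triple_obtain_chart by blast
  show ?thesis
    using maximal_triple_trans'[OF \<xi>_chart_less[OF N r(1) rxy] \<xi>_chart_less[OF N r(1) ryz]] .
qed

text \<open>To the right of \<open>cis t\<close> the values of \<open>\<xi>\<close> are squeezed:
  monotonicity keeps them above \<open>X\<close>, and any label further on bounds them from above,
  where such labels come arbitrarily close to \<open>X\<close> on each vector.\<close>

lemma \<xi>_right_continuous: "limitin lag_topology (\<lambda>s. \<xi> (cis s)) (\<xi> (cis t)) (at_right t)"
proof (rule lag_limit_imp_limitin)
  let ?x = "cis t"
  have x: "?x \<in> sphere 0 1" by simp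
  obtain r N where r: "r \<in> G" "fst r \<noteq> ?x" and N: "N \<in> Sp" "snd r = (*v) N ` infinity_lag"
    using G_nonempty_avoid[OF x] .
  have rs: "fst r \<in> sphere 0 1" by (rule G_sphere[OF r(1)])
  have near: "eventually (\<lambda>s. positively_oriented ?x (cis s) y) (at_right t)"
    if y: "y \<in> sphere 0 1" "y \<noteq> ?x" for y
  proof -
    obtain b where b: "t \<le> b" "b < t + 2 * pi" "y = cis b" using sphere_cis[OF y(1)] by blast
    then have "t < b" using y(2) by (cases "t = b") auto
    have "eventually (\<lambda>s. s \<in> {t<..<b}) (at_right t)" by (rule eventually_at_right_real[OF \<open>t < b\<close>])
    then show ?thesis
    proof eventually_elim
      case (elim s)
      then show ?case using b unfolding positively_oriented_def
        by (intro exI[of _ t] exI[of _ s] exI[of _ b]) auto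
    qed
  qed
  obtain X where "chart_value N r ?x X"
    using chart_limit[OF N r(1) x r(2)[symmetric]] by blast
  note X = chart_valueD[OF this]
  define Z where "Z s = lag_coord N (\<xi> (cis s))" for s
  have \<xi>x: "\<xi> ?x = (*v) N ` mat_lag X" by (rule \<xi>_eq[OF x X(2)])
  have ev: "eventually (\<lambda>s. transpose (Z s) = Z s \<and> \<xi> (cis s) = (*v) N ` mat_lag (Z s) \<and> pos_def (Z s - X)) (at_right t)"
    using near[OF rs r(2)]
  proof eventually_elim
    case (elim s)
    then have "positively_oriented (fst r) ?x (cis s)" by (simp only: positively_oriented_rotate_iff[of "fst r"])
    from \<xi>_chart_less[OF N r(1) this] show ?case
      unfolding N(2) maximal_triple_coord[OF N(1)] Z_def by (simp add: \<xi>x N(1))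
  qed
  have lim: "((\<lambda>s. qform (Z s) v) \<longlongrightarrow> qform X v) (at_right t)" for v
  proof (rule decreasing_tendsto)
    show "eventually (\<lambda>s. qform X v \<le> qform (Z s) v) (at_right t)"
      using ev by eventually_elim (auto intro: pos_def_diff_le)
    fix y assume "qform X v < y"
    then obtain p where p: "p \<in> G" "positively_oriented (fst r) ?x (fst p)" "qval N v p < y"
      using X(5)[of "y - qform X v" v] by auto
    have "fst p \<in> sphere 0 1" "fst p \<noteq> ?x" using G_sphere[OF p(1)] positively_oriented_distinct[OF p(2)] by auto
    from near[OF this] ev show "eventually (\<lambda>s. qform (Z s) v < y) (at_right t)"
    proof eventually_elim
      case (elim s)
      have cs: "cis s \<in> sphere 0 1" "cis s \<noteq> fst r"
      proof -
        show "cis s \<in> sphere 0 1" by simp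
        show "cis s \<noteq> fst r"
          using elim(1) p(2) positively_oriented_asym[of ?x "cis s" "fst p"]
          by (auto simp: positively_oriented_rotate_iff[of _ ?x])
      qed
      have "positively_oriented (fst r) (cis s) (fst p)"
      proof -
        have "positively_oriented (fst p) ?x (cis s)" "positively_oriented (fst p) (fst r) ?x"
          using elim(1) p(2) by (simp_all only: positively_oriented_rotate_iff[of "fst p"])
        then have "positively_oriented (fst p) (fst r) (cis s)" using positively_oriented_trans by blast
        then show ?thesis by (rule positively_oriented_rotate)
      qed
      obtain W where "chart_value N r (cis s) W"
    using chart_limit[OF N r(1) cs] by blast
  note W = chart_valueD[OF this]
      have "Z s = W" unfolding Z_def by (simp add: \<xi>_eq[OF cs(1) W(2)] N(1))
      with \<open>positively_oriented (fst r) (cis s) (fst p)\<close> have "qform (Z s) v \<le> qval N v p" using W(3)[OF p(1)] by blast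
      then show ?case using p(3) by (rule le_less_trans)
    qed
  qed
  have "(Z \<longlongrightarrow> X) (at_right t)"
  proof -
    have "eventually (\<lambda>s. transpose (Z s) = Z s) (at_right t)" using ev by eventually_elim simp
    moreover have "\<exists>l. ((\<lambda>s. qform (Z s) v) \<longlongrightarrow> l) (at_right t)" for v using lim by blast
    ultimately obtain X' where X': "transpose X' = X'" "(Z \<longlongrightarrow> X') (at_right t)"
      using sym_matrix_converges[of Z "at_right t"] by blast
    have "qform X' v = qform X v" for v
      using tendsto_unique[OF trivial_limit_at_right_real tendsto_qform[OF X'(2)] lim[of v]] .
    then have "X' = X" using sym_matrix_of_qform[OF X(1)] sym_matrix_of_qform[OF X'(1)] by simp
    with X' show ?thesis by simp
  qed
  moreover have "eventually (\<lambda>s. transpose (Z s) = Z s \<and> \<xi> (cis s) = (*v) N ` mat_lag (Z s)) (at_right t)"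
    using ev by eventually_elim simp
  ultimately show "lag_limit (at_right t) (\<lambda>s. \<xi> (cis s)) (\<xi> ?x)"
    unfolding lag_limit_def using N(1) X(1) \<xi>x by (intro bexI[OF _ N(1)] exI[of _ Z] exI[of _ X]) simp
qed

end

section \<open>Ping-pong\<close>

definition coset_pm :: "real ^ (2 + 2) ^ (2 + 2) \<Rightarrow> (real ^ (2 + 2) ^ (2 + 2)) set" where
  "coset_pm M = {M, - M}"

lemma carrier_PSp: "carrier PSp = coset_pm ` Sp"
  by (auto simp: PSp_def FactGroup_def RCOSETS_def r_coset_def Sp_group_def coset_pm_def minus_matrix_mult)

lemma carrier_PSp_pm: "carrier PSp_pm = coset_pm ` (Sp \<union> Sp_minus)"
  by (auto simp: PSp_pm_def FactGroup_def RCOSETS_def r_coset_def Sp_pm_group_def coset_pm_def minus_matrix_mult)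

lemma mult_PSp: "coset_pm M \<otimes>\<^bsub>PSp\<^esub> coset_pm N = coset_pm (M ** N)"
  by (auto simp: PSp_def FactGroup_def set_mult_def Sp_group_def coset_pm_def minus_matrix_mult matrix_mult_minus)

lemma mult_PSp_pm: "coset_pm M \<otimes>\<^bsub>PSp_pm\<^esub> coset_pm N = coset_pm (M ** N)"
  by (auto simp: PSp_pm_def FactGroup_def set_mult_def Sp_pm_group_def coset_pm_def minus_matrix_mult matrix_mult_minus)

lemma one_PSp_pm: "\<one>\<^bsub>PSp_pm\<^esub> = coset_pm (mat 1)"
  by (simp add: PSp_pm_def FactGroup_def coset_pm_def)

lemma coset_pm_eqI: "g \<in> carrier PSp_pm \<Longrightarrow> M \<in> g \<Longrightarrow> g = coset_pm M"
  by (auto simp: carrier_PSp_pm coset_pm_def)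

lemma act_coset_pm: "subspace l \<Longrightarrow> act (coset_pm M) l = (*v) M ` l"
  by (simp add: act_def coset_pm_def image_uminus_subspace)

lemma Lagrangian_subspace: "l \<in> Lagrangians \<Longrightarrow> subspace l"
  by (simp add: Lagrangians_def)

lemma Shilov_hyperbolic_coset_pm: "Shilov_matrix M \<Longrightarrow> Shilov_hyperbolic (coset_pm M)"
  by (auto simp: Shilov_hyperbolic_iff coset_pm_def)

lemma Gamma03_simps:
  "carrier Gamma03 = range (word_class {})" "\<one>\<^bsub>Gamma03\<^esub> = word_class {} []"
  by (simp_all add: Gamma03_def presented_group_def)

lemma mult_Gamma03: "word_class {} u \<otimes>\<^bsub>Gamma03\<^esub> word_class {} v = word_class {} (u @ v)"
  by (simp add: Gamma03_def mult_presented_group)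

lemma Gamma03_induct [consumes 1, case_names one step]:
  assumes "\<gamma> \<in> carrier Gamma03" and one: "P \<one>\<^bsub>Gamma03\<^esub>"
    and step: "\<And>a \<gamma>. a \<in> {\<alpha>, inv\<^bsub>Gamma03\<^esub> \<alpha>, \<beta>, inv\<^bsub>Gamma03\<^esub> \<beta>} \<Longrightarrow> \<gamma> \<in> carrier Gamma03 \<Longrightarrow> P \<gamma> \<Longrightarrow>
      P (a \<otimes>\<^bsub>Gamma03\<^esub> \<gamma>)"
  shows "P \<gamma>"
proof -
  interpret group Gamma03 by (rule group_Gamma03)
  have inv_gen: "inv\<^bsub>Gamma03\<^esub> (gen {} x) = word_class {} [(x, False)]" for x
  proof (rule inv_equality)
    have "word_eq {} [(x, False), (x, \<not> False)] []" by (rule word_eq.cancel)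
    then show "word_class {} [(x, False)] \<otimes>\<^bsub>Gamma03\<^esub> gen {} x = \<one>\<^bsub>Gamma03\<^esub>"
      by (simp add: gen_def mult_Gamma03 Gamma03_simps(2) word_class_eq_iff)
  qed (simp_all add: Gamma03_simps gen_def)
  have "P (word_class {} u)" for u
  proof (induction u)
    case Nil then show ?case using one by (simp add: Gamma03_simps(2))
  next
    case (Cons a u)
    obtain x b where a: "a = (x, b)" by (cases a)
    have "word_class {} [a] \<in> {\<alpha>, inv\<^bsub>Gamma03\<^esub> \<alpha>, \<beta>, inv\<^bsub>Gamma03\<^esub> \<beta>}"
      unfolding \<alpha>_def \<beta>_def inv_gen by (cases x; cases b) (simp_all add: a gen_def)
    from step[OF this _ Cons] show ?case by (simp add: mult_Gamma03 Gamma03_simps(1))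
  qed
  then show ?thesis using assms(1) by (auto simp: Gamma03_simps(1))
qed

text \<open>Cyclic order of four Lagrangians; the two remaining subtriples follow by
  transitivity.\<close>

definition cyc4 :: "lag \<Rightarrow> lag \<Rightarrow> lag \<Rightarrow> lag \<Rightarrow> bool" where
  "cyc4 p q r s \<longleftrightarrow> maximal_triple p q r \<and> maximal_triple p r s"

lemma cyc4_rotate: "cyc4 p q r s \<Longrightarrow> cyc4 q r s p"
  unfolding cyc4_def using maximal_triple_trans' maximal_triple_trans maximal_triple_rotate by blast

lemma cyc4_Sp_minus:
  assumes "S \<in> Sp_minus" "cyc4 p q r s"
  shows "cyc4 ((*v) S ` s) ((*v) S ` r) ((*v) S ` q) ((*v) S ` p)"
  using assms unfolding cyc4_def
  by (blast intro: maximal_triple_Sp_minus maximal_triple_trans' maximal_triple_trans)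

text \<open>Shrinking the interval from \<open>c\<close> to \<open>d\<close> keeps it disjoint from
  the one from \<open>a\<close> to \<open>b\<close>.\<close>

lemma cyc4_nested:
  assumes "cyc4 a b c d" "cyc4 c x y d"
  shows "cyc4 a b x y"
proof -
  note tr = maximal_triple_trans and tr' = maximal_triple_trans' and rot = maximal_triple_rotate
  have ca: "maximal_triple c d a" "maximal_triple c a b"
    using cyc4_rotate[OF cyc4_rotate[OF assms(1)]] by (simp_all add: cyc4_def)
  have xy: "maximal_triple c x y" "maximal_triple c y d" using assms(2) by (simp_all add: cyc4_def)
  have ya: "maximal_triple c y a" by (rule tr[OF xy(2) ca(1)])
  have "maximal_triple x a b" by (rule tr'[OF tr[OF xy(1) ya] ca(2)])
  moreover have "maximal_triple x y a" by (rule tr'[OF xy(1) ya])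
  ultimately show ?thesis unfolding cyc4_def using rot by blast
qed

locale reflection_triple =
  fixes Rf :: "W3_gen \<Rightarrow> real ^ (2 + 2) ^ (2 + 2)"
  assumes Rf: "Rf i \<in> Sp_minus" and Rf_Rf: "Rf i ** Rf i = mat 1"
begin

primrec mprod :: "W3_gen list \<Rightarrow> real ^ (2 + 2) ^ (2 + 2)" where
  "mprod [] = mat 1" | "mprod (i # w) = Rf i ** mprod w"

lemma mprod_append: "mprod (u @ v) = mprod u ** mprod v"
  by (induction u) (simp_all add: matrix_mul_assoc)

lemma mprod_Sp: "(even (length w) \<longrightarrow> mprod w \<in> Sp) \<and> (odd (length w) \<longrightarrow> mprod w \<in> Sp_minus)"
  by (induction w) (auto simp: Sp_one Rf intro: Sp_minus_mult Sp_minus_Sp_mult)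

end

text \<open>As \<open>Rf i\<close> reverses the order and fixes \<open>a i\<close> and
  \<open>b i\<close>, it exchanges the interval between them with the complementary one.\<close>

locale ping_pong = reflection_triple +
  fixes a b :: "W3_gen \<Rightarrow> lag"
  assumes fix_a: "(*v) (Rf i) ` a i = a i" and fix_b: "(*v) (Rf i) ` b i = b i"
    and disjoint: "i \<noteq> j \<Longrightarrow> cyc4 (a i) (b i) (a j) (b j)"
begin

text \<open>Reading from the right, each letter differs from the previous one, so it meets an
  interval disjoint from its own and pulls it inside. Every letter reverses the orientation, which
  swaps the end points for odd lengths.\<close>

lemma nested:
  assumes "w \<noteq> []" "distinct_adj (w @ [j])"
  shows "cyc4 (a (hd w)) ((*v) (mprod w) ` (if even (length w) then a j else b j))
    ((*v) (mprod w) ` (if even (length w) then b j else a j)) (b (hd w))"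
  using assms
proof (induction w)
  case (Cons i w)
  have *: "cyc4 (a i) ((*v) (Rf i) ` y) ((*v) (Rf i) ` x) (b i)" if "cyc4 (a i) (b i) x y" for x y
    using cyc4_rotate[OF cyc4_rotate[OF cyc4_rotate[OF cyc4_Sp_minus[OF Rf[of i] that]]]] unfolding fix_a fix_b .
  show ?case
  proof (cases "w = []")
    case True
    then have "i \<noteq> j" using Cons.prems(2) by simp
    then show ?thesis using *[OF disjoint] True by simp
  next
    case False
    then obtain k v where w: "w = k # v" by (cases w) auto
    have "i \<noteq> k" "distinct_adj (w @ [j])" using Cons.prems(2) by (simp_all add: w)
    from *[OF cyc4_nested[OF disjoint[OF this(1)] Cons.IH[OF False this(2), unfolded w, simplified]]]
    show ?thesis by (simp add: w image_matrix_mult split: if_splits)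
  qed
qed simp

text \<open>If the first and last letters differ, \<open>nested\<close> applies with
  \<open>j\<close> the first letter and yields an interval mapped inside itself. If they agree, the
  word is a conjugate by that letter of one shorter by two.\<close>

lemma Shilov_mprod:
  assumes "w \<noteq> []" "even (length w)" "distinct_adj w"
  shows "Shilov_matrix (mprod w)"
  using assms
proof (induction "length w" arbitrary: w rule: less_induct)
  case less
  show ?case
  proof (cases "hd w = last w")
    case False
    have "distinct_adj (w @ [hd w])"
      using less.prems(1,3) False by (simp add: distinct_adj_append_iff)
    from nested[OF less.prems(1) this] less.prems(2)
    have "cyc4 (a (hd w)) ((*v) (mprod w) ` a (hd w)) ((*v) (mprod w) ` b (hd w)) (b (hd w))" by simp
    then show ?thesis
      using Shilov_matrix_of_nested mprod_Sp less.prems(2) unfolding cyc4_def by blast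
  next
    case True
    obtain i v where w: "w = i # v" using less.prems(1) by (cases w) auto
    have "v \<noteq> []" using less.prems(2) w by auto
    then obtain m j where v: "v = m @ [j]" by (metis append_butlast_last_id)
    then have ij: "j = i" using True w by simp
    have "m \<noteq> []" using less.prems(3) by (auto simp: w v ij)
    moreover have "even (length m)" "length m < length w" using less.prems(2) by (simp_all add: w v)
    moreover have "distinct_adj m" using less.prems(3) by (simp add: w v distinct_adj_Cons distinct_adj_append_iff)
    ultimately have "Shilov_matrix (mprod m)" using less.hyps by blast
    then have "Shilov_matrix (Rf i ** mprod m ** Rf i)" by (rule Shilov_matrix_conj_reflection[OF Rf Rf_Rf])
    then show ?thesis by (simp add: w v ij mprod_append matrix_mul_assoc)
  qed
qed

end

text \<open>Since \<open>s\<^sub>i s\<^sub>j\<close> corresponds to \<open>t\<^sub>i t\<^sub>j\<^sup>-\<^sup>1\<close>, an element of \<^term>\<open>Gamma03\<close> is recovered from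
  any word of even length representing its image in \<^term>\<open>W3\<close>.\<close>

primrec t_gen :: "W3_gen \<Rightarrow> pants_gen word set" where
  "t_gen S1 = \<alpha>" | "t_gen S2 = \<one>\<^bsub>Gamma03\<^esub>" | "t_gen S3 = inv\<^bsub>Gamma03\<^esub> \<beta>"

text \<open>The flag is the parity of the position: letters contribute \<open>t_gen\<close> and its
  inverse alternately.\<close>

primrec lift_word :: "bool \<Rightarrow> W3_gen list \<Rightarrow> pants_gen word set" where
  "lift_word e [] = \<one>\<^bsub>Gamma03\<^esub>"
| "lift_word e (i # w) = (if e then t_gen i else inv\<^bsub>Gamma03\<^esub> t_gen i) \<otimes>\<^bsub>Gamma03\<^esub> lift_word (\<not> e) w"

lemma t_gen_carrier: "t_gen i \<in> carrier Gamma03"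
proof -
  interpret group Gamma03 by (rule group_Gamma03)
  have "\<alpha> \<in> carrier Gamma03" "\<beta> \<in> carrier Gamma03"
    by (simp_all add: \<alpha>_def \<beta>_def gen_def Gamma03_simps)
  then show ?thesis by (cases i) simp_all
qed

lemma lift_word_carrier: "lift_word e w \<in> carrier Gamma03"
proof -
  interpret group Gamma03 by (rule group_Gamma03)
  show ?thesis by (induction w arbitrary: e) (simp_all add: t_gen_carrier)
qed

context reflection_triple
begin

text \<open>Equal adjacent letters stand at positions of opposite parity, so cancelling them changes
  neither the matrix product nor the lift. A word reducing to the empty one therefore lifts to the
  identity.\<close>

lemma reduce_word:
  "\<exists>w'. distinct_adj w' \<and> even (length w') = even (length w) \<and> mprod w' = mprod w \<and>
    (\<forall>e. lift_word e w' = lift_word e w)"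
proof (induction w)
  case Nil then show ?case by (intro exI[of _ "[]"]) simp
next
  case (Cons i w)
  interpret group Gamma03 by (rule group_Gamma03)
  obtain w' where w': "distinct_adj w'" "even (length w') = even (length w)" "mprod w' = mprod w"
    "\<And>e. lift_word e w' = lift_word e w" using Cons by blast
  show ?case
  proof (cases "w' \<noteq> [] \<and> hd w' = i")
    case True
    then obtain v where v: "w' = i # v" by (cases w') auto
    have "mprod (i # w) = Rf i ** (Rf i ** mprod v)" using w'(3) by (simp add: v)
    also have "\<dots> = mprod v" unfolding matrix_mul_assoc Rf_Rf by simp
    finally have "mprod v = mprod (i # w)" ..
    moreover have "lift_word e v = lift_word e (i # w)" for e
    proof -
      have "lift_word e (i # w) = (if e then t_gen i else inv\<^bsub>Gamma03\<^esub> t_gen i) \<otimes>\<^bsub>Gamma03\<^esub> lift_word (\<not> e) (i # v)"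
        using w'(4)[of "\<not> e"] by (simp add: v)
      also have "\<dots> = lift_word e v"
        by (simp add: m_assoc[symmetric] t_gen_carrier lift_word_carrier)
      finally show ?thesis ..
    qed
    moreover have "even (length v) = even (length (i # w))" using w'(2) by (simp add: v) blast
    moreover have "distinct_adj v" using w'(1) by (auto simp: v distinct_adj_Cons)
    ultimately show ?thesis by blast
  next
    case False
    then have "distinct_adj (i # w')" using w'(1) by (cases w') auto
    then show ?thesis using w' by (intro exI[of _ "i # w'"]) simp
  qed
qed

end

section \<open>The tessellation by ideal triangles\<close>

locale marked_plane =
  fixes p q :: complex
  assumes wedge_pq: "wedge p q = - 2"
begin

lemma wedge_qp: "wedge q p = 2"
  using wedge_swap[of q p] by (simp add: wedge_pq)

lemma decompose: "wedge v q *\<^sub>R p + wedge p v *\<^sub>R q = - 2 *\<^sub>R v"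
  using wedge_decompose[of p q v] by (simp add: wedge_pq)

text \<open>In coordinates along \<open>p\<close> and \<open>q\<close> these are integer matrices
  congruent to the identity modulo 2. Each preserves two of the lines of \<open>q\<close>,
  \<open>p + q\<close>, \<open>p\<close>, negating one and fixing the other pointwise; the third
  line belongs to the corner opposite to the side.\<close>

primrec refl_lin :: "W3_gen \<Rightarrow> complex \<Rightarrow> complex" where
  "refl_lin S1 v = v + (wedge v q - wedge p v) *\<^sub>R p"
| "refl_lin S2 v = v + wedge v q *\<^sub>R p"
| "refl_lin S3 v = v + (wedge p v - wedge v q) *\<^sub>R q"

lemma refl_lin_coords:
  "refl_lin S1 (x *\<^sub>R p + y *\<^sub>R q) = (2 * y - x) *\<^sub>R p + y *\<^sub>R q"
  "refl_lin S2 (x *\<^sub>R p + y *\<^sub>R q) = (- x) *\<^sub>R p + y *\<^sub>R q"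
  "refl_lin S3 (x *\<^sub>R p + y *\<^sub>R q) = x *\<^sub>R p + (2 * x - y) *\<^sub>R q"
  by (simp_all add: wedge_pq) (simp_all add: scaleR_conv_of_real algebra_simps)

lemma coords: obtains x y where "v = x *\<^sub>R p + y *\<^sub>R q"
proof
  have "v = (- 1 / 2) *\<^sub>R (- 2 *\<^sub>R v)" by simp
  also have "\<dots> = (- 1 / 2) *\<^sub>R (wedge v q *\<^sub>R p + wedge p v *\<^sub>R q)" unfolding decompose ..
  also have "\<dots> = (- wedge v q / 2) *\<^sub>R p + (- wedge p v / 2) *\<^sub>R q" by (simp add: scaleR_add_right)
  finally show "v = (- wedge v q / 2) *\<^sub>R p + (- wedge p v / 2) *\<^sub>R q" .
qed

lemma refl_lin_scaleR: "refl_lin i (r *\<^sub>R v) = r *\<^sub>R refl_lin i v"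
  by (cases i) (simp_all add: algebra_simps)

lemma refl_lin_involutive: "refl_lin i (refl_lin i v) = v"
proof -
  obtain x y where "v = x *\<^sub>R p + y *\<^sub>R q" by (rule coords)
  then show ?thesis by (cases i) (simp_all only: refl_lin_coords, simp_all)
qed

lemma wedge_refl_lin: "wedge (refl_lin i u) (refl_lin i v) = - wedge u v"
proof -
  obtain x y where u: "u = x *\<^sub>R p + y *\<^sub>R q" by (rule coords)
  obtain x' y' where v: "v = x' *\<^sub>R p + y' *\<^sub>R q" by (rule coords)
  show ?thesis unfolding u v by (cases i) (simp_all only: refl_lin_coords, simp_all add: wedge_pq wedge_qp algebra_simps)
qed

lemma refl_lin_nonzero: "v \<noteq> 0 \<Longrightarrow> refl_lin i v \<noteq> 0"
  using refl_lin_involutive[of i v] refl_lin_scaleR[of i 0 0] by auto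

text \<open>This ties the reflections to the holonomy of alpha and beta; the sign in the second
  identity disappears on the circle.\<close>

lemma refl_lin_transvection:
  "refl_lin S1 (refl_lin S2 v) = transvection p v" "refl_lin S2 (refl_lin S3 v) = - transvection q v"
proof -
  obtain x y where v: "v = x *\<^sub>R p + y *\<^sub>R q" by (rule coords)
  show "refl_lin S1 (refl_lin S2 v) = transvection p v"
    unfolding v refl_lin_coords transvection_def by (simp add: wedge_pq algebra_simps)
  show "refl_lin S2 (refl_lin S3 v) = - transvection q v"
    unfolding v refl_lin_coords transvection_def by (simp add: wedge_qp algebra_simps)
qed

definition circle_refl :: "W3_gen \<Rightarrow> complex \<Rightarrow> complex" where
  "circle_refl i z = circ (refl_lin i (SOME v. v \<noteq> 0 \<and> circ v = z))"

text \<open>Two lifts of a point of the circle differ by a real factor, so the choice made in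
  \<open>circle_refl\<close> does not matter.\<close>

lemma circle_refl_circ: assumes "v \<noteq> 0" shows "circle_refl i (circ v) = circ (refl_lin i v)"
proof -
  define u where "u = (SOME u. u \<noteq> 0 \<and> circ u = circ v)"
  have u: "u \<noteq> 0 \<and> circ u = circ v" unfolding u_def by (rule someI[of _ v]) (simp add: assms)
  then have "wedge u v = 0" using circ_eq_iff assms by blast
  then obtain r where r: "v = r *\<^sub>R u" using wedge_zero_parallel u by blast
  have "r \<noteq> 0" using assms r by (cases "r = 0") simp_all
  have "circ (refl_lin i v) = circ (r *\<^sub>R refl_lin i u)"
    by (subst r) (simp only: refl_lin_scaleR)
  also have "\<dots> = circ (refl_lin i u)" using \<open>r \<noteq> 0\<close> by (rule circ_scaleR)
  also have "\<dots> = circle_refl i (circ v)" unfolding circle_refl_def u_def ..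
  finally show ?thesis ..
qed

lemma circle_refl_sphere: assumes "z \<in> sphere 0 1" shows "circle_refl i z \<in> sphere 0 1"
proof -
  obtain v where v: "v \<noteq> 0" "z = circ v" using circ_surj[OF assms] .
  show ?thesis unfolding v(2) circle_refl_circ[OF v(1)] by (rule circ_sphere[OF refl_lin_nonzero[OF v(1)]])
qed

lemma circle_refl_involutive: assumes "z \<in> sphere 0 1" shows "circle_refl i (circle_refl i z) = z"
proof -
  obtain v where v: "v \<noteq> 0" "z = circ v" using circ_surj[OF assms] .
  show ?thesis
    unfolding v(2) circle_refl_circ[OF v(1)] circle_refl_circ[OF refl_lin_nonzero[OF v(1)]] refl_lin_involutive ..
qed

lemma circle_refl_orientation:
  assumes "positively_oriented x y z"
  shows "positively_oriented (circle_refl i z) (circle_refl i y) (circle_refl i x)"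
proof -
  have s: "x \<in> sphere 0 1" "y \<in> sphere 0 1" "z \<in> sphere 0 1"
    using positively_oriented_sphere[OF assms] by blast+
  obtain u where u: "u \<noteq> 0" "x = circ u" using circ_surj[OF s(1)] .
  obtain v where v: "v \<noteq> 0" "y = circ v" using circ_surj[OF s(2)] .
  obtain w where w: "w \<noteq> 0" "z = circ w" using circ_surj[OF s(3)] .
  note uvw = u v w
  have "wedge u v * wedge v w * wedge u w > 0" using assms by (simp add: uvw positively_oriented_circ)
  then have "wedge w v * wedge v u * wedge w u < 0"
    by (simp add: wedge_swap[of w] wedge_swap[of v u] mult_ac)
  then show ?thesis
    by (simp add: uvw circle_refl_circ positively_oriented_circ refl_lin_nonzero wedge_refl_lin)
qed

primrec corner :: "W3_gen \<Rightarrow> complex" where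
  "corner S1 = q" | "corner S2 = p + q" | "corner S3 = p"

lemma p_q_nonzero: "p \<noteq> 0" "q \<noteq> 0" "p + q \<noteq> 0"
  using wedge_pq wedge_qp by (auto simp: add_eq_0_iff)

lemma circle_refl_corner: "j \<noteq> i \<Longrightarrow> circle_refl i (circ (corner j)) = circ (corner j)"
proof -
  have ci_minus: "circ (- v) = circ v" for v using circ_scaleR[of "-1" v] by simp
  assume "j \<noteq> i"
  then show ?thesis
    by (cases i; cases j) (simp_all add: circle_refl_circ p_q_nonzero wedge_pq wedge_qp ci_minus algebra_simps scaleR_2)
qed

lemma corner_oriented: "positively_oriented (circ (corner S1)) (circ (corner S2)) (circ (corner S3))"
  by (simp add: positively_oriented_circ p_q_nonzero wedge_pq wedge_qp)

text \<open>Lying between \<open>x\<close> and \<open>y\<close> is an open condition on the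
  coordinates of a vector. It holds at \<open>u + wedge u v *\<^sub>R v\<close>, where the weight
  selects the correct arc; a nearby rational vector is then cleared of denominators.\<close>

lemma int_points_dense:
  assumes "x \<in> sphere 0 1" "y \<in> sphere 0 1" "x \<noteq> y"
  obtains m n :: int where "(m, n) \<noteq> (0, 0)" "positively_oriented x (circ (of_int m *\<^sub>R p + of_int n *\<^sub>R q)) y"
proof -
  obtain u where u: "u \<noteq> 0" "x = circ u" using circ_surj[OF assms(1)] .
  obtain v where v: "v \<noteq> 0" "y = circ v" using circ_surj[OF assms(2)] .
  have uv: "wedge u v \<noteq> 0" using assms(3) u v by (simp add: circ_eq_iff)
  define F where "F z = (fst z * wedge u p + snd z * wedge u q) * (fst z * wedge p v + snd z * wedge q v) * wedge u v"
    for z :: "real \<times> real"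
  have F: "F (a, b) = wedge u (a *\<^sub>R p + b *\<^sub>R q) * wedge (a *\<^sub>R p + b *\<^sub>R q) v * wedge u v" for a b
    by (simp add: F_def)
  obtain a0 b0 where ab0: "u + wedge u v *\<^sub>R v = a0 *\<^sub>R p + b0 *\<^sub>R q" by (rule coords)
  have "F (a0, b0) = (wedge u v)\<^sup>2 * (wedge u v)\<^sup>2"
  proof -
    have "F (a0, b0) = wedge u (u + wedge u v *\<^sub>R v) * wedge (u + wedge u v *\<^sub>R v) v * wedge u v"
      by (simp only: F ab0)
    then show ?thesis by (simp add: power2_eq_square)
  qed
  then have F0: "F (a0, b0) > 0" using uv by (simp add: zero_less_mult_iff)
  have "continuous_on UNIV F"
    unfolding F_def by (intro continuous_intros)
  then have "open {z. F z > 0}"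
    by (intro open_Collect_less continuous_on_const)
  moreover have "(a0, b0) \<in> {z. F z > 0}" using F0 by simp
  ultimately obtain A B where AB': "open A" "open B" "(a0, b0) \<in> A \<times> B" "A \<times> B \<subseteq> {z. F z > 0}"
    by (rule open_prod_elim)
  then have AB: "open A" "open B" "a0 \<in> A" "b0 \<in> B" by simp_all
  have rat: "\<exists>r\<in>\<rat>. r \<in> S" if S: "open S" "s \<in> S" for S and s :: real
  proof -
    obtain e where e: "e > 0" "ball s e \<subseteq> S" using S by (rule openE)
    obtain r where "r \<in> \<rat>" "s < r" "r < s + e" using Rats_dense_in_real[of s "s + e"] e(1) by auto
    then show ?thesis using e(2) by (intro bexI[of _ r]) (auto simp: dist_real_def)
  qed
  obtain a b where ab: "a \<in> \<rat>" "a \<in> A" "b \<in> \<rat>" "b \<in> B" using rat[OF AB(1,3)] rat[OF AB(2,4)] by blast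
  obtain i j where ij: "j > 0" "a = of_int i / of_int j" using Rats_cases'[OF ab(1)] by blast
  obtain k l where kl: "l > 0" "b = of_int k / of_int l" using Rats_cases'[OF ab(3)] by blast
  define w where "w = a *\<^sub>R p + b *\<^sub>R q"
  have "F (a, b) > 0" using AB'(4) ab by auto
  then have pos: "wedge u w * wedge w v * wedge u v > 0" by (simp only: F w_def)
  then have w: "w \<noteq> 0" by (cases "w = 0") simp_all
  let ?w = "of_int (i * l) *\<^sub>R p + of_int (k * j) *\<^sub>R q"
  have eq: "?w = of_int (j * l) *\<^sub>R w"
    using ij kl by (simp add: w_def scaleR_add_right mult.commute)
  have jl: "of_int (j * l) \<noteq> (0 :: real)" using ij kl by simp
  have "circ ?w = circ w" unfolding eq by (rule circ_scaleR[OF jl])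
  moreover have "positively_oriented x (circ w) y"
    unfolding u(2) v(2) positively_oriented_circ[OF u(1) w v(1)] by (rule pos)
  moreover have "(i * l, k * j) \<noteq> (0, 0)"
  proof
    assume "(i * l, k * j) = (0, 0)"
    then have "i * l = 0" "k * j = 0" by (simp_all only: prod.inject)
    then have "?w = 0" by (simp only: of_int_0 scaleR_zero_left add_0)
    then show False unfolding eq using jl w by simp
  qed
  ultimately show ?thesis using that[of "i * l" "k * j"] by simp
qed

end

text \<open>The vertices of the tessellation are, up to scaling, all integer vectors: the reflections
  perform the Euclidean algorithm.\<close>

locale marked_triangle = marked_plane + reflection_triangle R C s V
  for R :: "complex \<times> 'l \<Rightarrow> complex \<times> 'l \<Rightarrow> complex \<times> 'l \<Rightarrow> bool" and C s V +
  assumes fst_s: "fst (s i x) = circle_refl i (fst x)" and fst_V: "fst (V e i) = circ (corner i)"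
begin

text \<open>Required for both colours, since reflections exchange them and the predicate is to be
  invariant under reflections.\<close>

definition cusp :: "int \<Rightarrow> int \<Rightarrow> bool" where
  "cusp m n \<longleftrightarrow> (\<forall>e. \<exists>l. (circ (of_int m *\<^sub>R p + of_int n *\<^sub>R q), l) \<in> vertices e)"

lemma cusp_vertex: assumes "r \<noteq> 0" "of_int m *\<^sub>R p + of_int n *\<^sub>R q = r *\<^sub>R corner i" shows "cusp m n"
  unfolding cusp_def
proof
  fix e
  have "V e i \<in> vertices e" by (auto simp: vertices_def)
  moreover have "V e i = (circ (of_int m *\<^sub>R p + of_int n *\<^sub>R q), snd (V e i))"
    using fst_V[of e i] assms by (simp add: circ_scaleR prod_eq_iff)
  ultimately show "\<exists>l. (circ (of_int m *\<^sub>R p + of_int n *\<^sub>R q), l) \<in> vertices e"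
    by (intro exI[of _ "snd (V e i)"]) simp
qed

lemma int_comb_nonzero: assumes "(m, n) \<noteq> (0, 0)" shows "of_int m *\<^sub>R p + of_int n *\<^sub>R q \<noteq> 0"
proof
  assume 0: "of_int m *\<^sub>R p + of_int n *\<^sub>R q = 0"
  then have "wedge p (of_int m *\<^sub>R p + of_int n *\<^sub>R q) = wedge p 0" "wedge (of_int m *\<^sub>R p + of_int n *\<^sub>R q) q = wedge 0 q"
    by (simp_all only:)
  then show False using assms by (simp add: wedge_pq)
qed

lemma cusp_reflect:
  assumes "cusp m n" "(m, n) \<noteq> (0, 0)"
    and "of_int m' *\<^sub>R p + of_int n' *\<^sub>R q = refl_lin i (of_int m *\<^sub>R p + of_int n *\<^sub>R q)"
  shows "cusp m' n'"
  unfolding cusp_def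
proof
  fix e
  obtain l where l: "(circ (of_int m *\<^sub>R p + of_int n *\<^sub>R q), l) \<in> vertices (\<not> e)"
    using assms(1) unfolding cusp_def by blast
  have "s i (circ (of_int m *\<^sub>R p + of_int n *\<^sub>R q), l) \<in> vertices e"
    using vertices_reflect[OF l, of i] by simp
  moreover have "fst (s i (circ (of_int m *\<^sub>R p + of_int n *\<^sub>R q), l)) = circ (of_int m' *\<^sub>R p + of_int n' *\<^sub>R q)"
    using int_comb_nonzero[OF assms(2)] by (simp add: fst_s circle_refl_circ assms(3))
  ultimately show "\<exists>l. (circ (of_int m' *\<^sub>R p + of_int n' *\<^sub>R q), l) \<in> vertices e"
    by (intro exI[of _ "snd (s i (circ (of_int m *\<^sub>R p + of_int n *\<^sub>R q), l))"]) (metis prod.collapse)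
qed

lemma cusp_uminus: "cusp m n \<Longrightarrow> cusp (- m) (- n)"
proof -
  have "of_int (- m) *\<^sub>R p + of_int (- n) *\<^sub>R q = (- 1) *\<^sub>R (of_int m *\<^sub>R p + of_int n *\<^sub>R q)"
    by (simp add: algebra_simps)
  then have "circ (of_int (- m) *\<^sub>R p + of_int (- n) *\<^sub>R q) = circ (of_int m *\<^sub>R p + of_int n *\<^sub>R q)"
    by (simp only:) (rule circ_scaleR, simp)
  then show "cusp m n \<Longrightarrow> cusp (- m) (- n)"
    unfolding cusp_def by (simp only: simp_thms)
qed

lemma cusp_S1:
  assumes "cusp (2 * n - m) n" "(m, n) \<noteq> (0, 0)" shows "cusp m n"
proof (rule cusp_reflect[OF assms(1)])
  show "((2 * n - m), n) \<noteq> (0, 0)" using assms(2) by auto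
  show "of_int m *\<^sub>R p + of_int n *\<^sub>R q = refl_lin S1 (of_int (2 * n - m) *\<^sub>R p + of_int n *\<^sub>R q)"
    unfolding refl_lin_coords by simp
qed

lemma cusp_S2:
  assumes "cusp (- m) n" "(m, n) \<noteq> (0, 0)" shows "cusp m n"
proof (rule cusp_reflect[OF assms(1)])
  show "((- m), n) \<noteq> (0, 0)" using assms(2) by auto
  show "of_int m *\<^sub>R p + of_int n *\<^sub>R q = refl_lin S2 (of_int (- m) *\<^sub>R p + of_int n *\<^sub>R q)"
    unfolding refl_lin_coords by simp
qed

lemma cusp_S3:
  assumes "cusp m (2 * m - n)" "(m, n) \<noteq> (0, 0)" shows "cusp m n"
proof (rule cusp_reflect[OF assms(1)])
  show "(m, (2 * m - n)) \<noteq> (0, 0)" using assms(2) by auto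
  show "of_int m *\<^sub>R p + of_int n *\<^sub>R q = refl_lin S3 (of_int m *\<^sub>R p + of_int (2 * m - n) *\<^sub>R q)"
    unfolding refl_lin_coords by simp
qed

text \<open>Descent on \<open>m + n\<close>. The larger coordinate, say \<open>m\<close>, is
  replaced by \<open>2 * n - m\<close>, which is smaller in absolute value; negative signs are
  removed by \<open>S2\<close>. It ends at multiples of \<open>q\<close>, \<open>p + q\<close> and
  \<open>p\<close>, so the vectors need not be primitive.\<close>

lemma cusp_nonneg: "m \<ge> 0 \<Longrightarrow> n \<ge> 0 \<Longrightarrow> (m, n) \<noteq> (0, 0) \<Longrightarrow> cusp m n"
proof (induction "nat (m + n)" arbitrary: m n rule: less_induct)
  case less
  have "m = 0 \<or> n = 0 \<or> (m = n \<and> n > 0) \<or> (m > n \<and> n > 0) \<or> (m < n \<and> m > 0)"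
    using less.prems(1,2) by linarith
  then consider "m = 0" | "n = 0" | "m = n" "n > 0" | "m > n" "n > 0" "2 * n - m \<ge> 0" | "m > n" "n > 0" "2 * n - m < 0"
    | "m < n" "m > 0" "2 * m - n \<ge> 0" | "m < n" "m > 0" "2 * m - n < 0"
    by (meson not_le)
  then show ?case
  proof cases
    case 1 then show ?thesis using less.prems by (intro cusp_vertex[of "of_int n" _ _ S1]) auto
  next
    case 2 then show ?thesis using less.prems by (intro cusp_vertex[of "of_int m" _ _ S3]) auto
  next
    case 3 then show ?thesis by (intro cusp_vertex[of "of_int m" _ _ S2]) (auto simp: scaleR_add_right)
  next
    case 4
    then have "cusp (2 * n - m) n" by (intro less.hyps) auto
    then show ?thesis by (rule cusp_S1) (use 4 in auto)
  next
    case 5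
    then have "cusp (- (2 * n - m)) n" by (intro less.hyps) auto
    then have "cusp (2 * n - m) n" by (rule cusp_S2) (use 5 in auto)
    then show ?thesis by (rule cusp_S1) (use 5 in auto)
  next
    case 6
    then have "cusp m (2 * m - n)" by (intro less.hyps) auto
    then show ?thesis by (rule cusp_S3) (use 6 in auto)
  next
    case 7
    then have "cusp m (n - 2 * m)" by (intro less.hyps) auto
    \<comment> \<open>Here the second coordinate would be negative, while \<open>S2\<close> negates
      the first; the global sign change makes up for this.\<close>
    then have "cusp (- (- m)) (n - 2 * m)" by simp
    then have "cusp (- m) (n - 2 * m)" by (rule cusp_S2) (use 7 in auto)
    then have "cusp m (2 * m - n)" using cusp_uminus[of "- m" "n - 2 * m"] by simp
    then show ?thesis by (rule cusp_S3) (use 7 in auto)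
  qed
qed

lemma cusp_all: assumes "(m, n) \<noteq> (0, 0)" shows "cusp m n"
proof -
  consider "m \<ge> 0" "n \<ge> 0" | "m \<le> 0" "n \<le> 0" | "m < 0" "n > 0" | "m > 0" "n < 0"
    by (meson not_le linear)
  then show ?thesis
  proof cases
    case 1 then show ?thesis using assms cusp_nonneg by blast
  next
    case 2
    then have "cusp (- m) (- n)" using assms by (intro cusp_nonneg) auto
    then show ?thesis using cusp_uminus[of "- m" "- n"] by simp
  next
    case 3
    then have "cusp (- m) n" by (intro cusp_nonneg) auto
    then show ?thesis using assms by (rule cusp_S2)
  next
    case 4
    then have "cusp m (- n)" by (intro cusp_nonneg) auto
    then have "cusp (- m) n" using cusp_uminus[of m "- n"] by simp
    then show ?thesis using assms by (rule cusp_S2)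
  qed
qed

lemma vertices_dense:
  assumes "x \<in> sphere 0 1" "y \<in> sphere 0 1" "x \<noteq> y"
  shows "\<exists>v\<in>vertices e. positively_oriented x (fst v) y"
proof -
  obtain m n :: int where mn: "(m, n) \<noteq> (0, 0)" "positively_oriented x (circ (of_int m *\<^sub>R p + of_int n *\<^sub>R q)) y"
    using int_points_dense[OF assms] .
  obtain l where "(circ (of_int m *\<^sub>R p + of_int n *\<^sub>R q), l) \<in> vertices e"
    using cusp_all[OF mn(1)] unfolding cusp_def by blast
  then show ?thesis using mn(2) by (intro bexI) simp_all
qed

end

section \<open>Labelled cusps and the equivariant map\<close>

lemma maximal_tuple_nth:
  "maximal_tuple ls \<Longrightarrow> i < j \<Longrightarrow> j < k \<Longrightarrow> k < length ls \<Longrightarrow> maximal_triple (ls ! i) (ls ! j) (ls ! k)"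
  by (simp add: maximal_tuple_def)

lemma cyc4_of_tuple:
  assumes "maximal_tuple ls" "i < j" "j < k" "k < m" "m < length ls"
  shows "cyc4 (ls ! i) (ls ! j) (ls ! k) (ls ! m)"
  unfolding cyc4_def using assms by (intro conjI maximal_tuple_nth) simp_all

definition joint_refl :: "('l \<Rightarrow> complex \<Rightarrow> complex) \<Rightarrow> ('l \<Rightarrow> real ^ (2 + 2) ^ (2 + 2)) \<Rightarrow> 'l \<Rightarrow> complex \<times> lag \<Rightarrow> complex \<times> lag" where
  "joint_refl f Rf i x = (f i (fst x), (*v) (Rf i) ` snd x)"

definition joint_cyclic :: "complex \<times> lag \<Rightarrow> complex \<times> lag \<Rightarrow> complex \<times> lag \<Rightarrow> bool" where
  "joint_cyclic x y z \<longleftrightarrow> positively_oriented (fst x) (fst y) (fst z) \<and> maximal_triple (snd x) (snd y) (snd z)"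

lemma image_involution:
  "R ** R = (mat 1 :: real ^ 'n ^ 'n) \<Longrightarrow> (*v) R ` (*v) R ` l = l"
  by (simp add: image_matrix_mult[symmetric])

theorem proposition7p14:
  fixes h :: "pants_gen word set \<Rightarrow> complex \<Rightarrow> complex"
    and \<phi> :: "pants_gen word set \<Rightarrow> W3_gen word set"
    and \<rho>' :: "W3_gen word set \<Rightarrow> (real ^ (2 + 2) ^ (2 + 2)) set"
  assumes "finite_area_hyperbolization h"
    and "\<phi> \<in> hom Gamma03 W3"
    and "\<phi> \<alpha> = s1 \<otimes>\<^bsub>W3\<^esub> s2"
    and "\<phi> \<beta> = s2 \<otimes>\<^bsub>W3\<^esub> s3"
    and "\<rho>' \<in> Hom_max_W3"
  shows "\<rho>' \<circ> \<phi> \<in> Hom_max_Shilov h"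
proof -
  interpret Gam: group Gamma03 by (rule group_Gamma03)
  interpret PSp_pm: group PSp_pm by (rule group_PSp_pm)
  define \<rho> where "\<rho> = \<rho>' \<circ> \<phi>"
  obtain P1 P2 Q1 Q2 R1 R2 X1 X2 Y1 Y2 Z1 Z2 where
    hom': "\<rho>' \<in> hom W3 PSp_pm"
    and PQR: "maximal_tuple [P1, P2, Q1, Q2, R1, R2]"
    and XYZ: "maximal_tuple [X1, X2, Y1, Y2, Z1, Z2]"
    and fixing: "reflection_fixing (\<rho>' s1) P1 P2" "reflection_fixing (\<rho>' s2) Q1 Q2" "reflection_fixing (\<rho>' s3) R1 R2"
    and swap: "act (\<rho>' s1) X1 = X2" "act (\<rho>' s1) Z1 = Z2" "act (\<rho>' s2) X1 = X2" "act (\<rho>' s2) Y1 = Y2"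
      "act (\<rho>' s3) Y1 = Y2" "act (\<rho>' s3) Z1 = Z2"
    using assms(5) unfolding Hom_max_W3_def mem_Collect_eq by (elim conjE exE) (rule that; assumption)
  define sg where "sg = case_W3_gen s1 s2 s3"
  define a where "a = case_W3_gen P1 Q1 R1"
  define b where "b = case_W3_gen P2 Q2 R2"
  have sg_carrier: "sg i \<in> carrier W3" for i
    by (cases i) (simp_all add: sg_def s1_def s2_def s3_def gen_def W3_def presented_group_def)
  have rho_sg: "\<rho>' (sg i) \<in> carrier PSp_pm" for i
    using hom' sg_carrier by (auto simp: hom_def)
  have fixing': "reflection_fixing (\<rho>' (sg i)) (a i) (b i)" for i
    using fixing by (cases i) (simp_all add: sg_def a_def b_def)
  have "\<exists>R. R \<in> \<rho>' (sg i) \<and> R \<in> Sp_minus \<and> R ** R = mat 1" for i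
    using fixing'[of i] unfolding reflection_fixing_def by blast
  then have ex: "\<forall>i. \<exists>R. R \<in> \<rho>' (sg i) \<and> R \<in> Sp_minus \<and> R ** R = mat 1" ..
  obtain Rf where "\<forall>i. Rf i \<in> \<rho>' (sg i) \<and> Rf i \<in> Sp_minus \<and> Rf i ** Rf i = mat 1"
    using choice[OF ex] by (rule exE)
  then have Rf0: "\<And>i. Rf i \<in> \<rho>' (sg i)" "\<And>i. Rf i \<in> Sp_minus" "\<And>i. Rf i ** Rf i = mat 1"
    by simp_all
  have rho_pm: "\<rho>' (sg i) = coset_pm (Rf i)" for i by (rule coset_pm_eqI[OF rho_sg Rf0(1)])
  interpret reflection_triple Rf by unfold_locales (fact Rf0)+
  have ab_Lag: "a i \<in> Lagrangians" "b i \<in> Lagrangians" for i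
    using maximal_triple_Lagrangians[OF maximal_tuple_nth[OF PQR, of 0 1 2]]
      maximal_triple_Lagrangians[OF maximal_tuple_nth[OF PQR, of 3 4 5]]
    by (cases i; simp add: a_def b_def)+
  have cyc_PQ: "cyc4 P1 P2 Q1 Q2" using cyc4_of_tuple[OF PQR, of 0 1 2 3] by simp
  have cyc_PR: "cyc4 P1 P2 R1 R2" using cyc4_of_tuple[OF PQR, of 0 1 4 5] by simp
  have cyc_QR: "cyc4 Q1 Q2 R1 R2" using cyc4_of_tuple[OF PQR, of 2 3 4 5] by simp
  interpret ping_pong Rf a b
  proof
    fix i j :: W3_gen
    have "act (coset_pm (Rf i)) (a i) = a i" "act (coset_pm (Rf i)) (b i) = b i"
      using fixing'[of i] unfolding rho_pm reflection_fixing_def by blast+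
    then show "(*v) (Rf i) ` a i = a i" "(*v) (Rf i) ` b i = b i"
      by (simp_all add: act_coset_pm Lagrangian_subspace ab_Lag)
    assume "i \<noteq> j"
    then show "cyc4 (a i) (b i) (a j) (b j)"
      using cyc_PQ cyc_PR cyc_QR cyc4_rotate[OF cyc4_rotate[OF cyc_PQ]]
        cyc4_rotate[OF cyc4_rotate[OF cyc_PR]] cyc4_rotate[OF cyc4_rotate[OF cyc_QR]]
      by (cases i; cases j) (simp_all add: a_def b_def)
  qed
  have hom: "\<rho> \<in> hom Gamma03 PSp_pm"
    unfolding \<rho>_def using assms(2) hom' by (rule hom_compose)
  interpret rho: group_hom Gamma03 PSp_pm \<rho>
    by unfold_locales (rule hom)
  note gens = t_gen_carrier[of S1, simplified] t_gen_carrier[of S3]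
  have beta: "\<beta> \<in> carrier Gamma03"
    by (simp add: \<beta>_def gen_def Gamma03_simps)
  have rho_gen: "\<rho> \<alpha> = coset_pm (mprod [S1, S2])" "\<rho> \<beta> = coset_pm (mprod [S2, S3])"
  proof -
    have "\<rho>' (sg i \<otimes>\<^bsub>W3\<^esub> sg j) = coset_pm (mprod [i, j])" for i j
      using hom' sg_carrier by (simp add: hom_mult rho_pm mult_PSp_pm)
    from this[of S1 S2] this[of S2 S3] show "\<rho> \<alpha> = coset_pm (mprod [S1, S2])" "\<rho> \<beta> = coset_pm (mprod [S2, S3])"
      by (simp_all add: \<rho>_def assms(3,4) sg_def)
  qed
  have inv_pm: "inv\<^bsub>PSp_pm\<^esub> (coset_pm (mprod [i, j])) = coset_pm (mprod [j, i])" for i j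
  proof (rule PSp_pm.inv_equality)
    have "mprod [j, i] ** mprod [i, j] = Rf j ** (Rf i ** Rf i) ** Rf j"
      by (simp add: matrix_mul_assoc)
    also have "\<dots> = mat 1" by (simp add: Rf0(3))
    finally show "coset_pm (mprod [j, i]) \<otimes>\<^bsub>PSp_pm\<^esub> coset_pm (mprod [i, j]) = \<one>\<^bsub>PSp_pm\<^esub>"
      by (simp add: mult_PSp_pm one_PSp_pm)
    show "coset_pm (mprod [i, j]) \<in> carrier PSp_pm" "coset_pm (mprod [j, i]) \<in> carrier PSp_pm"
      using mprod_Sp[of "[i, j]"] mprod_Sp[of "[j, i]"] by (simp_all add: carrier_PSp_pm)
  qed
  \<comment> \<open>The word records \<open>\<gamma>\<close> itself as well as its image, so
    nontriviality of \<open>\<gamma>\<close> can later rule out that the reduced word is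
    empty.\<close>
  have word: "\<exists>w. even (length w) \<and> \<gamma> = lift_word True w \<and> \<rho> \<gamma> = coset_pm (mprod w)"
    if "\<gamma> \<in> carrier Gamma03" for \<gamma>
    using that
  proof (induction rule: Gamma03_induct)
    case one
    then show ?case by (intro exI[of _ "[]"]) (simp add: one_PSp_pm)
  next
    case (step c \<gamma>)
    then obtain w where w: "even (length w)" "\<gamma> = lift_word True w" "\<rho> \<gamma> = coset_pm (mprod w)" by blast
    have "\<exists>i j. c = t_gen i \<otimes>\<^bsub>Gamma03\<^esub> inv\<^bsub>Gamma03\<^esub> t_gen j \<and> \<rho> c = coset_pm (mprod [i, j])"
      using step(1)
    proof (elim insertE emptyE)
      assume "c = \<alpha>"
      then show ?thesis using gens beta rho_gen by (intro exI[of _ S1] exI[of _ S2]) simp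
    next
      assume "c = inv\<^bsub>Gamma03\<^esub> \<alpha>"
      then show ?thesis using gens beta rho_gen inv_pm[of S1 S2]
        by (intro exI[of _ S2] exI[of _ S1]) (simp del: mprod.simps)
    next
      assume "c = \<beta>"
      then show ?thesis using gens beta rho_gen by (intro exI[of _ S2] exI[of _ S3]) simp
    next
      assume "c = inv\<^bsub>Gamma03\<^esub> \<beta>"
      then show ?thesis using gens beta rho_gen inv_pm[of S2 S3]
        by (intro exI[of _ S3] exI[of _ S2]) (simp del: mprod.simps)
    qed
    then obtain i j where c: "c = t_gen i \<otimes>\<^bsub>Gamma03\<^esub> inv\<^bsub>Gamma03\<^esub> t_gen j" "\<rho> c = coset_pm (mprod [i, j])" by blast
    have "\<rho> (c \<otimes>\<^bsub>Gamma03\<^esub> \<gamma>) = coset_pm (mprod ([i, j] @ w))"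
      using c step(2) w(3) by (simp only: mprod_append mult_PSp_pm[symmetric] rho.hom_mult[symmetric])
        (simp add: t_gen_carrier)
    moreover have "c \<otimes>\<^bsub>Gamma03\<^esub> \<gamma> = lift_word True ([i, j] @ w)"
      using c(1) w(2) by (simp add: Gam.m_assoc t_gen_carrier lift_word_carrier)
    ultimately show ?case using w(1) by (intro exI[of _ "[i, j] @ w"]) simp
  qed
  have rho_Sp: "\<exists>W\<in>Sp. \<rho> \<gamma> = coset_pm W" if \<gamma>: "\<gamma> \<in> carrier Gamma03" for \<gamma>
  proof -
    obtain w where "even (length w)" "\<rho> \<gamma> = coset_pm (mprod w)" using word[OF \<gamma>] by blast
    then show ?thesis using mprod_Sp[of w] by (intro bexI[of _ "mprod w"]) simp_all
  qed
  have hom_PSp: "\<rho> \<in> hom Gamma03 PSp"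
  proof (rule homI)
    fix x assume "x \<in> carrier Gamma03"
    then obtain W where "W \<in> Sp" "\<rho> x = coset_pm W" using rho_Sp by blast
    then show "\<rho> x \<in> carrier PSp" by (simp add: carrier_PSp)
  next
    fix x y assume xy: "x \<in> carrier Gamma03" "y \<in> carrier Gamma03"
    obtain U where "\<rho> x = coset_pm U" using rho_Sp[OF xy(1)] by blast
    moreover obtain V where "\<rho> y = coset_pm V" using rho_Sp[OF xy(2)] by blast
    ultimately show "\<rho> (x \<otimes>\<^bsub>Gamma03\<^esub> y) = \<rho> x \<otimes>\<^bsub>PSp\<^esub> \<rho> y"
      using rho.hom_mult[OF xy] by (simp add: mult_PSp mult_PSp_pm)
  qed
  have Shilov: "Shilov_hyperbolic (\<rho> \<gamma>)" if \<gamma>: "\<gamma> \<in> carrier Gamma03" "\<gamma> \<noteq> \<one>\<^bsub>Gamma03\<^esub>" for \<gamma>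
  proof -
    obtain w where w: "even (length w)" "\<gamma> = lift_word True w" "\<rho> \<gamma> = coset_pm (mprod w)"
      using word[OF \<gamma>(1)] by blast
    obtain w' where w': "distinct_adj w'" "even (length w') = even (length w)" "mprod w' = mprod w"
      "\<And>e. lift_word e w' = lift_word e w" using reduce_word[of w] by blast
    have "w' \<noteq> []"
    proof
      assume "w' = []"
      then have "\<gamma> = \<one>\<^bsub>Gamma03\<^esub>" using w'(4)[of True] w(2) by simp
      with \<gamma>(2) show False ..
    qed
    then have "Shilov_matrix (mprod w')" using w(1) w'(1,2) by (intro Shilov_mprod) simp_all
    then show ?thesis using w(3) w'(3) by (simp add: Shilov_hyperbolic_coset_pm)
  qed
  obtain p q where wedge: "wedge p q = - 2" and
    h\<alpha>: "\<And>v. v \<noteq> 0 \<Longrightarrow> h \<alpha> (circ v) = circ (transvection p v)" and h\<beta>: "\<And>v. v \<noteq> 0 \<Longrightarrow> h \<beta> (circ v) = circ (transvection q v)"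
    using hyperbolization_normal_form[OF assms(1)] by blast
  interpret marked_plane p q by unfold_locales (rule wedge)
  define lab where "lab e i = (if e then case_W3_gen Y2 Z2 X2 i else case_W3_gen Y1 Z1 X1 i)" for e i
  define V where "V e i = (circ (corner i), lab e i)" for e i
  define C where "C = sphere (0 :: complex) 1 \<times> (UNIV :: lag set)"
  define s where "s = joint_refl circle_refl Rf"
  have XYZ_Lag: "l \<in> Lagrangians" if "l \<in> {X1, X2, Y1, Y2, Z1, Z2}" for l
    using that maximal_triple_Lagrangians[OF maximal_tuple_nth[OF XYZ, of 0 1 2]]
      maximal_triple_Lagrangians[OF maximal_tuple_nth[OF XYZ, of 3 4 5]] by auto
  have swap': "(*v) (Rf S1) ` X1 = X2" "(*v) (Rf S1) ` Z1 = Z2" "(*v) (Rf S2) ` X1 = X2" "(*v) (Rf S2) ` Y1 = Y2"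
      "(*v) (Rf S3) ` Y1 = Y2" "(*v) (Rf S3) ` Z1 = Z2"
    using swap rho_pm[of S1] rho_pm[of S2] rho_pm[of S3] XYZ_Lag
    by (simp_all add: sg_def act_coset_pm Lagrangian_subspace)
  have swap_sym: "(*v) (Rf i) ` m = l" if "(*v) (Rf i) ` l = m" for i l m
    unfolding that[symmetric] by (rule image_involution[OF Rf0(3)])
  note swap'' = swap'[THEN swap_sym]
  interpret reflection_triangle joint_cyclic C s V
  proof
    fix x y z w :: "complex \<times> lag"
    show "joint_cyclic x y z \<Longrightarrow> joint_cyclic y z x"
      unfolding joint_cyclic_def
      using positively_oriented_rotate[of "fst x"] maximal_triple_rotate[of "snd x"] by blast
    show "joint_cyclic x y z \<Longrightarrow> joint_cyclic x z w \<Longrightarrow> joint_cyclic x y w"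
      unfolding joint_cyclic_def
      using positively_oriented_trans[of "fst x" "fst y" "fst z" "fst w"]
        maximal_triple_trans[of "snd x" "snd y" "snd z" "snd w"] by blast
    fix i j e
    show "V e i \<in> C"
      using circ_sphere[of "corner i"] p_q_nonzero by (cases i) (simp_all add: V_def C_def)
    show "x \<in> C \<Longrightarrow> s i x \<in> C"
      using circle_refl_sphere[of "fst x" i] by (simp add: C_def s_def joint_refl_def mem_Times_iff)
    show "x \<in> C \<Longrightarrow> s i (s i x) = x"
      using circle_refl_involutive[of "fst x" i] image_involution[OF Rf0(3)[of i]]
      by (simp add: C_def s_def joint_refl_def mem_Times_iff prod_eq_iff)
    show "joint_cyclic x y z \<Longrightarrow> joint_cyclic (s i z) (s i y) (s i x)"
      by (simp add: joint_cyclic_def s_def joint_refl_def circle_refl_orientation maximal_triple_Sp_minus[OF Rf0(2)])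
    show "s i (V e j) = V (\<not> e) j" if "j \<noteq> i"
      using circle_refl_corner[OF that] that
      by (cases i; cases j) (auto simp: s_def joint_refl_def V_def lab_def swap' swap'')
    have "maximal_triple X1 Y1 Z1" "maximal_triple X2 Y2 Z2"
      using maximal_tuple_nth[OF XYZ, of 0 2 4] maximal_tuple_nth[OF XYZ, of 1 3 5] by simp_all
    then have "maximal_triple (lab e S1) (lab e S2) (lab e S3)"
      using maximal_triple_rotate[of X1] maximal_triple_rotate[of X2] by (simp add: lab_def)
    then show "joint_cyclic (V e S1) (V e S2) (V e S3)"
      using corner_oriented by (simp add: joint_cyclic_def V_def)
  qed
  interpret marked_triangle p q joint_cyclic C s V
    by unfold_locales (simp_all add: s_def joint_refl_def V_def)
  \<comment> \<open>One colour class, preserved by products of two reflections.\<close>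
  define G where "G = vertices True"
  interpret G: monotone_dense G
  proof
    fix x assume "x \<in> G"
    then have "x \<in> C" using vertices_C unfolding G_def by blast
    then show "fst x \<in> sphere 0 1" unfolding C_def by (rule mem_Times_iff[THEN iffD1, THEN conjunct1])
  next
    fix x y z assume xyz: "x \<in> G" "y \<in> G" "z \<in> G" and pos: "positively_oriented (fst x) (fst y) (fst z)"
    have "x \<noteq> y" "y \<noteq> z" "x \<noteq> z" using positively_oriented_distinct[OF pos] by auto
    \<comment> \<open>One of the two joint orders holds; the second would contradict the given
      orientation of the points.\<close>
    then have "joint_cyclic x y z \<or> joint_cyclic x z y"
      using vertices_total xyz unfolding G_def by blast
    then show "maximal_triple (snd x) (snd y) (snd z)"
      using positively_oriented_asym[OF pos] by (auto simp: joint_cyclic_def)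
  next
    fix x y :: complex assume "x \<in> sphere 0 1" "y \<in> sphere 0 1" "x \<noteq> y"
    then show "\<exists>g\<in>G. positively_oriented x (fst g) y" unfolding G_def by (rule vertices_dense)
  qed
  \<comment> \<open>The map is described twice: as a transvection it is onto the circle and
    preserves orientation, and as a product of two reflections it preserves the labelled
    cusps.\<close>
  have equiv_gen: "(\<forall>x\<in>sphere 0 1. f x \<in> sphere 0 1 \<and> G.\<xi> (f x) = (*v) (mprod [i, j]) ` G.\<xi> x) \<and> f ` sphere 0 1 = sphere 0 1"
    if f: "\<And>v. v \<noteq> 0 \<Longrightarrow> f (circ v) = circ (transvection r v)" "\<And>v. v \<noteq> 0 \<Longrightarrow> f (circ v) = circle_refl i (circle_refl j (circ v))"
    for f i j r
  proof -
    have f_sph: "f x \<in> sphere 0 1" if sx: "x \<in> sphere 0 1" for x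
    proof -
      obtain v where "v \<noteq> 0" "x = circ v" using circ_surj[OF sx] .
      then show ?thesis using f(1) circ_sphere[of "transvection r v"] by simp
    qed
    have f_surj: "f ` sphere 0 1 = sphere 0 1"
    proof
      show "f ` sphere 0 1 \<subseteq> sphere 0 1" using f_sph by blast
      show "sphere 0 1 \<subseteq> f ` sphere 0 1"
      proof
        fix x :: complex assume "x \<in> sphere 0 1"
        then obtain v where v: "v \<noteq> 0" "x = circ v" using circ_surj by blast
        let ?u = "v + wedge r v *\<^sub>R r"
        have "?u \<noteq> 0" using v(1) transvection_inverse[of r v] transvection_eq_0_iff[of r ?u] by auto
        then have "f (circ ?u) = x" using f(1) by (simp only: transvection_inverse v(2) not_False_eq_True)
        then show "x \<in> f ` sphere 0 1" using circ_sphere[OF \<open>?u \<noteq> 0\<close>] by blast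
      qed
    qed
    have f_pos: "positively_oriented (f x) (f y) (f z) \<longleftrightarrow> positively_oriented x y z"
      if sxyz: "x \<in> sphere 0 1" "y \<in> sphere 0 1" "z \<in> sphere 0 1" for x y z
    proof -
      obtain u where u: "u \<noteq> 0" "x = circ u" using circ_surj[OF sxyz(1)] .
      obtain v where v: "v \<noteq> 0" "y = circ v" using circ_surj[OF sxyz(2)] .
      obtain w where w: "w \<noteq> 0" "z = circ w" using circ_surj[OF sxyz(3)] .
      show ?thesis using u v w by (simp add: f(1) positively_oriented_circ wedge_transvection)
    qed
    have fG: "(f (fst x), (*v) (mprod [i, j]) ` snd x) \<in> G" if xG: "x \<in> G" for x
    proof -
      obtain v where v: "v \<noteq> 0" "fst x = circ v" using circ_surj[OF G.G_sphere[OF xG]] .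
      have "s i (s j x) \<in> vertices True"
        using vertices_reflect[OF vertices_reflect[OF xG[unfolded G_def], of j], of i] by simp
      moreover have "s i (s j x) = (f (fst x), (*v) (mprod [i, j]) ` snd x)"
        by (simp add: s_def joint_refl_def v(2) f(2)[OF v(1)] image_matrix_mult)
      ultimately show ?thesis by (simp only: G_def)
    qed
    have "mprod [i, j] \<in> Sp" using mprod_Sp[of "[i, j]"] by simp
    from G.\<xi>_equivariant[OF this f_sph f_pos f_surj fG] show ?thesis using f_sph f_surj by blast
  qed
  \<comment> \<open>For beta the product of the linear reflections is minus the
    transvection.\<close>
  have ci_minus: "circ (- v) = circ v" for v using circ_scaleR[of "-1" v] by simp
  have eq\<alpha>: "(\<forall>x\<in>sphere 0 1. h \<alpha> x \<in> sphere 0 1 \<and> G.\<xi> (h \<alpha> x) = (*v) (mprod [S1, S2]) ` G.\<xi> x) \<and> h \<alpha> ` sphere 0 1 = sphere 0 1"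
    by (rule equiv_gen[OF h\<alpha>]) (simp_all add: h\<alpha> circle_refl_circ refl_lin_nonzero refl_lin_transvection del: refl_lin.simps)
  have eq\<beta>: "(\<forall>x\<in>sphere 0 1. h \<beta> x \<in> sphere 0 1 \<and> G.\<xi> (h \<beta> x) = (*v) (mprod [S2, S3]) ` G.\<xi> x) \<and> h \<beta> ` sphere 0 1 = sphere 0 1"
    by (rule equiv_gen[OF h\<beta>]) (simp_all add: h\<beta> circle_refl_circ refl_lin_nonzero refl_lin_transvection ci_minus del: refl_lin.simps)
  interpret h: group_action Gamma03 "cball 0 1" h
    using assms(1) unfolding finite_area_hyperbolization_def by (rule conjunct1)
  define D where "D c \<longleftrightarrow> (\<forall>x\<in>sphere 0 1. h c x \<in> sphere 0 1 \<and> G.\<xi> (h c x) = act (\<rho> c) (G.\<xi> x))" for c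
  have sub: "subspace (G.\<xi> x)" if "x \<in> sphere 0 1" for x
    using G.\<xi>_Lagrangian[OF that] by (rule Lagrangian_subspace)
  have sph_cball: "x \<in> cball 0 1" if "x \<in> sphere (0 :: complex) 1" for x using that by simp
  have D_inv: "D (inv\<^bsub>Gamma03\<^esub> c)"
    if c: "c \<in> carrier Gamma03" "\<rho> c = coset_pm (mprod [i, j])"
      "(\<forall>x\<in>sphere 0 1. h c x \<in> sphere 0 1 \<and> G.\<xi> (h c x) = (*v) (mprod [i, j]) ` G.\<xi> x) \<and> h c ` sphere 0 1 = sphere 0 1"
    for c i j
    unfolding D_def
  proof
    fix x :: complex assume x: "x \<in> sphere 0 1"
    \<comment> \<open>Surjectivity of \<open>h c\<close> on the circle moves the question to
      \<open>y\<close>, where equivariance under \<open>c\<close> is known;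
      \<open>mprod [j, i]\<close> then undoes \<open>mprod [i, j]\<close>.\<close>
    then obtain y where y: "y \<in> sphere 0 1" "x = h c y" using c(3) by blast
    have hx: "h (inv\<^bsub>Gamma03\<^esub> c) x = y"
      using h.orbit_sym_aux[OF c(1) sph_cball[OF y(1)] HOL.refl] y(2) by simp
    have "\<rho> (inv\<^bsub>Gamma03\<^esub> c) = coset_pm (mprod [j, i])"
      using c(1,2) inv_pm by (simp del: mprod.simps)
    then have "act (\<rho> (inv\<^bsub>Gamma03\<^esub> c)) (G.\<xi> x) = (*v) (mprod [j, i]) ` (*v) (mprod [i, j]) ` G.\<xi> y"
      using sub[OF x] c(3) y by (simp add: act_coset_pm del: mprod.simps)
    also have "\<dots> = G.\<xi> y"
      by (simp add: image_matrix_mult image_involution[OF Rf0(3)])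
    finally show "h (inv\<^bsub>Gamma03\<^esub> c) x \<in> sphere 0 1 \<and> G.\<xi> (h (inv\<^bsub>Gamma03\<^esub> c) x) = act (\<rho> (inv\<^bsub>Gamma03\<^esub> c)) (G.\<xi> x)"
      using y(1) by (simp only: hx simp_thms)
  qed
  have D_gen: "D c" if "c \<in> {\<alpha>, inv\<^bsub>Gamma03\<^esub> \<alpha>, \<beta>, inv\<^bsub>Gamma03\<^esub> \<beta>}" for c
  proof -
    have "D \<alpha>" unfolding D_def using eq\<alpha> sub by (simp add: rho_gen act_coset_pm del: mprod.simps mem_sphere_0)
    moreover have "D \<beta>" unfolding D_def using eq\<beta> sub by (simp add: rho_gen act_coset_pm del: mprod.simps mem_sphere_0)
    moreover have "D (inv\<^bsub>Gamma03\<^esub> \<alpha>)" using gens(1) rho_gen(1) eq\<alpha> by (rule D_inv)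
    moreover have "D (inv\<^bsub>Gamma03\<^esub> \<beta>)" using beta rho_gen(2) eq\<beta> by (rule D_inv)
    ultimately show ?thesis using that by blast
  qed
  have gen_carrier: "c \<in> carrier Gamma03" if "c \<in> {\<alpha>, inv\<^bsub>Gamma03\<^esub> \<alpha>, \<beta>, inv\<^bsub>Gamma03\<^esub> \<beta>}" for c
    using that gens(1) beta by auto
  have D: "D \<gamma>" if "\<gamma> \<in> carrier Gamma03" for \<gamma>
    using that
  proof (induction rule: Gamma03_induct)
    case one
    have "h \<one>\<^bsub>Gamma03\<^esub> x = x" if "x \<in> cball 0 1" for x
      using that by (simp only: h.id_eq_one[symmetric] restrict_apply')
    then show ?case unfolding D_def by (simp add: one_PSp_pm act_coset_pm sub)
  next
    case (step c \<gamma>)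
    show ?case
      unfolding D_def
    proof
      fix x :: complex assume x: "x \<in> sphere 0 1"
      have hx: "h \<gamma> x \<in> sphere 0 1" "G.\<xi> (h \<gamma> x) = act (\<rho> \<gamma>) (G.\<xi> x)" using step(3) x unfolding D_def by blast+
      have hc: "h c (h \<gamma> x) \<in> sphere 0 1" "G.\<xi> (h c (h \<gamma> x)) = act (\<rho> c) (G.\<xi> (h \<gamma> x))"
        using D_gen[OF step(1)] hx(1) unfolding D_def by blast+
      obtain U where U: "\<rho> c = coset_pm U" using rho_Sp gen_carrier[OF step(1)] by blast
      obtain W where W: "\<rho> \<gamma> = coset_pm W" using rho_Sp step(2) by blast
      have 1: "act (\<rho> c) (G.\<xi> (h \<gamma> x)) = (*v) U ` G.\<xi> (h \<gamma> x)" unfolding U by (rule act_coset_pm[OF sub[OF hx(1)]])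
      have 2: "G.\<xi> (h \<gamma> x) = (*v) W ` G.\<xi> x" unfolding hx(2) W by (rule act_coset_pm[OF sub[OF x]])
      have "(*v) U ` (*v) W ` G.\<xi> x = act (\<rho> (c \<otimes>\<^bsub>Gamma03\<^esub> \<gamma>)) (G.\<xi> x)"
        using gen_carrier[OF step(1)] step(2) by (simp add: U W mult_PSp_pm act_coset_pm sub[OF x] image_matrix_mult)
      then have "act (\<rho> c) (G.\<xi> (h \<gamma> x)) = act (\<rho> (c \<otimes>\<^bsub>Gamma03\<^esub> \<gamma>)) (G.\<xi> x)"
        unfolding 1 unfolding 2 .
      then show "h (c \<otimes>\<^bsub>Gamma03\<^esub> \<gamma>) x \<in> sphere 0 1 \<and> G.\<xi> (h (c \<otimes>\<^bsub>Gamma03\<^esub> \<gamma>) x) = act (\<rho> (c \<otimes>\<^bsub>Gamma03\<^esub> \<gamma>)) (G.\<xi> x)"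
        using hc h.composition_rule[OF sph_cball[OF x] gen_carrier[OF step(1)] step(2)] by simp
    qed
  qed
  have "maximal_representation h \<rho>"
    unfolding maximal_representation_def
  proof (intro conjI hom_PSp exI[of _ G.\<xi>] funcsetI ballI allI impI)
    show "G.\<xi> x \<in> Lagrangians" if "x \<in> sphere 0 1" for x by (rule G.\<xi>_Lagrangian[OF that])
    show "G.\<xi> (h \<gamma> x) = act (\<rho> \<gamma>) (G.\<xi> x)" if "\<gamma> \<in> carrier Gamma03" "x \<in> sphere 0 1" for \<gamma> x
      using D[OF that(1)] that(2) unfolding D_def by blast
    show "maximal_triple (G.\<xi> x) (G.\<xi> y) (G.\<xi> z)" if "positively_oriented x y z" for x y z
      by (rule G.\<xi>_monotone[OF that])
    show "limitin lag_topology (\<lambda>s. G.\<xi> (cis s)) (G.\<xi> (cis t)) (at_right t)" for t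
      by (rule G.\<xi>_right_continuous)
  qed
  then have "\<rho> \<in> Hom_max_Shilov h" unfolding Hom_max_Shilov_def using Shilov by simp
  then show ?thesis by (simp only: \<rho>_def)
qed

end
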